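(* Let $k$ be a positive integer, let $\alpha_1, \dots, \alpha_k > 0$ be real numbers such that $\alpha_i/\alpha_j$ is irrational whenever $i \neq j$, and let $\beta_1, \dots, \beta_k$ be real numbers. For $n$ chosen uniformly at random from $[N] = \{1, \dots, N\}$, the random vector \[ \left(\frac{\omega(\lfloor \alpha_1 n + \beta_1\rfloor) - \log\log N}{\sqrt{\log\log N}}, \dots, \frac{\omega(\lfloor \alpha_k n + \beta_k\rfloor) - \log\log N}{\sqrt{\log\log N}}\right) \] converges in distribution to the standard $k$-dimensional Gaussian $\mathcal{N}(0, I_k)$ as $N \to \infty$.
   Context: $\omega(m)$ denotes the number of distinct prime divisors of an integer $m$. $I_k$ is the $k\times k$ identity matrix. *)

theory Defs
  imports "HOL-Probability.Probability"
begin

(* The value at 0 is irrelevant below; here it is 0, since prime_factors 0 = {}. *)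
definition omega :: "int \<Rightarrow> nat" where
  "omega m = card (prime_factors m)"

(* The library's weak_conv_m is restricted to measures on the real line. *)
definition converges_in_distribution ::
  "(nat \<Rightarrow> 'a::topological_space measure) \<Rightarrow> 'a measure \<Rightarrow> bool" where
  "converges_in_distribution \<mu> \<nu> \<longleftrightarrow>
    (\<forall>f :: 'a \<Rightarrow> real. continuous_on UNIV f \<longrightarrow> bounded (range f) \<longrightarrow>
       (\<lambda>N. integral\<^sup>L (\<mu> N) f) \<longlonglongrightarrow> integral\<^sup>L \<nu> f)"

(* N(m, S) through its Lebesgue density; meaningful for symmetric positive definite S. *)
definition gaussian :: "real^'k \<Rightarrow> real^'k^'k \<Rightarrow> (real^'k) measure" where
  "gaussian m S = density lborel (\<lambda>x.
     ennreal (exp (- ((x - m) \<bullet> (matrix_inv S *v (x - m))) / 2)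
              / sqrt ((2 * pi) ^ CARD('k) * det S)))"

definition normalized_omega :: "real^'k \<Rightarrow> real^'k \<Rightarrow> nat \<Rightarrow> nat \<Rightarrow> real^'k" where
  "normalized_omega \<alpha> \<beta> N n =
     (\<chi> i. (real (omega \<lfloor>\<alpha> $ i * real n + \<beta> $ i\<rfloor>) - ln (ln (real N))) / sqrt (ln (ln (real N))))"

end

theory Submission
  imports Defs "HOL-Number_Theory.Cong" "HOL-Real_Asymp.Real_Asymp"
begin

text \<open>Dirichlet's theorem gives \<open>q \<le> sqrt N\<close> and integers \<open>a\<^sub>i\<close> with \<open>q \<alpha>\<^sub>i\<close> so close
  to \<open>a\<^sub>i\<close> that, for all but \<open>o(N)\<close> of the \<open>n \<le> N\<close>, the values
  \<open>\<lfloor>\<alpha>\<^sub>i (n + q s) + \<beta>\<^sub>i\<rfloor> = a\<^sub>i s + c\<^sub>i\<close> are exactly linear in \<open>s\<close> on a block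
  \<open>s < S\<close> whose length \<open>S\<close> is a fixed power of \<open>N\<close>. So no quantitative equidistribution of
  \<open>\<alpha>\<^sub>i n\<close> is needed, and it suffices to prove the theorem on blocks. Irrationality of
  \<open>\<alpha>\<^sub>i / \<alpha>\<^sub>j\<close> enters only to see that \<open>a\<^sub>i c\<^sub>j \<noteq> a\<^sub>j c\<^sub>i\<close> for most \<open>n\<close>. The primes
  dividing some \<open>a\<^sub>i\<close> or \<open>a\<^sub>i c\<^sub>j - a\<^sub>j c\<^sub>i\<close> have reciprocal sum \<open>O(log log log N)\<close>, and the
  primes beyond \<open>y = N\<^bsup>o(1)\<^esup>\<close> contribute \<open>O(log N / log y)\<close> to \<open>\<omega>\<close>; both are negligible
  against \<open>sqrt (log log N)\<close>. For every other prime the \<open>k\<close> linear forms have distinct roots,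
  so the characteristic function is that of a sum of independent vectors by the Chinese
  remainder theorem, up to errors that are controlled because products of boundedly many such
  primes are much shorter than \<open>S\<close>.\<close>

section \<open>Reciprocal sums of primes\<close>

text \<open>Dirichlet's theorem gives no arithmetic control over the \<open>a i\<close>: they may
  have many prime factors, and a prime dividing both \<open>a i\<close> and \<open>c i\<close>
  divides every value in the block. Such primes cannot be averaged out inside a block; they are rare
  only on average over \<open>n\<close>, which is why the error of a single block keeps a term
  depending on \<open>n\<close>. Inside a block \<open>cis\<close> is replaced by a Taylor
  polynomial of fixed degree \<open>2 * K - 1\<close>. The powers that occur then involve only
  periods up to a fixed power of \<open>y\<close>, and the remainder is of order
  \<open>1 / 4 ^ K\<close> with a constant depending only on the frequency vector. So
  \<open>N\<close> goes to infinity first, for fixed \<open>K\<close>, and \<open>K\<close>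
  afterwards. At most one \<open>\<alpha> $ i\<close> can be rational. It needs its own argument,
  since \<open>\<alpha> $ i * n + \<beta> $ i\<close> may then be close to an integer for a positive
  proportion of the \<open>n\<close>. Errors of size o(sqrt (log log N)) are harmless, so sums of
  \<open>1 / p\<close> are estimated by Euler products, with a loss of order log log log N in the
  upper bound.\<close>

definition primes_le :: "real \<Rightarrow> nat set" where
  "primes_le x = {p. prime p \<and> real p \<le> x}"

definition prime_recip_sum :: "real \<Rightarrow> real" where
  "prime_recip_sum x = (\<Sum>p\<in>primes_le x. 1 / real p)"

lemma finite_primes_le [simp]: "finite (primes_le x)"
proof (rule finite_subset)
  show "primes_le x \<subseteq> {..nat \<lfloor>x\<rfloor>}"
    by (auto simp: primes_le_def le_nat_floor)
qed simp

lemma sum_inverse_squares_primes_le: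
  assumes "finite A" "\<And>p. p \<in> A \<Longrightarrow> prime p"
  shows "(\<Sum>p\<in>A. 1 / (real p)\<^sup>2) \<le> 1"
proof -
  have tele: "(\<Sum>p\<in>{2..Suc n}. 1 / (real p)\<^sup>2) \<le> 1 - 1 / real (Suc n)" for n
  proof (induction n)
    case (Suc n)
    have "{2..Suc (Suc n)} = insert (Suc (Suc n)) {2..Suc n}" by auto
    hence "(\<Sum>p\<in>{2..Suc (Suc n)}. 1 / (real p)\<^sup>2)
        \<le> 1 - 1 / real (Suc n) + 1 / (real (Suc (Suc n)))\<^sup>2"
      using Suc by simp
    also have "1 / (real (Suc (Suc n)))\<^sup>2 \<le> 1 / real (Suc n) - 1 / real (Suc (Suc n))"
      by (simp add: divide_simps power2_eq_square)
    finally show ?case by simp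
  qed simp
  have "A \<subseteq> {2..Suc (Max A)}"
    using assms by (auto intro!: prime_ge_2_nat le_SucI Max_ge)
  hence "(\<Sum>p\<in>A. 1 / (real p)\<^sup>2) \<le> (\<Sum>p\<in>{2..Suc (Max A)}. 1 / (real p)\<^sup>2)"
    by (intro sum_mono2) auto
  also have "\<dots> \<le> 1 - 1 / real (Suc (Max A))" by (rule tele)
  also have "\<dots> \<le> 1" by simp
  finally show ?thesis .
qed

text \<open>Euler's argument: expanding the product of truncated geometric series gives reciprocals
  of all numbers composed of primes up to \<open>n\<close> with exponents up to \<open>n\<close>,
  and every \<open>m \<le> n\<close> is among them.\<close>

lemma harm_le_prod_primes:
  "harm n \<le> (\<Prod>p\<in>{p. prime p \<and> p \<le> n}. 1 / (1 - 1 / real p))"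
proof -
  define A where "A = {p. prime p \<and> p \<le> n}"
  define \<phi> where "\<phi> e = (\<Prod>p\<in>A. p ^ e p)" for e :: "nat \<Rightarrow> nat"
  define E where "E = PiE A (\<lambda>_. {..n})"
  have fin: "finite A" by (auto simp: A_def)
  have finE: "finite E" by (auto simp: E_def fin intro!: finite_PiE)
  have sub: "{1..n} \<subseteq> \<phi> ` E"
  proof
    fix m assume m: "m \<in> {1..n}"
    define e where "e = restrict (\<lambda>p. multiplicity p m) A"
    have "multiplicity p m \<le> n" if "p \<in> A" for p
    proof -
      have p: "prime p" using that by (auto simp: A_def)
      have "p ^ multiplicity p m dvd m" by (rule multiplicity_dvd)
      hence "p ^ multiplicity p m \<le> m" using m by (auto intro: dvd_imp_le)
      moreover have "multiplicity p m < 2 ^ multiplicity p m" by (rule less_exp)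
      moreover have "2 ^ multiplicity p m \<le> p ^ multiplicity p m"
        using prime_ge_2_nat[OF p] by (intro power_mono) auto
      ultimately show ?thesis using m unfolding atLeastAtMost_iff by linarith
    qed
    hence "e \<in> E" by (auto simp: e_def E_def)
    moreover have "\<phi> e = m"
    proof -
      have "\<phi> e = (\<Prod>p\<in>A. p ^ multiplicity p m)"
        by (auto simp: \<phi>_def e_def intro!: prod.cong)
      also have "\<dots> = (\<Prod>p\<in>prime_factors m. p ^ multiplicity p m)"
      proof (rule prod.mono_neutral_right[OF fin])
        show "prime_factors m \<subseteq> A"
        proof
          fix p assume "p \<in> prime_factors m"
          hence "prime p" "p \<le> m" using m by (auto simp: in_prime_factors_iff intro!: dvd_imp_le)
          thus "p \<in> A" using m by (auto simp: A_def)
        qed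
        show "\<forall>p\<in>A - prime_factors m. p ^ multiplicity p m = 1"
        proof
          fix p assume p: "p \<in> A - prime_factors m"
          hence "\<not> p dvd m" using m by (auto simp: A_def in_prime_factors_iff)
          thus "p ^ multiplicity p m = 1" by (simp add: not_dvd_imp_multiplicity_0)
        qed
      qed
      also have "\<dots> = m" using m by (simp add: prod_prime_factors)
      finally show ?thesis .
    qed
    ultimately show "m \<in> \<phi> ` E" by blast
  qed
  have "harm n = (\<Sum>m\<in>{1..n}. 1 / real m)" by (simp add: harm_def divide_inverse)
  also have "\<dots> \<le> (\<Sum>m\<in>\<phi> ` E. 1 / real m)"
    using sub finE by (intro sum_mono2) auto
  also have "\<dots> \<le> sum ((\<lambda>m. 1 / real m) \<circ> \<phi>) E"
    using finE by (intro sum_image_le) auto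
  also have "\<dots> = (\<Sum>e\<in>E. \<Prod>p\<in>A. (1 / real p) ^ e p)"
    by (simp add: \<phi>_def prod_dividef power_one_over)
  also have "\<dots> = (\<Prod>p\<in>A. \<Sum>j\<le>n. (1 / real p) ^ j)"
    using fin by (simp add: E_def prod_sum_PiE)
  also have "\<dots> \<le> (\<Prod>p\<in>A. 1 / (1 - 1 / real p))"
  proof (rule prod_mono)
    fix p assume "p \<in> A"
    hence p: "real p \<ge> 2" using prime_ge_2_nat by (auto simp: A_def)
    have "(\<Sum>j\<le>n. (1 / real p) ^ j) = (1 - (1 / real p) ^ Suc n) / (1 - 1 / real p)"
      using p by (subst sum_gp0) auto
    also have "\<dots> \<le> 1 / (1 - 1 / real p)"
      using p by (intro divide_right_mono) auto
    finally show "0 \<le> (\<Sum>j\<le>n. (1 / real p) ^ j) \<and> (\<Sum>j\<le>n. (1 / real p) ^ j) \<le> 1 / (1 - 1 / real p)"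
      by (auto intro!: sum_nonneg)
  qed
  finally show ?thesis by (simp add: A_def)
qed

text \<open>Logarithm of Euler's bound. Each factor costs at most \<open>1 / p + 2 / p^2\<close>
  because \<open>p\<close> is at least 2, and the inverse squares sum to at most 1, whence the
  constant 2.\<close>

lemma prime_recip_sum_ge:
  assumes "x > 1"
  shows "prime_recip_sum x \<ge> ln (ln x) - 2"
proof -
  define n where "n = nat \<lfloor>x\<rfloor>"
  have A: "{p. prime p \<and> p \<le> n} = primes_le x"
    using assms by (auto simp: n_def primes_le_def le_nat_iff le_floor_iff)
  have "ln x \<le> ln (real n + 1)"
  proof (subst ln_le_cancel_iff)
    show "x \<le> real n + 1" using assms unfolding n_def by linarith
  qed (use assms in auto)
  also have "\<dots> \<le> harm n" by (rule ln_le_harm)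
  also have "\<dots> \<le> (\<Prod>p\<in>primes_le x. 1 / (1 - 1 / real p))"
    using harm_le_prod_primes[of n] A by simp
  finally have le: "ln x \<le> (\<Prod>p\<in>primes_le x. 1 / (1 - 1 / real p))" .
  have pos: "1 / (1 - 1 / real p) > 0" if "p \<in> primes_le x" for p
    using that prime_gt_1_nat[of p] by (auto simp: primes_le_def)
  have "ln (ln x) \<le> ln (\<Prod>p\<in>primes_le x. 1 / (1 - 1 / real p))"
    using le assms by (intro ln_mono) auto
  also have "\<dots> = (\<Sum>p\<in>primes_le x. ln (1 / (1 - 1 / real p)))"
    by (intro ln_prod finite_primes_le less_imp_neq[THEN not_sym] pos)
  also have "\<dots> \<le> (\<Sum>p\<in>primes_le x. 1 / real p + 2 * (1 / (real p)\<^sup>2))"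
  proof (rule sum_mono)
    fix p assume p: "p \<in> primes_le x"
    hence p2: "real p \<ge> 2" using prime_ge_2_nat by (auto simp: primes_le_def)
    have "ln (1 / (1 - 1 / real p)) \<le> 1 / (1 - 1 / real p) - 1"
      using pos[OF p] by (rule ln_le_minus_one)
    also have "\<dots> \<le> 1 / real p + 2 * (1 / (real p)\<^sup>2)"
      using p2 by (simp add: field_simps power2_eq_square)
    finally show "ln (1 / (1 - 1 / real p)) \<le> 1 / real p + 2 * (1 / (real p)\<^sup>2)" .
  qed
  also have "\<dots> = prime_recip_sum x + 2 * (\<Sum>p\<in>primes_le x. 1 / (real p)\<^sup>2)"
    by (simp add: sum.distrib prime_recip_sum_def sum_distrib_left)
  also have "(\<Sum>p\<in>primes_le x. 1 / (real p)\<^sup>2) \<le> 1"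
    by (intro sum_inverse_squares_primes_le finite_primes_le) (simp add: primes_le_def)
  finally show ?thesis by simp
qed

text \<open>Comparison with the integral of \<open>t powr (- 1 - \<epsilon>)\<close>, run as an
  induction: the subtracted endpoint term makes the bound telescope. Each step reduces to
  \<open>1 + \<epsilon> / (a + 1) \<le> ((a + 1) / a) powr \<epsilon>\<close>.\<close>

lemma sum_powr_le:
  fixes \<epsilon> :: real
  assumes "\<epsilon> > 0"
  shows "(\<Sum>m\<in>{1..Suc n}. real m powr (- 1 - \<epsilon>)) \<le> 1 + (1 - real (Suc n) powr (- \<epsilon>)) / \<epsilon>"
proof (induction n)
  case (Suc n)
  define a where "a = real (Suc n)"
  have a: "a > 0" by (simp add: a_def)
  have key: "(a + 1) powr (- 1 - \<epsilon>) \<le> (a powr (- \<epsilon>) - (a + 1) powr (- \<epsilon>)) / \<epsilon>"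
  proof -
    have "ln (a / (a + 1)) \<le> a / (a + 1) - 1"
      using a by (intro ln_le_minus_one) auto
    hence "1 / (a + 1) \<le> ln ((a + 1) / a)"
      using a by (simp add: ln_div field_simps)
    hence "1 + \<epsilon> * (1 / (a + 1)) \<le> 1 + \<epsilon> * ln ((a + 1) / a)"
      using assms by (intro add_left_mono mult_left_mono) auto
    also have "\<dots> \<le> exp (\<epsilon> * ln ((a + 1) / a))" by (rule exp_ge_add_one_self)
    also have "\<dots> = a powr (- \<epsilon>) / (a + 1) powr (- \<epsilon>)"
      using a by (simp add: powr_def ln_div exp_diff [symmetric] algebra_simps)
    finally have "(1 + \<epsilon> * (1 / (a + 1))) * (a + 1) powr (- \<epsilon>) \<le> a powr (- \<epsilon>)"
      using a by (simp add: pos_le_divide_eq)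
    moreover have "(a + 1) powr (- 1 - \<epsilon>) = 1 / (a + 1) * (a + 1) powr (- \<epsilon>)"
      using a by (simp add: powr_diff powr_minus divide_inverse)
    ultimately show ?thesis using assms by (simp add: algebra_simps pos_le_divide_eq)
  qed
  have "{1..Suc (Suc n)} = insert (Suc (Suc n)) {1..Suc n}" by auto
  hence "(\<Sum>m\<in>{1..Suc (Suc n)}. real m powr (- 1 - \<epsilon>)) 
      \<le> 1 + (1 - a powr (- \<epsilon>)) / \<epsilon> + (a + 1) powr (- 1 - \<epsilon>)"
    using Suc by (simp add: a_def algebra_simps)
  also have "\<dots> \<le> 1 + (1 - (a + 1) powr (- \<epsilon>)) / \<epsilon>"
    using key by (simp add: diff_divide_distrib)
  finally show ?case by (simp add: a_def algebra_simps)
qed simp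

text \<open>\<open>T\<close> is recovered from its product as the set of primes dividing it.\<close>

lemma inj_on_prod_primes:
  "inj_on (\<lambda>T. \<Prod>T) (Pow {p::nat. prime p} \<inter> Collect finite)"
proof (rule inj_onI)
  fix S T :: "nat set"
  assume ST: "S \<in> Pow {p. prime p} \<inter> Collect finite" "T \<in> Pow {p. prime p} \<inter> Collect finite" "\<Prod>S
      = \<Prod>T"
  have *: "{p. prime p \<and> p dvd \<Prod>U} = U" if "finite U" "U \<subseteq> {p. prime p}" for U :: "nat set"
  proof -
    have "p \<in> U" if p: "prime p" "p dvd \<Prod>U" for p
    proof -
      obtain q where "q \<in> U" "p dvd q"
        using p \<open>finite U\<close> by (auto simp: prime_dvd_prod_iff)
      thus ?thesis using p \<open>U \<subseteq> _\<close> primes_dvd_imp_eq by blast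
    qed
    thus ?thesis using that by (auto intro: dvd_prodI)
  qed
  have "S = {p. prime p \<and> p dvd \<Prod>S}" using *[of S] ST(1) by simp
  also have "\<dots> = {p. prime p \<and> p dvd \<Prod>T}" by (simp only: ST(3))
  also have "\<dots> = T" using *[of T] ST(2) by simp
  finally show "S = T" .
qed

text \<open>Multiplied out, the product is a sum over squarefree numbers, each occurring once, so it
  is dominated by an initial segment of the zeta series at \<open>1 + \<epsilon>\<close>.\<close>

lemma prod_one_plus_powr_primes_le:
  fixes \<epsilon> :: real
  assumes "\<epsilon> > 0" "finite A" "\<And>p. p \<in> A \<Longrightarrow> prime p"
  shows "(\<Prod>p\<in>A. 1 + real p powr (- 1 - \<epsilon>)) \<le> 1 + 1 / \<epsilon>"
proof -
  have "(\<Prod>p\<in>A. 1 + real p powr (- 1 - \<epsilon>)) = (\<Sum>T\<in>Pow A. \<Prod>p\<in>T. real p powr (- 1 - \<epsilon>))"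
    using prod_add[OF assms(2), of "\<lambda>p. real p powr (- 1 - \<epsilon>)" "\<lambda>_. 1"] by (simp add: add.commute)
  also have "\<dots> = (\<Sum>T\<in>Pow A. real (\<Prod>T) powr (- 1 - \<epsilon>))"
    by (intro sum.cong) (auto simp: prod_powr_distrib)
  also have "\<dots> = (\<Sum>m\<in>(\<lambda>T. \<Prod>T) ` Pow A. real m powr (- 1 - \<epsilon>))"
    using assms
    by (subst sum.reindex) (auto intro!: inj_on_subset[OF inj_on_prod_primes] dest: finite_subset)
  also have "\<dots> \<le> (\<Sum>m\<in>{1..Suc (\<Prod>A)}. real m powr (- 1 - \<epsilon>))"
  proof (rule sum_mono2)
    show "(\<lambda>T. \<Prod>T) ` Pow A \<subseteq> {1..Suc (\<Prod>A)}"
    proof safe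
      fix T assume "T \<subseteq> A"
      have posA: "\<Prod>A > 0" using assms prime_gt_0_nat by (intro prod_pos) auto
      have "\<Prod>T dvd \<Prod>A" using \<open>T \<subseteq> A\<close> assms by (intro prod_dvd_prod_subset) auto
      hence "\<Prod>T \<le> \<Prod>A" using posA by (rule dvd_imp_le)
      moreover have "\<Prod>T > 0" using \<open>T \<subseteq> A\<close> assms prime_gt_0_nat by (intro prod_pos) auto
      ultimately show "\<Prod>T \<in> {1..Suc (\<Prod>A)}" by auto
    qed
  qed auto
  also have "\<dots> \<le> 1 + (1 - real (Suc (\<Prod>A)) powr (- \<epsilon>)) / \<epsilon>"
    by (rule sum_powr_le) fact
  also have "\<dots> \<le> 1 + 1 / \<epsilon>" using assms by (simp add: field_simps)
  finally show ?thesis .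
qed

text \<open>Rankin's trick with \<open>\<epsilon> = 1 / (K * ln x)\<close>: damping
  \<open>1 / p\<close> to \<open>p powr (- 1 - \<epsilon>)\<close> loses at most the factor
  \<open>1 - 1 / K\<close> for \<open>p \<le> x\<close>, and the damped sum is controlled by the
  Euler product at \<open>1 + \<epsilon>\<close>. The parameter stays free: \<open>K = 2\<close>
  serves where a constant factor is harmless, a slowly growing \<open>K\<close> where the leading
  constant must be 1.\<close>

lemma prime_recip_sum_le:
  assumes "x > 1" "K > 1"
  shows "(1 - 1 / K) * prime_recip_sum x \<le> ln (1 + K * ln x) + 1"
proof -
  define \<epsilon> where "\<epsilon> = 1 / (K * ln x)"
  have \<epsilon>: "\<epsilon> > 0" using assms by (simp add: \<epsilon>_def)
  define u where "u p = real p powr (- 1 - \<epsilon>)" for p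
  have u: "0 < u p" "u p \<le> 1 / real p" "(1 - 1 / K) * (1 / real p) \<le> u p"
    if "p \<in> primes_le x" for p
  proof -
    have p: "real p \<ge> 2" "real p \<le> x" using that prime_ge_2_nat by (auto simp: primes_le_def)
    show "0 < u p" using p by (simp add: u_def)
    have eq: "u p = 1 / real p * exp (- \<epsilon> * ln p)"
      using p by (simp add: u_def powr_def exp_diff exp_minus field_simps)
    have lp: "0 \<le> ln p" "ln p \<le> ln x" using p by auto
    show "u p \<le> 1 / real p" using p lp \<epsilon> by (simp add: eq mult_left_le_one_le divide_right_mono)
    have "\<epsilon> * ln p \<le> \<epsilon> * ln x" using lp \<epsilon> by simp
    also have "\<dots> = 1 / K" using assms by (simp add: \<epsilon>_def)
    finally have "1 - 1 / K \<le> 1 + (- \<epsilon> * ln p)" by simp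
    also have "\<dots> \<le> exp (- \<epsilon> * ln p)" by (rule exp_ge_add_one_self)
    finally show "(1 - 1 / K) * (1 / real p) \<le> u p"
      using p by (simp add: eq divide_right_mono)
  qed
  have pos: "1 + u p > 0" if "p \<in> primes_le x" for p
    using u(1)[OF that] by linarith
  \<comment> \<open>The 1 subtracted here bounds the sum of \<open>1 / p^2\<close>, which pays for
    \<open>ln (1 + u) \<ge> u - u^2\<close> below.\<close>
  have "(1 - 1 / K) * prime_recip_sum x - 1
      \<le> (\<Sum>p\<in>primes_le x. u p) - (\<Sum>p\<in>primes_le x. 1 / (real p)\<^sup>2)"
  proof (rule diff_mono)
    show "(\<Sum>p\<in>primes_le x. 1 / (real p)\<^sup>2) \<le> 1"
      by (intro sum_inverse_squares_primes_le finite_primes_le) (simp add: primes_le_def)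
    show "(1 - 1 / K) * prime_recip_sum x \<le> (\<Sum>p\<in>primes_le x. u p)"
      unfolding prime_recip_sum_def sum_distrib_left by (intro sum_mono u(3))
  qed
  also have "\<dots> = (\<Sum>p\<in>primes_le x. u p - (1 / real p)\<^sup>2)"
    by (simp add: sum_subtractf power_divide)
  also have "\<dots> \<le> (\<Sum>p\<in>primes_le x. ln (1 + u p))"
  proof (rule sum_mono)
    fix p assume p: "p \<in> primes_le x"
    have "p \<ge> 1" using p prime_ge_1_nat by (auto simp: primes_le_def)
    hence "1 / real p \<le> 1" by simp
    hence "u p \<le> 1" using u(2)[OF p] by linarith
    have "u p - (1 / real p)\<^sup>2 \<le> u p - (u p)\<^sup>2"
      using u[OF p] by (intro diff_left_mono power_mono) auto
    also have "\<dots> \<le> ln (1 + u p)"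
      using u[OF p] \<open>u p \<le> 1\<close> by (intro ln_one_plus_pos_lower_bound) auto
    finally show "u p - (1 / real p)\<^sup>2 \<le> ln (1 + u p)" .
  qed
  also have "\<dots> = ln (\<Prod>p\<in>primes_le x. 1 + u p)"
    by (intro ln_prod [symmetric] finite_primes_le less_imp_neq[THEN not_sym] pos)
  also have "\<dots> \<le> ln (1 + K * ln x)"
  proof (rule ln_mono)
    have "(\<Prod>p\<in>primes_le x. 1 + u p) \<le> 1 + 1 / \<epsilon>"
      unfolding u_def
      by (rule prod_one_plus_powr_primes_le[OF \<epsilon> finite_primes_le]) (simp add: primes_le_def)
    thus "(\<Prod>p\<in>primes_le x. 1 + u p) \<le> 1 + K * ln x" by (simp add: \<epsilon>_def)
    show "(\<Prod>p\<in>primes_le x. 1 + u p) > 0" by (intro prod_pos pos)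
  qed
  finally show ?thesis by linarith
qed

section \<open>Averages of periodic functions\<close>

definition avg :: "nat \<Rightarrow> (nat \<Rightarrow> 'a::real_normed_field) \<Rightarrow> 'a" where
  "avg n f = (\<Sum>s<n. f s) / of_nat n"

text \<open>Any period counts, not only the least one, so that periods can be enlarged to common
  multiples. The degenerate \<open>m = 0\<close> is excluded wherever \<open>m\<close> divides a
  positive \<open>D\<close>.\<close>

definition has_period :: "nat \<Rightarrow> (nat \<Rightarrow> 'a) \<Rightarrow> bool" where
  "has_period m f \<longleftrightarrow> (\<forall>s. f (s + m) = f s)"

lemma avg_add: "avg n (\<lambda>s. f s + g s) = avg n f + avg n g"
  by (simp add: avg_def sum.distrib add_divide_distrib)

lemma avg_diff: "avg n (\<lambda>s. f s - g s) = avg n f - avg n g"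
  by (simp add: avg_def sum_subtractf diff_divide_distrib)

lemma avg_cmult: "avg n (\<lambda>s. c * f s) = c * avg n f"
  by (simp add: avg_def sum_distrib_left [symmetric])

lemma avg_sum: "avg n (\<lambda>s. \<Sum>i\<in>A. f i s) = (\<Sum>i\<in>A. avg n (f i))"
  unfolding avg_def by (subst sum.swap) (simp add: sum_divide_distrib)

lemma avg_const: "n > 0 \<Longrightarrow> avg n (\<lambda>_. c) = c"
  by (simp add: avg_def)

lemma avg_of_real: "avg n (\<lambda>s. of_real (f s)) = of_real (avg n f)"
  by (simp add: avg_def)

lemma norm_avg_le: "norm (avg n f) \<le> avg n (\<lambda>s. norm (f s))"
proof -
  have "norm (avg n f) = norm (\<Sum>s<n. f s) / real n" by (simp add: avg_def norm_divide)
  also have "\<dots> \<le> (\<Sum>s<n. norm (f s)) / real n" by (intro divide_right_mono norm_sum) auto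
  finally show ?thesis by (simp add: avg_def)
qed

lemma avg_mono:
  fixes f g :: "nat \<Rightarrow> real"
  shows "(\<And>s. s < n \<Longrightarrow> f s \<le> g s) \<Longrightarrow> avg n f \<le> avg n g"
  unfolding avg_def by (intro divide_right_mono sum_mono) auto

lemma avg_nonneg:
  fixes f :: "nat \<Rightarrow> real"
  shows "(\<And>s. f s \<ge> 0) \<Longrightarrow> avg n f \<ge> 0"
  unfolding avg_def by (intro divide_nonneg_nonneg sum_nonneg) auto

lemma has_period_mod: "has_period m f \<Longrightarrow> f (s mod m) = f s"
proof -
  assume p: "has_period m f"
  have "f (t + k * m) = f t" for t k
  proof (induction k)
    case (Suc k)
    have "f (t + Suc k * m) = f (t + k * m + m)" by (simp add: algebra_simps)
    thus ?case using p Suc by (simp add: has_period_def)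
  qed simp
  from this[of "s mod m" "s div m"] show ?thesis by (simp add: mod_div_mult_eq)
qed

lemma has_period_iff_mod: "has_period m f \<longleftrightarrow> (\<forall>s. f s = f (s mod m))"
  by (metis has_period_def has_period_mod mod_add_self2)

lemma has_period_dvd: "has_period m f \<Longrightarrow> m dvd n \<Longrightarrow> has_period n f"
  unfolding has_period_iff_mod by (metis mod_mod_cancel)

lemma has_period_mult:
  fixes f g :: "nat \<Rightarrow> 'a::times"
  shows "has_period m f \<Longrightarrow> has_period m g \<Longrightarrow> has_period m (\<lambda>s. f s * g s)"
  by (simp add: has_period_def)

lemma has_period_comp: "has_period m f \<Longrightarrow> has_period m (\<lambda>s. h (f s))"
  by (simp add: has_period_def)

lemma sum_lessThan_add:
  "(\<Sum>s<m + n. f s) = (\<Sum>s<m. f s) + (\<Sum>s<n. f (m + s))" for f :: "nat \<Rightarrow> 'a::comm_monoid_add"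
  by (induction n) (auto simp: add_ac)

lemma sum_has_period_multiple:
  fixes f :: "nat \<Rightarrow> 'a::real_normed_field"
  assumes "has_period m f"
  shows "(\<Sum>s<k * m. f s) = of_nat k * (\<Sum>s<m. f s)"
proof (induction k)
  case (Suc k)
  have "(\<Sum>s<Suc k * m. f s) = (\<Sum>s<k * m. f s) + (\<Sum>s<m. f (k * m + s))"
    by (subst sum_lessThan_add [symmetric]) (simp add: add.commute)
  also have "(\<Sum>s<m. f (k * m + s)) = (\<Sum>s<m. f s)"
  proof (rule sum.cong)
    fix s assume "s \<in> {..<m}"
    thus "f (k * m + s) = f s"
      using has_period_mod[OF assms, of "k * m + s"] by simp
  qed simp
  finally show ?case using Suc by (simp add: algebra_simps)
qed simp

lemma avg_has_period_multiple:
  fixes f :: "nat \<Rightarrow> 'a::real_normed_field"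
  assumes "has_period m f" "m dvd D" "D > 0"
  shows "avg D f = avg m f"
proof -
  obtain k where k: "D = k * m" using assms(2) by (auto simp: dvd_def mult.commute)
  show ?thesis using assms(3) by (simp add: avg_def k sum_has_period_multiple[OF assms(1)])
qed

text \<open>Complete periods average exactly; only the last \<open>S mod m\<close> terms deviate,
  and both these terms and the mean they are compared with are bounded by \<open>B\<close>, hence
  the factor 2. Allowing any multiple \<open>D\<close> of \<open>m\<close> lets functions of
  different periods share one reference average.\<close>

lemma avg_has_period_approx:
  fixes f :: "nat \<Rightarrow> 'a::real_normed_field"
  assumes "has_period m f" "m dvd D" "D > 0" "S > 0" and B: "\<And>s. norm (f s) \<le> B"
  shows "norm (avg S f - avg D f) \<le> 2 * B * m / S"
proof -
  define r where "r = S mod m"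
  define R where "R = (\<Sum>s<r. f (S div m * m + s))"
  have m: "m > 0" using assms by (intro Nat.gr0I) auto
  have rm: "real r \<le> real m" using m by (simp add: r_def less_imp_le)
  have nonneg: "B \<ge> 0" using norm_ge_zero B[of 0] by (rule order_trans)
  have S: "S = S div m * m + r" by (simp add: r_def)
  have "(\<Sum>s<S. f s) = of_nat (S div m) * (\<Sum>s<m. f s) + R"
    by (subst S, subst sum_lessThan_add, subst sum_has_period_multiple[OF assms(1)])
        (simp add: R_def)
  also have "(\<Sum>s<m. f s) = of_nat m * avg m f" using m by (simp add: avg_def)
  also have "of_nat (S div m) * (of_nat m * avg m f) + R
      = of_nat (S div m * m + r) * avg m f + (R - of_nat r * avg m f)"
    by (simp add: algebra_simps)
  also have "S div m * m + r = S" using S by simp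
  finally have eq: "(\<Sum>s<S. f s) = of_nat S * avg m f + (R - of_nat r * avg m f)" .
  have "avg S f - avg D f = (R - of_nat r * avg m f) / of_nat S"
    using \<open>S > 0\<close> avg_has_period_multiple[OF assms(1-3)]
    by (simp add: avg_def[of S] eq field_simps)
  moreover have "norm (R - of_nat r * avg m f) \<le> 2 * B * m"
  proof -
    have "norm R \<le> real r * B"
      unfolding R_def using sum_norm_bound[of "{..<r}" "\<lambda>s. f (S div m * m + s)" B] B by simp
    moreover have "norm (avg m f) \<le> B"
      using order_trans[OF norm_avg_le, of m f, OF avg_mono[OF B]] m by (simp add: avg_const)
    hence "norm (of_nat r * avg m f) \<le> real r * B"
      by (simp add: norm_mult mult_left_mono)
    ultimately have "norm (R - of_nat r * avg m f) \<le> real r * B + real r * B"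
      by (rule order_trans[OF norm_triangle_ineq4 add_mono])
    also have "\<dots> = 2 * B * real r" by simp
    also have "\<dots> \<le> 2 * B * m" using rm nonneg by (intro mult_left_mono) auto
    finally show ?thesis .
  qed
  ultimately show ?thesis by (simp add: norm_divide divide_right_mono)
qed

text \<open>Chinese remainder theorem: the pair of residues takes every value exactly once, so
  functions of the two residues are independent.\<close>

lemma avg_mult_coprime:
  fixes f g :: "nat \<Rightarrow> 'a::real_normed_field"
  assumes "has_period a f" "has_period b g" "coprime a b" "a > 0" "b > 0"
  shows "avg (a * b) (\<lambda>s. f s * g s) = avg a f * avg b g"
proof -
  have bij: "bij_betw (\<lambda>s. (s mod a, s mod b)) {..<a * b} ({..<a} \<times> {..<b})"
  proof (rule bij_betw_imageI)
    show inj: "inj_on (\<lambda>s. (s mod a, s mod b)) {..<a * b}"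
    proof (rule inj_onI)
      fix s t assume st: "s \<in> {..<a * b}" "t \<in> {..<a * b}" "(s mod a, s mod b) = (t mod a, t mod b)"
      hence "[s = t] (mod a * b)" using assms(3) by (intro coprime_cong_mult_nat)
          (simp_all add: cong_def)
      thus "s = t" using st by (simp add: cong_def)
    qed
    show "(\<lambda>s. (s mod a, s mod b)) ` {..<a * b} = {..<a} \<times> {..<b}"
      using assms by (intro card_subset_eq) (auto simp: card_image[OF inj])
  qed
  have "(\<Sum>s<a * b. f s * g s) = (\<Sum>s<a * b. (\<lambda>(u, v). f u * g v) (s mod a, s mod b))"
    by (simp add: has_period_mod[OF assms(1)] has_period_mod[OF assms(2)])
  also have "\<dots> = (\<Sum>(u, v)\<in>{..<a} \<times> {..<b}. f u * g v)"
    by (rule sum.reindex_bij_betw[OF bij])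
  also have "\<dots> = (\<Sum>u<a. f u) * (\<Sum>v<b. g v)"
    by (simp add: sum_product sum.cartesian_product)
  finally show ?thesis by (simp add: avg_def)
qed

text \<open>The period is proved in the same induction as the mean, because the inductive step needs
  it for the product over the remaining primes.\<close>

lemma avg_prod_primes:
  fixes f :: "nat \<Rightarrow> nat \<Rightarrow> 'a::real_normed_field"
  assumes "finite P" "\<And>p. p \<in> P \<Longrightarrow> prime p" "\<And>p. p \<in> P \<Longrightarrow> has_period p (f p)"
  shows "avg (\<Prod>P) (\<lambda>s. \<Prod>p\<in>P. f p s) = (\<Prod>p\<in>P. avg p (f p)) \<and> has_period (\<Prod>P) (\<lambda>s. \<Prod>p\<in>P. f p s)"
  using assms
proof (induction P rule: finite_induct)
  case empty
  show ?case by (simp add: avg_def has_period_def)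
next
  case (insert q P)
  have cop: "coprime q (\<Prod>P)"
    using insert by (intro prod_coprime_right primes_coprime) auto
  have pos: "q > 0" "\<Prod>P > 0" using insert.prems(1) prime_gt_0_nat by (auto intro!: prod_pos)
  have IH: "avg (\<Prod>P) (\<lambda>s. \<Prod>p\<in>P. f p s) = (\<Prod>p\<in>P. avg p (f p))"
    "has_period (\<Prod>P) (\<lambda>s. \<Prod>p\<in>P. f p s)"
    using insert by auto
  have perq: "has_period q (f q)" using insert.prems by simp
  have "has_period (q * \<Prod>P) (\<lambda>s. f q s * (\<Prod>p\<in>P. f p s))"
    by (intro has_period_mult has_period_dvd[OF perq] has_period_dvd[OF IH(2)]) simp_all
  moreover have "avg (q * \<Prod>P) (\<lambda>s. f q s * (\<Prod>p\<in>P. f p s)) = avg q (f q) * (\<Prod>p\<in>P. avg p (f p))"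
    using avg_mult_coprime[OF perq IH(2) cop pos] IH(1) by simp
  ultimately show ?case using insert.hyps by simp
qed

text \<open>One factor of the power is expanded at a time and absorbed into \<open>h\<close>, which
  is why \<open>h\<close> is general and has its own period and bound. Each expansion has
  \<open>card P\<close> terms, multiplies the period by at most \<open>y\<close> and the bound by
  \<open>\<Theta>\<close>; these three make up the base of the power on the right.\<close>

lemma avg_power_sum_approx:
  fixes h :: "nat \<Rightarrow> real" and g :: "nat \<Rightarrow> nat \<Rightarrow> real" and y :: real
  assumes "finite P" "D > 0" "S > 0"
    and per: "\<And>p. p \<in> P \<Longrightarrow> has_period p (g p)" and dvd: "\<And>p. p \<in> P \<Longrightarrow> p dvd D"
    and le: "\<And>p. p \<in> P \<Longrightarrow> real p \<le> y" and bd: "\<And>p s. p \<in> P \<Longrightarrow> \<bar>g p s\<bar> \<le> \<Theta>"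
    and h: "has_period m h" "m dvd D" "\<And>s. \<bar>h s\<bar> \<le> B"
    and nonneg: "\<Theta> \<ge> 0" "y \<ge> 0"
  shows "\<bar>avg S (\<lambda>s. h s * (\<Sum>p\<in>P. g p s) ^ j) - avg D (\<lambda>s. h s * (\<Sum>p\<in>P. g p s) ^ j)\<bar>
           \<le> 2 * B * m / S * (card P * y * \<Theta>) ^ j"
  using h
proof (induction j arbitrary: h m B)
  case 0
  thus ?case using avg_has_period_approx[of m h D S B] assms(2,3) by simp
next
  case (Suc j)
  let ?\<Delta> = "\<lambda>p. avg S (\<lambda>s. (h s * g p s) * (\<Sum>p\<in>P. g p s) ^ j)
               - avg D (\<lambda>s. (h s * g p s) * (\<Sum>p\<in>P. g p s) ^ j)"
  have B: "B \<ge> 0" using Suc.prems(3)[of 0] by linarith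
  have dist: "avg n (\<lambda>s. h s * (\<Sum>p\<in>P. g p s) ^ Suc j)
      = (\<Sum>p\<in>P. avg n (\<lambda>s. (h s * g p s) * (\<Sum>p\<in>P. g p s) ^ j))" for n
  proof -
    have "h s * (\<Sum>p\<in>P. g p s) ^ Suc j = (\<Sum>p\<in>P. (h s * g p s) * (\<Sum>p\<in>P. g p s) ^ j)" for s
      by (simp add: sum_distrib_left sum_distrib_right mult_ac)
    thus ?thesis by (simp only: avg_sum)
  qed
  have "\<bar>avg S (\<lambda>s. h s * (\<Sum>p\<in>P. g p s) ^ Suc j) - avg D (\<lambda>s. h s * (\<Sum>p\<in>P. g p s) ^ Suc j)\<bar>
      \<le> (\<Sum>p\<in>P. \<bar>?\<Delta> p\<bar>)"
    unfolding dist sum_subtractf [symmetric] by (rule sum_abs)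
  also have "\<dots> \<le> (\<Sum>p\<in>P. 2 * (B * \<Theta>) * (m * y) / S * (card P * y * \<Theta>) ^ j)"
  proof (rule sum_mono)
    fix p assume p: "p \<in> P"
    have "\<bar>?\<Delta> p\<bar>
          \<le> 2 * (B * \<Theta>) * lcm m p / S * (card P * y * \<Theta>) ^ j"
    proof (rule Suc.IH)
      show "has_period (lcm m p) (\<lambda>s. h s * g p s)"
        by (intro has_period_mult has_period_dvd[OF Suc.prems(1)] has_period_dvd[OF per[OF p]])
            simp_all
      show "lcm m p dvd D" using Suc.prems(2) dvd[OF p] by (rule lcm_least)
      show "\<bar>h s * g p s\<bar> \<le> B * \<Theta>" for s
        unfolding abs_mult using Suc.prems(3) bd[OF p] B by (intro mult_mono) auto
    qed
    also have "real (lcm m p) \<le> m * y"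
    proof -
      have "m > 0" using Suc.prems(2) assms(2) by (intro Nat.gr0I) auto
      moreover have "p > 0" using dvd[OF p] assms(2) by (intro Nat.gr0I) auto
      ultimately have "lcm m p \<le> m * p" by (intro dvd_imp_le lcm_least) auto
      hence "real (lcm m p) \<le> real m * real p" by (simp flip: of_nat_mult)
      also have "\<dots> \<le> m * y" using le[OF p] by (intro mult_left_mono) auto
      finally show ?thesis .
    qed
    hence "2 * (B * \<Theta>) * lcm m p / S * (card P * y * \<Theta>) ^ j 
        \<le> 2 * (B * \<Theta>) * (m * y) / S * (card P * y * \<Theta>) ^ j"
      using B nonneg by (intro mult_right_mono divide_right_mono mult_left_mono) auto
    finally show "\<bar>?\<Delta> p\<bar>
          \<le> 2 * (B * \<Theta>) * (m * y) / S * (card P * y * \<Theta>) ^ j" .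
  qed
  also have "\<dots> = 2 * B * m / S * (card P * y * \<Theta>) ^ Suc j"
    by (simp add: field_simps)
  finally show ?case .
qed

section \<open>Moments and characteristic functions of sums over primes\<close>

lemma power_div_fact_le_exp:
  fixes x :: real
  assumes "x \<ge> 0"
  shows "x ^ n / fact n \<le> exp x"
proof -
  have "(\<Sum>k\<in>{n}. x ^ k /\<^sub>R fact k) \<le> (\<Sum>k. x ^ k /\<^sub>R fact k)"
    using assms by (intro sum_le_suminf summable_exp_generic) auto
  thus ?thesis by (simp add: exp_def divide_inverse mult.commute)
qed

lemma exp_le_quadratic:
  fixes u :: real
  assumes "\<bar>u\<bar> \<le> 1"
  shows "exp u \<le> 1 + u + u\<^sup>2"
proof (cases "u \<ge> 0")
  case True
  thus ?thesis using assms by (intro exp_bound) auto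
next
  case False
  define t where "t = - u"
  have t: "t \<ge> 0" using False by (simp add: t_def)
  \<comment> \<open>The upper bound for \<open>exp (- t)\<close> comes from the lower Taylor bound
    for \<open>exp t\<close>, since the two quadratics multiply to at least 1.\<close>
  have "1 \<le> (1 + t + t\<^sup>2 / 2) * (1 - t + t\<^sup>2)"
  proof -
    have "(1 + t + t\<^sup>2 / 2) * (1 - t + t\<^sup>2) = 1 + t\<^sup>2 / 2 + t ^ 3 / 2 + t ^ 4 / 2"
      by (simp add: power2_eq_square power3_eq_cube power4_eq_xxxx field_simps)
    thus ?thesis using t by simp
  qed
  also have "\<dots> \<le> exp t * (1 - t + t\<^sup>2)"
  proof (intro mult_right_mono exp_lower_Taylor_quadratic t)
    have "1 - t + t\<^sup>2 = (t - 1/2)\<^sup>2 + 3/4" by (simp add: power2_eq_square field_simps)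
    thus "0 \<le> 1 - t + t\<^sup>2" by (simp add: add_nonneg_nonneg)
  qed
  finally have "exp (- t) \<le> 1 - t + t\<^sup>2" by (simp add: exp_minus field_simps)
  thus ?thesis by (simp add: t_def)
qed

lemma cis_approx:
  "cmod (cis x - (\<Sum>k\<le>n. (\<i> * x) ^ k / fact k)) \<le> \<bar>x\<bar> ^ Suc n / fact (Suc n)"
  using iexp_approx1[of x n] by (simp add: cis_conv_exp mult.commute)

text \<open>Exponential moments factor by independence over the full period, and as the means vanish
  each factor is at most 1 plus the variance. Through them the high moments of the sum are bounded
  in terms of the sum of \<open>1 / p\<close> alone.\<close>

lemma avg_exp_sum_le:
  fixes g :: "nat \<Rightarrow> nat \<Rightarrow> real"
  assumes "finite P" and prime: "\<And>p. p \<in> P \<Longrightarrow> prime p"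
    and per: "\<And>p. p \<in> P \<Longrightarrow> has_period p (g p)"
    and bd: "\<And>p s. p \<in> P \<Longrightarrow> \<bar>g p s\<bar> \<le> 1"
    and mean: "\<And>p. p \<in> P \<Longrightarrow> avg p (g p) = 0"
    and var: "\<And>p. p \<in> P \<Longrightarrow> avg p (\<lambda>s. (g p s)\<^sup>2) \<le> w / p"
  shows "avg (\<Prod>P) (\<lambda>s. exp (\<Sum>p\<in>P. g p s)) \<le> exp (w * (\<Sum>p\<in>P. 1 / p))"
proof -
  have "avg (\<Prod>P) (\<lambda>s. exp (\<Sum>p\<in>P. g p s)) = (\<Prod>p\<in>P. avg p (\<lambda>s. exp (g p s)))"
    using avg_prod_primes[of P "\<lambda>p s. exp (g p s)"] assms
    by (simp add: exp_sum has_period_comp)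
  also have "\<dots> \<le> (\<Prod>p\<in>P. exp (w / p))"
  proof (intro prod_mono conjI)
    fix p assume p: "p \<in> P"
    have "p > 0" using prime[OF p] by (rule prime_gt_0_nat)
    have "avg p (\<lambda>s. exp (g p s)) \<le> avg p (\<lambda>s. (1 + g p s) + (g p s)\<^sup>2)"
      using bd[OF p] by (intro avg_mono exp_le_quadratic)
    also have "\<dots> = 1 + avg p (\<lambda>s. (g p s)\<^sup>2)"
      using mean[OF p] \<open>p > 0\<close> by (simp add: avg_add avg_const)
    also have "\<dots> \<le> 1 + w / p" using var[OF p] by simp
    also have "\<dots> \<le> exp (w / p)" by (rule exp_ge_add_one_self)
    finally show "avg p (\<lambda>s. exp (g p s)) \<le> exp (w / p)" .
  qed (auto intro: avg_nonneg)
  also have "\<dots> = exp (w * (\<Sum>p\<in>P. 1 / p))"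
    using assms(1) by (simp add: exp_sum [symmetric] sum_distrib_left)
  finally show ?thesis .
qed

text \<open>Second-order expansion of both sides. The cubic remainder is at most
  \<open>\<Theta>\<close> times the square, so a small amplitude makes it small against the
  variance; \<open>V\<close> measures how far the variance is from \<open>v / p\<close>, at the
  summable scale \<open>1 / p^2\<close>.\<close>

lemma avg_cis_approx:
  fixes f :: "nat \<Rightarrow> real"
  assumes "p > 0" and bd: "\<And>s. \<bar>f s\<bar> \<le> \<Theta>" and mean: "avg p f = 0"
    and var: "\<bar>avg p (\<lambda>s. (f s)\<^sup>2) - v / p\<bar> \<le> V / (real p)\<^sup>2"
    and nonneg: "v \<ge> 0" "V \<ge> 0" "\<Theta> \<ge> 0"
  shows "cmod (avg p (\<lambda>s. cis (f s)) - complex_of_real (exp (- (v / (2 * p)))))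
      \<le> \<Theta> * (v + V) * (1 / p) + (V + v\<^sup>2) * (1 / (real p)\<^sup>2)"
proof -
  define q where "q = avg p (\<lambda>s. (f s)\<^sup>2)"
  have p1: "real p \<ge> 1" using assms(1) by simp
  have "V / (real p)\<^sup>2 \<le> V / real p"
    using p1 nonneg by (intro divide_left_mono) (auto simp: power2_eq_square)
  hence q: "q \<le> (v + V) / p" using var by (simp add: q_def add_divide_distrib abs_le_iff)
  have taylor: "cmod (cis x - (1 + \<i> * x - x\<^sup>2 / 2)) \<le> \<Theta> * x\<^sup>2" if "\<bar>x\<bar> \<le> \<Theta>" for x :: real
  proof -
    have "(\<Sum>k\<le>2. (\<i> * x) ^ k / fact k) = 1 + \<i> * x - x\<^sup>2 / 2"
      by (simp add: numeral_2_eq_2 power2_eq_square field_simps)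
    hence "cmod (cis x - (1 + \<i> * x - x\<^sup>2 / 2)) \<le> \<bar>x\<bar> ^ 3 / 6"
      using cis_approx[of x 2] by (simp add: eval_nat_numeral)
    also have "\<dots> \<le> \<bar>x\<bar> ^ 3" by simp
    also have "\<dots> = \<bar>x\<bar> * x\<^sup>2" by (simp add: power3_eq_cube power2_eq_square abs_mult_self_eq
        mult.assoc)
    also have "\<dots> \<le> \<Theta> * x\<^sup>2" using that by (intro mult_right_mono) auto
    finally show ?thesis .
  qed
  have "avg p (\<lambda>s. cis (f s)) - (1 - q / 2)
      = avg p (\<lambda>s. cis (f s) - (1 + \<i> * f s - (f s)\<^sup>2 / 2))"
  proof -
    have "avg p (\<lambda>s. 1 + \<i> * f s - (f s)\<^sup>2 / 2)
        = avg p (\<lambda>s. (1 + \<i> * complex_of_real (f s)) - 1 / 2 * complex_of_real ((f s)\<^sup>2))"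
      by simp
    also have "\<dots> = 1 + \<i> * complex_of_real (avg p f) - 1 / 2 * complex_of_real q"
      using assms(1) unfolding avg_diff avg_add avg_cmult avg_of_real q_def by (simp add: avg_const)
    finally show ?thesis by (simp add: avg_diff mean)
  qed
  hence "cmod (avg p (\<lambda>s. cis (f s)) - (1 - q / 2))
      \<le> avg p (\<lambda>s. cmod (cis (f s) - (1 + \<i> * f s - (f s)\<^sup>2 / 2)))"
    by (simp only: norm_avg_le)
  also have "\<dots> \<le> avg p (\<lambda>s. \<Theta> * (f s)\<^sup>2)"
    using taylor bd by (intro avg_mono) blast
  also have "\<dots> = \<Theta> * q" by (simp add: avg_cmult q_def)
  also have "\<dots> \<le> \<Theta> * ((v + V) / p)" using q nonneg by (intro mult_left_mono)
  finally have 1: "cmod (avg p (\<lambda>s. cis (f s)) - (1 - q / 2)) \<le> \<Theta> * ((v + V) / p)" .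
  define t where "t = v / (2 * p)"
  have t: "t \<ge> 0" using nonneg by (simp add: t_def)
  have "exp (- t) \<le> 1 - t + t\<^sup>2"
  \<comment> \<open>\<open>exp_le_quadratic\<close> covers \<open>t \<le> 1\<close>; for larger
    \<open>t\<close> the right-hand side already exceeds 1.\<close>
  proof (cases "t \<le> 1")
    case True
    thus ?thesis using exp_le_quadratic[of "- t"] t by simp
  next
    case False
    have "exp (- t) \<le> 1" using t by simp
    also have "1 \<le> 1 - t + t\<^sup>2" using False by (simp add: power2_eq_square)
    finally show ?thesis .
  qed
  moreover have "1 - t \<le> exp (- t)" using exp_ge_add_one_self[of "- t"] by simp
  ultimately have 2: "\<bar>(1 - t) - exp (- t)\<bar> \<le> v\<^sup>2 * (1 / (real p)\<^sup>2)"
  proof -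
    have "t\<^sup>2 = v\<^sup>2 * (1 / (real p)\<^sup>2) / 4" by (simp add: t_def power_divide power_mult_distrib)
    moreover have "v\<^sup>2 * (1 / (real p)\<^sup>2) \<ge> 0" by simp
    hence "v\<^sup>2 * (1 / (real p)\<^sup>2) / 4 \<le> v\<^sup>2 * (1 / (real p)\<^sup>2)"
      using p1 by (simp add: divide_simps mult_nonneg_nonneg)
    ultimately have "t\<^sup>2 \<le> v\<^sup>2 * (1 / (real p)\<^sup>2)" by simp
    thus ?thesis using \<open>exp (- t) \<le> _\<close> \<open>1 - t \<le> _\<close> by linarith
  qed
  have 3: "\<bar>(1 - q / 2) - (1 - t)\<bar> \<le> V * (1 / (real p)\<^sup>2)"
  proof -
    have "(1 - q / 2) - (1 - t) = - ((q - v / p) / 2)" by (simp add: t_def field_simps)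
    hence "\<bar>(1 - q / 2) - (1 - t)\<bar> = \<bar>q - v / p\<bar> / 2" by
        (simp only: abs_minus_cancel abs_divide abs_numeral)
    also have "\<dots> \<le> \<bar>q - v / p\<bar>" by simp
    finally show ?thesis using var by (simp add: q_def)
  qed
  have "\<bar>(1 - q / 2) - exp (- t)\<bar> \<le> (V + v\<^sup>2) * (1 / (real p)\<^sup>2)"
    using 2 3 by (simp only: distrib_right)
  moreover have "cmod (complex_of_real (1 - q / 2) - complex_of_real (exp (- t)))
      = \<bar>(1 - q / 2) - exp (- t)\<bar>"
    by (simp only: of_real_diff [symmetric] norm_of_real)
  ultimately have "cmod (avg p (\<lambda>s. cis (f s)) - complex_of_real (exp (- t)))
      \<le> \<Theta> * ((v + V) / p) + (V + v\<^sup>2) * (1 / (real p)\<^sup>2)"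
    using 1 by (intro norm_diff_triangle_le[of _ "complex_of_real (1 - q / 2)"]) auto
  thus ?thesis by (simp add: t_def)
qed

text \<open>By independence the average is a product over primes, and so is the Gaussian factor. All
  factors have modulus at most 1, so the products differ by at most the sum of the differences of
  their factors; the terms in \<open>1 / p^2\<close> add up to at most
  \<open>V + v^2\<close>.\<close>

lemma avg_cis_sum_primes_approx:
  fixes g :: "nat \<Rightarrow> nat \<Rightarrow> real" and P :: "nat set"
  defines "\<Lambda> \<equiv> (\<Sum>p\<in>P. 1 / p)"
  assumes fin: "finite P" and prime: "\<And>p. p \<in> P \<Longrightarrow> prime p"
    and per: "\<And>p. p \<in> P \<Longrightarrow> has_period p (g p)"
    and bd: "\<And>p s. p \<in> P \<Longrightarrow> \<bar>g p s\<bar> \<le> \<Theta>"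
    and mean: "\<And>p. p \<in> P \<Longrightarrow> avg p (g p) = 0"
    and var: "\<And>p. p \<in> P \<Longrightarrow> \<bar>avg p (\<lambda>s. (g p s)\<^sup>2) - v / p\<bar> \<le> V / (real p)\<^sup>2"
    and nonneg: "v \<ge> 0" "V \<ge> 0" "\<Theta> \<ge> 0"
  shows "cmod (avg (\<Prod>P) (\<lambda>s. cis (\<Sum>p\<in>P. g p s)) - complex_of_real (exp (- (v * \<Lambda> / 2))))
      \<le> \<Theta> * (v + V) * \<Lambda> + V + v\<^sup>2"
proof -
  let ?e = "\<lambda>p. complex_of_real (exp (- (v / (2 * p))))"
  have cis_sum: "cis (\<Sum>p\<in>P. g p s) = (\<Prod>p\<in>P. cis (g p s))" for s
    by (simp add: cis_conv_exp sum_distrib_left exp_sum fin)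
  have "avg (\<Prod>P) (\<lambda>s. cis (\<Sum>p\<in>P. g p s)) = (\<Prod>p\<in>P. avg p (\<lambda>s. cis (g p s)))"
    using avg_prod_primes[of P "\<lambda>p s. cis (g p s)"] fin prime per
    by (simp add: cis_sum has_period_comp)
  moreover have "exp (- (v * \<Lambda> / 2)) = (\<Prod>p\<in>P. exp (- (v / (2 * p))))"
    unfolding \<Lambda>_def by (simp add: exp_sum [symmetric] fin sum_distrib_left sum_divide_distrib
        sum_negf mult.commute)
  ultimately have "cmod (avg (\<Prod>P) (\<lambda>s. cis (\<Sum>p\<in>P. g p s)) - complex_of_real (exp (- (v * \<Lambda> / 2))))
     = cmod ((\<Prod>p\<in>P. avg p (\<lambda>s. cis (g p s))) - (\<Prod>p\<in>P. ?e p))"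
    by simp
  also have "\<dots> \<le> (\<Sum>p\<in>P. cmod (avg p (\<lambda>s. cis (g p s)) - ?e p))"
  proof (rule norm_prod_diff)
    fix p assume p: "p \<in> P"
    have "cmod (avg p (\<lambda>s. cis (g p s))) \<le> avg p (\<lambda>s. cmod (cis (g p s)))" by (rule norm_avg_le)
    also have "\<dots> = 1" using prime_gt_0_nat[OF prime[OF p]] by (simp add: avg_const)
    finally show "cmod (avg p (\<lambda>s. cis (g p s))) \<le> 1" .
    show "cmod (?e p) \<le> 1" using nonneg by (simp add: norm_of_real)
  qed
  also have "\<dots> \<le> (\<Sum>p\<in>P. \<Theta> * (v + V) * (1 / p) + (V + v\<^sup>2) * (1 / (real p)\<^sup>2))"
  proof (rule sum_mono)
    fix p assume p: "p \<in> P"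
    show "cmod (avg p (\<lambda>s. cis (g p s)) - ?e p)
        \<le> \<Theta> * (v + V) * (1 / p) + (V + v\<^sup>2) * (1 / (real p)\<^sup>2)"
      using avg_cis_approx[OF prime_gt_0_nat[OF prime[OF p]] bd[OF p] mean[OF p] var[OF p] nonneg]
      by simp
  qed
  also have "\<dots> = \<Theta> * (v + V) * \<Lambda> + (V + v\<^sup>2) * (\<Sum>p\<in>P. 1 / (real p)\<^sup>2)"
    by (simp only: sum.distrib sum_distrib_left [symmetric] \<Lambda>_def)
  also have "(V + v\<^sup>2) * (\<Sum>p\<in>P. 1 / (real p)\<^sup>2) \<le> (V + v\<^sup>2) * 1"
    using nonneg by (intro mult_left_mono sum_inverse_squares_primes_le fin prime) auto
  finally show ?thesis by simp
qed

text \<open>Over the full period \<open>\<Prod>P\<close> the summands are independent by the Chinese remainder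
  theorem. A much shorter average is compared with it through the Taylor polynomial of degree
  \<open>2 * K - 1\<close> of \<open>cis\<close>, because low powers of the sum have small periods.\<close>

lemma short_avg_cis_sum_primes_approx:
  fixes g :: "nat \<Rightarrow> nat \<Rightarrow> real" and P :: "nat set" and y :: real
  defines "\<Lambda> \<equiv> (\<Sum>p\<in>P. 1 / p)"
  assumes fin: "finite P" and prime: "\<And>p. p \<in> P \<Longrightarrow> prime p"
    and le: "\<And>p. p \<in> P \<Longrightarrow> real p \<le> y" and card: "card P \<le> y"
    and per: "\<And>p. p \<in> P \<Longrightarrow> has_period p (g p)"
    and bd: "\<And>p s. p \<in> P \<Longrightarrow> \<bar>g p s\<bar> \<le> \<Theta>"
    and mean: "\<And>p. p \<in> P \<Longrightarrow> avg p (g p) = 0"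
    and var: "\<And>p. p \<in> P \<Longrightarrow> \<bar>avg p (\<lambda>s. (g p s)\<^sup>2) - v / p\<bar> \<le> V / (real p)\<^sup>2"
    and nonneg: "v \<ge> 0" "V \<ge> 0" "\<Theta> \<ge> 0" "\<Theta> \<le> 1 / 2" and S: "S > 0" and K: "K > 0"
  shows "cmod (avg S (\<lambda>s. cis (\<Sum>p\<in>P. g p s)) - complex_of_real (exp (- (v * \<Lambda> / 2))))
      \<le> 2 * (2 * real K + 1) * (1 + y\<^sup>2 * \<Theta>) ^ (2 * K) / S + 4 * exp (4 * (v + V) * \<Lambda>) / 4 ^ K
         + \<Theta> * (v + V) * \<Lambda> + V + v\<^sup>2"
proof -
  define D where "D = \<Prod>P"
  define Y where "Y s = (\<Sum>p\<in>P. g p s)" for s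
  \<comment> \<open>The base of the error in \<open>avg_power_sum_approx\<close>, with
    \<open>card P\<close> estimated by \<open>y\<close>.\<close>
  define x where "x = y\<^sup>2 * \<Theta>"
  define R where "R s = cis (Y s) - (\<Sum>k\<le>2 * K - 1. (\<i> * Y s) ^ k / fact k)" for s
  have D: "D > 0" unfolding D_def using prime prime_gt_0_nat by (intro prod_pos) auto
  let ?d = "\<lambda>k. avg S (\<lambda>s. Y s ^ k) - avg D (\<lambda>s. Y s ^ k)"
  have y: "y \<ge> 0" using card by linarith
  have x: "x \<ge> 0" using nonneg by (simp add: x_def)
  have moment: "\<bar>avg S (\<lambda>s. Y s ^ j) - avg D (\<lambda>s. Y s ^ j)\<bar> \<le> 2 / S * x ^ j" for j
  proof -
    have "\<bar>avg S (\<lambda>s. 1 * (\<Sum>p\<in>P. g p s) ^ j) - avg D (\<lambda>s. 1 * (\<Sum>p\<in>P. g p s) ^ j)\<bar>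
           \<le> 2 * 1 * real 1 / S * (card P * y * \<Theta>) ^ j"
      by (rule avg_power_sum_approx)
        (use fin D S per le bd nonneg y in \<open>auto simp: has_period_def D_def intro: dvd_prodI\<close>)
    also have "\<dots> \<le> 2 * 1 * real 1 / S * x ^ j"
      unfolding x_def power2_eq_square using card y nonneg
      by (intro mult_left_mono power_mono mult_right_mono) auto
    finally show ?thesis by (simp add: Y_def)
  qed
  have RK: "cmod (R s) \<le> Y s ^ (2 * K) / fact (2 * K)" for s
    using cis_approx[of "Y s" "2 * K - 1"] K by (simp add: R_def power_even_abs)
  have poly: "avg n (\<lambda>s. cis (Y s))
      = avg n R + (\<Sum>k\<le>2 * K - 1. \<i> ^ k / fact k * of_real (avg n (\<lambda>s. Y s ^ k)))" for n
  proof -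
    have "avg n (\<lambda>s. cis (Y s)) 
        = avg n (\<lambda>s. R s + (\<Sum>k\<le>2 * K - 1. \<i> ^ k / fact k * complex_of_real (Y s ^ k)))"
      by (simp add: R_def power_mult_distrib)
    thus ?thesis unfolding avg_add avg_sum avg_cmult avg_of_real .
  qed
  \<comment> \<open>The high moment is bounded by exponential moments of \<open>2 * Y\<close> and
    \<open>- 2 * Y\<close>. The doubling produces the decay \<open>1 / 4 ^ K\<close>, and
    \<open>\<Theta> \<le> 1 / 2\<close> keeps the doubled summands within the reach of
    \<open>avg_exp_sum_le\<close>.\<close>
  have T: "avg D (\<lambda>s. Y s ^ (2 * K)) / fact (2 * K) \<le> 2 * exp (4 * (v + V) * \<Lambda>) / 4 ^ K"
  proof -
    have E: "avg D (\<lambda>s. exp (\<Sum>p\<in>P. c * g p s)) \<le> exp (4 * (v + V) * \<Lambda>)" if c: "c = 2 \<or> c = - 2"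
        for c
      unfolding D_def \<Lambda>_def
    proof (rule avg_exp_sum_le)
      fix p assume p: "p \<in> P"
      show "has_period p (\<lambda>s. c * g p s)" using per[OF p] by (simp add: has_period_def)
      show "\<bar>c * g p s\<bar> \<le> 1" for s using bd[OF p, of s] nonneg c by auto
      show "avg p (\<lambda>s. c * g p s) = 0" using mean[OF p] by (simp add: avg_cmult)
      have "c\<^sup>2 = 4" using c by auto
      have "real p \<ge> 1" using prime_gt_0_nat[OF prime[OF p]] by simp
      hence "V / (real p)\<^sup>2 \<le> V / real p"
        using nonneg by (intro divide_left_mono) (auto simp: power2_eq_square)
      hence "avg p (\<lambda>s. (g p s)\<^sup>2) \<le> (v + V) / p"
        using var[OF p] by (simp add: add_divide_distrib abs_le_iff)
      thus "avg p (\<lambda>s. (c * g p s)\<^sup>2) \<le> 4 * (v + V) / p"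
        by (simp add: power_mult_distrib avg_cmult \<open>c\<^sup>2 = 4\<close> add_divide_distrib)
    qed (use fin prime in auto)
    have "Y s ^ (2 * K) / fact (2 * K)
        \<le> 1 / 4 ^ K * (exp (\<Sum>p\<in>P. 2 * g p s) + exp (\<Sum>p\<in>P. (- 2) * g p s))" for s
    proof -
      have "Y s ^ (2 * K) / fact (2 * K) = 1 / 4 ^ K * (\<bar>2 * Y s\<bar> ^ (2 * K) / fact (2 * K))"
        by (simp add: power_even_abs power_mult_distrib power_mult)
      also have "\<dots> \<le> 1 / 4 ^ K * exp \<bar>2 * Y s\<bar>"
        by (intro mult_left_mono power_div_fact_le_exp) auto
      also have "\<dots> \<le> 1 / 4 ^ K * (exp (2 * Y s) + exp (- 2 * Y s))"
        by (intro mult_left_mono) (auto simp: abs_if)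
      finally show ?thesis unfolding Y_def sum_distrib_left .
    qed
    hence "avg D (\<lambda>s. 1 / fact (2 * K) * Y s ^ (2 * K))
        \<le> avg D (\<lambda>s. 1 / 4 ^ K * (exp (\<Sum>p\<in>P. 2 * g p s) + exp (\<Sum>p\<in>P. (- 2) * g p s)))"
      by (intro avg_mono) simp
    also have "\<dots> = 1 / 4 ^ K * (avg D (\<lambda>s. exp (\<Sum>p\<in>P. 2 * g p s)) + avg D (\<lambda>s. exp (\<Sum>p\<in>P. (- 2) *
        g p s)))"
      by (simp only: avg_cmult avg_add)
    also have "\<dots> \<le> 1 / 4 ^ K * (exp (4 * (v + V) * \<Lambda>) + exp (4 * (v + V) * \<Lambda>))"
      by (intro mult_left_mono add_mono E) auto
    finally show ?thesis by (simp only: avg_cmult) simp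
  qed
  have "cmod (avg S (\<lambda>s. cis (Y s)) - avg D (\<lambda>s. cis (Y s)))
      \<le> avg S (\<lambda>s. Y s ^ (2 * K)) / fact (2 * K) + avg D (\<lambda>s. Y s ^ (2 * K)) / fact (2 * K)
        + (\<Sum>k\<le>2 * K - 1. 2 / S * x ^ k)"
  proof -
    have Rn: "cmod (avg n R) \<le> avg n (\<lambda>s. Y s ^ (2 * K)) / fact (2 * K)" for n
    proof -
      have "cmod (avg n R) \<le> avg n (\<lambda>s. 1 / fact (2 * K) * Y s ^ (2 * K))"
        using RK by (intro order_trans[OF norm_avg_le avg_mono]) simp
      thus ?thesis by (simp only: avg_cmult) simp
    qed
    have diff: "avg S (\<lambda>s. cis (Y s)) - avg D (\<lambda>s. cis (Y s))
       = avg S R - avg D R + (\<Sum>k\<le>2 * K - 1. \<i> ^ k / fact k * of_real (?d k))"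
      unfolding poly by (simp add: algebra_simps sum_subtractf)
    have "cmod (\<Sum>k\<le>2 * K - 1. \<i> ^ k / fact k * of_real (?d k))
        \<le> (\<Sum>k\<le>2 * K - 1. 2 / S * x ^ k)"
    proof (intro order_trans[OF norm_sum sum_mono])
      fix k
      have "cmod (\<i> ^ k / fact k * of_real (?d k))
          = \<bar>?d k\<bar> / fact k"
        unfolding norm_mult norm_divide norm_power norm_of_real by simp
      also have "\<dots> \<le> \<bar>?d k\<bar> / 1"
        by (intro divide_left_mono) (auto simp: fact_ge_1)
      also have "\<dots> \<le> 2 / S * x ^ k" using moment[of k] by simp
      finally show "cmod (\<i> ^ k / fact k * of_real (?d k))
          \<le> 2 / S * x ^ k" .
    qed
    thus ?thesis unfolding diff
      using Rn[of S] Rn[of D] by (intro order_trans[OF norm_triangle_ineq] add_mono order_trans[OF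
          norm_triangle_ineq4])
  qed
  \<comment> \<open>Over the short range there is no independence, so the top moment is moved to the
    full period as well; the error of this move supplies the missing term \<open>k = 2 * K\<close>
    of the sum.\<close>
  also have "avg S (\<lambda>s. Y s ^ (2 * K)) / fact (2 * K)
      \<le> avg D (\<lambda>s. Y s ^ (2 * K)) / fact (2 * K) + 2 / S * x ^ (2 * K)"
  proof -
    have "avg S (\<lambda>s. Y s ^ (2 * K)) / fact (2 * K)
        \<le> (avg D (\<lambda>s. Y s ^ (2 * K)) + 2 / S * x ^ (2 * K)) / fact (2 * K)"
      using moment[of "2 * K"] by (intro divide_right_mono) auto
    also have "\<dots> \<le> avg D (\<lambda>s. Y s ^ (2 * K)) / fact (2 * K) + 2 / S * x ^ (2 * K) / 1"
      unfolding add_divide_distrib using x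
      by (intro add_left_mono divide_left_mono) (auto simp: fact_ge_1)
    finally show ?thesis by simp
  qed
  also have "avg D (\<lambda>s. Y s ^ (2 * K)) / fact (2 * K) + 2 / S * x ^ (2 * K)
      + avg D (\<lambda>s. Y s ^ (2 * K)) / fact (2 * K) + (\<Sum>k\<le>2 * K - 1. 2 / S * x ^ k)
      = 2 * (avg D (\<lambda>s. Y s ^ (2 * K)) / fact (2 * K)) + (\<Sum>k\<le>2 * K. 2 / S * x ^ k)"
  proof -
    have "{..2 * K} = insert (2 * K) {..2 * K - 1}" using K by auto
    hence "(\<Sum>k\<le>2 * K. 2 / S * x ^ k) = 2 / S * x ^ (2 * K) + (\<Sum>k\<le>2 * K - 1. 2 / S * x ^ k)"
      using K by simp
    thus ?thesis by linarith
  qed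
  also have "\<dots> \<le> 2 * (2 * exp (4 * (v + V) * \<Lambda>) / 4 ^ K) + (\<Sum>k\<le>2 * K. 2 / S * (1 + x) ^ (2 * K))"
  proof (intro add_mono mult_left_mono T sum_mono)
    fix k assume "k \<in> {..2 * K}"
    have "x ^ k \<le> (1 + x) ^ k" using x by (intro power_mono) auto
    also have "\<dots> \<le> (1 + x) ^ (2 * K)" using x \<open>k \<in> _\<close> by (intro power_increasing) auto
    finally show "x ^ k \<le> (1 + x) ^ (2 * K)" .
  qed auto
  finally have 1: "cmod (avg S (\<lambda>s. cis (Y s)) - avg D (\<lambda>s. cis (Y s)))
      \<le> 4 * exp (4 * (v + V) * \<Lambda>) / 4 ^ K + 2 * (2 * real K + 1) * (1 + x) ^ (2 * K) / S"
    by (simp add: field_simps)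
  have 2: "cmod (avg D (\<lambda>s. cis (Y s)) - complex_of_real (exp (- (v * \<Lambda> / 2))))
      \<le> \<Theta> * (v + V) * \<Lambda> + V + v\<^sup>2"
    unfolding D_def Y_def \<Lambda>_def
    by (rule avg_cis_sum_primes_approx[OF fin prime per bd mean var nonneg(1-3)])
  show ?thesis using norm_diff_triangle_le[OF 1 2] by (simp add: Y_def x_def add_ac)
qed

section \<open>Prime divisors of linear forms\<close>

lemma omega_eq_card_nat:
  assumes "m > 0"
  shows "omega m = card {p. prime p \<and> int p dvd m}"
proof -
  have "prime_factors m = int ` {p. prime p \<and> int p dvd m}"
  proof (intro equalityI subsetI)
    fix p assume "p \<in> prime_factors m"
    hence p: "prime p" "p dvd m" by (auto simp: in_prime_factors_iff)
    have "p = int (nat p)" using prime_ge_0_int[OF p(1)] by simp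
    moreover have "prime (nat p)" using p(1) calculation
        by (metis prime_int_nat_transfer prime_nat_int_transfer)
    ultimately show "p \<in> int ` {p. prime p \<and> int p dvd m}" using p(2) by
        (intro image_eqI[of _ _ "nat p"]) auto
  qed (use assms in \<open>auto simp: in_prime_factors_iff\<close>)
  thus ?thesis by (simp add: omega_def card_image)
qed

lemma finite_prime_divisors:
  fixes m :: int
  assumes "m \<noteq> 0"
  shows "finite {p::nat. prime p \<and> int p dvd m}"
proof (rule finite_subset)
  show "{p::nat. prime p \<and> int p dvd m} \<subseteq> {..nat \<bar>m\<bar>}"
    using assms by (auto simp: le_nat_iff intro!: zdvd_imp_le)
qed simp

text \<open>The product of the distinct prime divisors above \<open>y\<close> divides
  \<open>m\<close>, so the power of \<open>y\<close> with their number as exponent is at most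
  \<open>\<bar>m\<bar>\<close>.\<close>

lemma card_large_prime_divisors_le:
  fixes m :: int and y :: real
  assumes "m \<noteq> 0" "y > 1"
  shows "real (card {p::nat. prime p \<and> int p dvd m \<and> real p > y}) \<le> ln \<bar>real_of_int m\<bar> / ln y"
proof -
  define Q where "Q = {p::nat. prime p \<and> int p dvd m \<and> real p > y}"
  have fin: "finite Q" unfolding Q_def
      by (rule finite_subset[OF _ finite_prime_divisors[OF assms(1)]]) auto
  have "\<Prod>R dvd nat \<bar>m\<bar>" if "finite R" "R \<subseteq> Q" for R
    using that
  proof (induction R rule: finite_induct)
    case (insert p R)
    have "coprime p (\<Prod>R)"
      using insert by (intro prod_coprime_right primes_coprime) (auto simp: Q_def)
    moreover have "p dvd nat \<bar>m\<bar>" using insert.prems by (auto simp: Q_def)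
    moreover have "\<Prod>R dvd nat \<bar>m\<bar>" using insert by simp
    ultimately have "p * \<Prod>R dvd nat \<bar>m\<bar>" using divides_mult by blast
    thus ?case using insert.hyps by simp
  qed simp
  hence "\<Prod>Q dvd nat \<bar>m\<bar>" using fin by blast
  hence "\<Prod>Q \<le> nat \<bar>m\<bar>" using assms(1) by (intro dvd_imp_le) auto
  hence "real (\<Prod>Q) \<le> real (nat \<bar>m\<bar>)" by (simp only: of_nat_le_iff)
  also have "\<dots> = \<bar>real_of_int m\<bar>" by simp
  finally have "real (\<Prod>Q) \<le> \<bar>real_of_int m\<bar>" .
  moreover have "y ^ card Q \<le> real (\<Prod>Q)"
  proof -
    have "y ^ card Q = (\<Prod>p\<in>Q. y)" by simp
    also have "\<dots> \<le> (\<Prod>p\<in>Q. real p)" using assms(2) by (intro prod_mono) (auto simp: Q_def)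
    finally show ?thesis by simp
  qed
  ultimately have "y ^ card Q \<le> \<bar>real_of_int m\<bar>" by linarith
  hence "ln (y ^ card Q) \<le> ln \<bar>real_of_int m\<bar>" using assms by (intro ln_mono) auto
  hence "card Q * ln y \<le> ln \<bar>real_of_int m\<bar>" using assms by (simp add: ln_realpow)
  thus ?thesis using assms by (simp add: Q_def pos_le_divide_eq)
qed

lemma sum_inverse_prime_divisors_le:
  fixes m :: int and X y z :: real
  assumes "m \<noteq> 0" "\<bar>real_of_int m\<bar> \<le> X" "z > 1"
  shows "(\<Sum>p\<in>{p \<in> primes_le y. int p dvd m}. 1 / real p) \<le> prime_recip_sum z + ln X / (z * ln z)"
proof -
  define Q where "Q = {p::nat. prime p \<and> int p dvd m \<and> real p > z}"
  have fin: "finite Q" unfolding Q_def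
      by (rule finite_subset[OF _ finite_prime_divisors[OF assms(1)]]) auto
  have "(\<Sum>p\<in>{p \<in> primes_le y. int p dvd m}. 1 / real p) \<le> (\<Sum>p\<in>primes_le z \<union> Q. 1 / real p)"
    using fin by (intro sum_mono2 finite_UnI finite_primes_le) (auto simp: primes_le_def Q_def)
  also have "\<dots> \<le> prime_recip_sum z + (\<Sum>p\<in>Q. 1 / real p)"
    unfolding prime_recip_sum_def using fin
    by (subst sum.union_inter [symmetric]) (auto intro!: sum_nonneg)
  also have "(\<Sum>p\<in>Q. 1 / real p) \<le> (\<Sum>p\<in>Q. 1 / z)"
    using assms by (intro sum_mono divide_left_mono) (auto simp: Q_def)
  also have "\<dots> = card Q / z" by simp
  also have "\<dots> \<le> (ln \<bar>real_of_int m\<bar> / ln z) / z"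
    unfolding Q_def using assms by (intro divide_right_mono card_large_prime_divisors_le) auto
  also have "\<dots> \<le> (ln X / ln z) / z"
    using assms by (intro divide_right_mono ln_mono) auto
  finally show ?thesis by (simp add: mult.commute)
qed

lemma omega_split:
  assumes "m > 0"
  shows "real (omega m) = (\<Sum>p\<in>primes_le y. of_bool (int p dvd m))
           + real (card {p::nat. prime p \<and> int p dvd m \<and> real p > y})"
proof -
  have "{p. prime p \<and> int p dvd m} = {p \<in> primes_le y. int p dvd m} \<union> {p. prime p \<and> int p dvd m
      \<and> real p > y}"
    by (auto simp: primes_le_def)
  hence "omega m = card {p \<in> primes_le y. int p dvd m} + card {p::nat. prime p \<and> int p dvd m
      \<and> real p > y}"
    unfolding omega_eq_card_nat[OF assms] using finite_prime_divisors[of m] assms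
    by (subst card_Un_disjoint [symmetric]) (auto simp: primes_le_def intro: finite_subset)
  moreover have "(\<Sum>p\<in>primes_le y. of_bool (int p dvd m))
      = real (card {p \<in> primes_le y. int p dvd m})"
    by (simp add: sum.If_cases of_bool_def Int_def)
  ultimately show ?thesis by simp
qed

section \<open>Divisibility of linear forms by a prime as a periodic function\<close>

definition hit :: "nat \<Rightarrow> int \<Rightarrow> int \<Rightarrow> nat \<Rightarrow> real" where
  "hit p a c s = of_bool (int p dvd a * int s + c)"

lemma hit_bounds: "0 \<le> hit p a c s" "hit p a c s \<le> 1"
  by (auto simp: hit_def)

lemma has_period_hit: "has_period p (hit p a c)"
proof -
  have "int p dvd a * int (s + p) + c \<longleftrightarrow> int p dvd a * int s + c" for s
    using dvd_add_times_triv_right_iff[of "int p" "a * int s + c" a] by (simp add: algebra_simps)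
  thus ?thesis by (simp add: has_period_def hit_def)
qed

text \<open>\<open>a\<close> is invertible modulo \<open>p\<close>, so the form has exactly one root
  in each period.\<close>

lemma avg_hit:
  assumes "prime p" "\<not> int p dvd a"
  shows "avg p (hit p a c) = 1 / p"
proof -
  have p: "p > 0" using assms(1) by (rule prime_gt_0_nat)
  have cop: "coprime a (int p)"
    using assms prime_imp_coprime[of "int p" a] by (simp add: coprime_commute)
  obtain x where x: "[a * x = - c] (mod int p)"
    using cong_solve_coprime_int[OF cop]
        by (metis cong_scalar_left mult.assoc mult.right_neutral mult.commute)
  define r where "r = nat (x mod int p)"
  have r: "r < p" "int r = x mod int p" using p by (auto simp: r_def nat_less_iff)
  have "s < p \<Longrightarrow> int p dvd a * int s + c \<longleftrightarrow> s = r" for s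
  proof -
    assume s: "s < p"
    have "int p dvd a * int s + c \<longleftrightarrow> [a * int s = - c] (mod int p)"
      by (simp add: cong_iff_dvd_diff)
    also have "\<dots> \<longleftrightarrow> [a * int s = a * x] (mod int p)" using x by (metis cong_sym cong_trans)
    also have "\<dots> \<longleftrightarrow> [int s = x] (mod int p)" using cop by (simp add: cong_mult_lcancel)
    also have "\<dots> \<longleftrightarrow> int s = int r" using s r by (simp add: cong_def)
    finally show ?thesis by simp
  qed
  hence "(\<Sum>s<p. hit p a c s) = (\<Sum>s<p. if s = r then 1 else 0)"
    by (intro sum.cong) (auto simp: hit_def)
  thus ?thesis using r by (simp add: avg_def)
qed

lemma avg_hit_le:
  assumes "prime p" "\<not> int p dvd a" "S > 0"
  shows "avg S (hit p a c) \<le> 1 / p + 2 * p / S"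
  using avg_has_period_approx[OF has_period_hit[of p a c], of p S 1] avg_hit[OF assms(1,2), of c]
    prime_gt_0_nat[OF assms(1)] assms(3)
  by (simp add: hit_def abs_le_iff)

text \<open>Eliminating \<open>s\<close> from two simultaneous divisibilities leaves the
  determinant.\<close>

lemma hit_mult_eq_0:
  assumes "\<not> int p dvd a * c' - a' * c"
  shows "hit p a c s * hit p a' c' s = 0"
proof -
  have "int p dvd a * c' - a' * c" if "int p dvd a * int s + c" "int p dvd a' * int s + c'"
  proof -
    have "int p dvd a * (a' * int s + c') - a' * (a * int s + c)" using that by
        (intro dvd_diff dvd_mult)
    thus ?thesis by (simp add: algebra_simps)
  qed
  thus ?thesis using assms by (auto simp: hit_def)
qed

text \<open>No two forms are divisible by \<open>p\<close> at once, so the square of the uncentred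
  sum has no cross terms. Correlation enters only through the centring, which contributes the term
  with \<open>1 / p^2\<close>.\<close>

lemma avg_centred_hits:
  fixes a c :: "'k::finite \<Rightarrow> int" and \<tau> :: "'k \<Rightarrow> real" and p :: nat
  assumes "prime p" and a: "\<And>i. \<not> int p dvd a i" and ac: "\<And>i j. i \<noteq> j
      \<Longrightarrow> \<not> int p dvd a i * c j - a j * c i"
  defines "g \<equiv> (\<lambda>s. \<Sum>i\<in>UNIV. \<tau> i * (hit p (a i) (c i) s - 1 / p))"
  shows "avg p g = 0"
    and "avg p (\<lambda>s. (g s)\<^sup>2) = (\<Sum>i\<in>UNIV. (\<tau> i)\<^sup>2) / p - (\<Sum>i\<in>UNIV. \<tau> i)\<^sup>2 / (real p)\<^sup>2"
proof -
  define T where "T = (\<Sum>i\<in>UNIV. \<tau> i)"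
  define u where "u s = (\<Sum>i\<in>UNIV. \<tau> i * hit p (a i) (c i) s)" for s
  have p: "p > 0" using assms(1) by (rule prime_gt_0_nat)
  have g: "g s = u s - T / p" for s
    by (simp add: g_def u_def T_def algebra_simps sum_subtractf sum_divide_distrib)
  have u: "avg p u = T / p"
    unfolding u_def avg_sum avg_cmult avg_hit[OF assms(1) a] by (simp add: T_def sum_divide_distrib)
  thus "avg p g = 0" using p by (simp add: g[abs_def] avg_diff avg_const)
  have sq: "(u s)\<^sup>2 = (\<Sum>i\<in>UNIV. (\<tau> i)\<^sup>2 * hit p (a i) (c i) s)" for s
  proof -
    have "(u s)\<^sup>2 = (\<Sum>i\<in>UNIV. \<Sum>j\<in>UNIV. (\<tau> i * hit p (a i) (c i) s) * (\<tau> j * hit p (a j) (c j) s))"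
      by (simp add: power2_eq_square u_def sum_product)
    also have "\<dots> = (\<Sum>i\<in>UNIV. \<Sum>j\<in>UNIV. if i = j then (\<tau> i)\<^sup>2 * hit p (a i) (c i) s else 0)"
    proof (intro sum.cong refl)
      fix i j
      show "(\<tau> i * hit p (a i) (c i) s) * (\<tau> j * hit p (a j) (c j) s)
          = (if i = j then (\<tau> i)\<^sup>2 * hit p (a i) (c i) s else 0)"
        using hit_mult_eq_0[OF ac[of i j], of s] by (auto simp: hit_def power2_eq_square)
    qed
    finally show ?thesis by simp
  qed
  have u2: "avg p (\<lambda>s. (u s)\<^sup>2) = (\<Sum>i\<in>UNIV. (\<tau> i)\<^sup>2) / p"
    unfolding sq avg_sum avg_cmult avg_hit[OF assms(1) a] by (simp add: sum_divide_distrib)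
  have "avg p (\<lambda>s. (g s)\<^sup>2) = avg p (\<lambda>s. (u s)\<^sup>2 - 2 * (T / p) * u s + (T / p)\<^sup>2)"
    unfolding g power2_diff by (simp add: algebra_simps)
  also have "\<dots> = (\<Sum>i\<in>UNIV. (\<tau> i)\<^sup>2) / p - 2 * (T / p) * (T / p) + (T / p)\<^sup>2"
    using p by (simp only: avg_add avg_diff avg_cmult avg_const u u2)
  also have "\<dots> = (\<Sum>i\<in>UNIV. (\<tau> i)\<^sup>2) / p - T\<^sup>2 / (real p)\<^sup>2"
    by (simp add: power2_eq_square)
  finally show "avg p (\<lambda>s. (g s)\<^sup>2) = (\<Sum>i\<in>UNIV. (\<tau> i)\<^sup>2) / p - (\<Sum>i\<in>UNIV. \<tau> i)\<^sup>2 / (real p)\<^sup>2"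
    by (simp add: T_def)
qed

section \<open>The joint characteristic function over one block\<close>

lemma abs_exp_minus_diff_le:
  fixes a b :: real
  assumes "a \<ge> 0" "b \<ge> 0"
  shows "\<bar>exp (- a) - exp (- b)\<bar> \<le> \<bar>a - b\<bar>"
proof -
  have *: "exp (- a) - exp (- b) \<le> b - a" if "a \<ge> 0" "a \<le> b" for a b :: real
  proof -
    have "exp (- a) - exp (- b) = exp (- a) * (1 - exp (- (b - a)))"
      by (simp add: algebra_simps flip: exp_add)
    also have "\<dots> \<le> 1 * (b - a)"
    proof (intro mult_mono)
      show "1 - exp (- (b - a)) \<le> b - a" using exp_ge_add_one_self[of "- (b - a)"] by linarith
    qed (use that in auto)
    finally show ?thesis by simp
  qed
  show ?thesis using *[of a b] *[of b a] assms by (cases "a \<le> b") auto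
qed

lemma card_primes_le: "y \<ge> 0 \<Longrightarrow> real (card (primes_le y)) \<le> y"
proof -
  assume y: "y \<ge> 0"
  have "primes_le y \<subseteq> {1..nat \<lfloor>y\<rfloor>}"
    by (auto simp: primes_le_def le_nat_floor Suc_le_eq prime_gt_0_nat)
  hence "card (primes_le y) \<le> nat \<lfloor>y\<rfloor>" using card_mono[of "{1..nat \<lfloor>y\<rfloor>}"] by fastforce
  thus ?thesis using y by linarith
qed

lemma cmod_cis_diff_le: "cmod (cis x - cis y) \<le> \<bar>x - y\<bar>"
proof -
  have "cis x - cis y = cis y * (cis (x - y) - 1)" by (simp add: algebra_simps cis_mult)
  hence "cmod (cis x - cis y) = cmod (cis (x - y) - 1)" by (simp add: norm_mult)
  also have "\<dots> \<le> \<bar>x - y\<bar>" using cis_approx[of "x - y" 0] by simp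
  finally show ?thesis .
qed

lemma sum_UNION_le:
  fixes f :: "'a \<Rightarrow> real"
  assumes "finite I" "\<And>i. i \<in> I \<Longrightarrow> finite (A i)" "\<And>x. f x \<ge> 0"
  shows "(\<Sum>x\<in>(\<Union>i\<in>I. A i). f x) \<le> (\<Sum>i\<in>I. \<Sum>x\<in>A i. f x)"
  using assms(1,2)
proof (induction I rule: finite_induct)
  case (insert i I)
  have "(\<Sum>x\<in>A i \<union> (\<Union>i\<in>I. A i). f x) \<le> (\<Sum>x\<in>A i. f x) + (\<Sum>x\<in>(\<Union>i\<in>I. A i). f x)"
    using insert.prems insert.hyps assms(3)
    by (subst sum.union_inter [symmetric]) (auto intro!: sum_nonneg)
  thus ?case using insert by auto
qed simp

text \<open>Three sources: the first summand is what \<open>omega\<close> counts outside the primes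
  that are kept, together with the shift of the mean; the second is the error of
  \<open>short_avg_cis_sum_primes_approx\<close>; the third is the deviation of the variance from
  \<open>Q\<close>. Here \<open>b\<close> bounds the reciprocal sum of the discarded primes,
  \<open>e\<close> is the distance of \<open>L\<close> from the reciprocal sum up to
  \<open>y\<close>, and \<open>u\<close> bounds the number of prime factors above
  \<open>y\<close>.\<close>

definition block_error ::
  "real \<Rightarrow> real \<Rightarrow> nat \<Rightarrow> nat \<Rightarrow> real \<Rightarrow> real \<Rightarrow> real \<Rightarrow> real \<Rightarrow> real \<Rightarrow> real" where
  "block_error \<Theta> Q K S L b e y u =
     \<Theta> * (2 * b + e + 2 * y\<^sup>2 / S + u) / sqrt L
       + (2 * (2 * real K + 1) * (1 + y\<^sup>2) ^ (2 * K) / S + 4 * exp (8 * (Q + \<Theta>\<^sup>2)) / 4 ^ K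
          + 2 * \<Theta> * (Q + \<Theta>\<^sup>2) / sqrt L + \<Theta>\<^sup>2 / L + (Q / L)\<^sup>2)
       + Q * (b + e) / L"

text \<open>Apart from the discarded primes, which divide some \<open>a i\<close> or \<open>a i * c j - a j * c i\<close>, at
  most one of the forms \<open>a i * s + c i\<close> is divisible by \<open>p\<close> for any given \<open>s\<close>, so the
  covariance matrix is diagonal up to \<open>O(1 / p\<^sup>2)\<close>.\<close>

lemma block_estimate:
  fixes a c :: "'k::finite \<Rightarrow> int" and \<theta> :: "'k \<Rightarrow> real" and L X y z :: real and S K :: nat
  defines "\<Theta> \<equiv> \<Sum>i\<in>UNIV. \<bar>\<theta> i\<bar>" and "Q \<equiv> \<Sum>i\<in>UNIV. (\<theta> i)\<^sup>2"
    and "b \<equiv> (real CARD('k) + (real CARD('k))\<^sup>2) * (prime_recip_sum z + ln X / (z * ln z))"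
    and "e \<equiv> \<bar>prime_recip_sum y - L\<bar>"
  assumes a: "\<And>i. a i > 0" and ne: "\<And>i j. i \<noteq> j \<Longrightarrow> a i * c j \<noteq> a j * c i"
    and range: "\<And>i s. s < S \<Longrightarrow> a i * int s + c i > 0" "\<And>i s. s < S
        \<Longrightarrow> real_of_int (a i * int s + c i) \<le> X"
    and aX: "\<And>i. real_of_int (a i) \<le> X" and acX: "\<And>i j. \<bar>real_of_int (a i * c j - a j * c i)\<bar> \<le> X"
    and y: "y > 1" and z: "z > 1" and L: "L > 0" "prime_recip_sum y \<le> 2 * L" "2 * \<Theta> \<le> sqrt L"
    and S: "S > 0" and K: "K > 0"
  shows "cmod (avg S (\<lambda>s. cis (\<Sum>i\<in>UNIV. \<theta> i * ((real (omega (a i * int s + c i)) - L) / sqrt L)))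
             - complex_of_real (exp (- (Q / 2))))
      \<le> (\<Sum>i\<in>UNIV. \<bar>\<theta> i\<bar> * real (card {p \<in> primes_le y. int p dvd a i \<and> int p dvd c i})) / sqrt L
         + block_error \<Theta> Q K S L b e y (ln X / ln y)"
proof -
  define \<sigma> where "\<sigma> = sqrt L"
  have \<sigma>: "\<sigma> > 0" "\<sigma>\<^sup>2 = L" using L by (auto simp: \<sigma>_def)
  \<comment> \<open>The primes modulo which all forms are nonconstant and have distinct roots, so
    that \<open>avg_centred_hits\<close> applies.\<close>
  define P where "P = {p \<in> primes_le y. (\<forall>i. \<not> int p dvd a i) \<and> (\<forall>i j. i \<noteq> j
      \<longrightarrow> \<not> int p dvd a i * c j - a j * c i)}"
  define B where "B = primes_le y - P"
  define \<Lambda> where "\<Lambda> = (\<Sum>p\<in>P. 1 / real p)"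
  define \<tau> where "\<tau> i = \<theta> i / \<sigma>" for i
  define g where "g p s = (\<Sum>i\<in>UNIV. \<tau> i * (hit p (a i) (c i) s - 1 / p))" for p s
  define t where "t i = real (card {p \<in> primes_le y. int p dvd a i \<and> int p dvd c i})" for i
  define W where "W s = (\<Sum>i\<in>UNIV. \<theta> i * ((real (omega (a i * int s + c i)) - L) / sqrt L))" for s
  have \<Theta>: "\<Theta> \<ge> 0" unfolding \<Theta>_def by (intro sum_nonneg) auto
  have Q: "Q \<ge> 0" unfolding Q_def by (intro sum_nonneg) auto
  have PB: "primes_le y = P \<union> B" "P \<inter> B = {}" "finite P" "finite B"
    by (auto simp: B_def P_def)
  have primeP: "prime p" "real p \<le> y" if "p \<in> P" for p using that by
      (auto simp: P_def primes_le_def)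
  have primeB: "prime p" "real p \<le> y" if "p \<in> B" for p using that by
      (auto simp: B_def primes_le_def)
  have X1: "X \<ge> 1" using aX[of undefined] a[of undefined] by linarith
  have prs: "prime_recip_sum y = \<Lambda> + (\<Sum>p\<in>B. 1 / real p)"
    unfolding prime_recip_sum_def \<Lambda>_def PB(1) using PB by (intro sum.union_disjoint) auto

  have bad: "(\<Sum>p\<in>B. 1 / real p) \<le> b"
  proof -
    define \<rho> where "\<rho> = prime_recip_sum z + ln X / (z * ln z)"
    define D where "D m = {p \<in> primes_le y. int p dvd m}" for m :: int
    have \<rho>: "\<rho> \<ge> 0"
      unfolding \<rho>_def prime_recip_sum_def using X1 z by (intro add_nonneg_nonneg sum_nonneg) auto
    have D: "(\<Sum>p\<in>D m. 1 / real p) \<le> \<rho>" if "m \<noteq> 0" "\<bar>real_of_int m\<bar> \<le> X" for m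
      unfolding D_def \<rho>_def using that z by (rule sum_inverse_prime_divisors_le)
    define I where "I = {ij :: 'k \<times> 'k. fst ij \<noteq> snd ij}"
    have finD: "finite (D m)" for m by (simp add: D_def)
    \<comment> \<open>A discarded prime divides one of the numbers \<open>a i\<close> or one of the
      determinants, fewer than \<open>CARD('k)\<close> squared in number. All of these are nonzero
      and at most \<open>X\<close> in modulus, so each accounts for at most
      \<open>\<rho>\<close>.\<close>
    have "B \<subseteq> (\<Union>i. D (a i)) \<union> (\<Union>(i, j)\<in>I. D (a i * c j - a j * c i))"
    proof
      fix p assume p: "p \<in> B"
      hence "p \<in> primes_le y" and "(\<exists>i. int p dvd a i) \<or> (\<exists>i j. i \<noteq> j
          \<and> int p dvd a i * c j - a j * c i)"
        by (auto simp: B_def P_def)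
      thus "p \<in> (\<Union>i. D (a i)) \<union> (\<Union>(i, j)\<in>I. D (a i * c j - a j * c i))"
        unfolding D_def I_def by fastforce
    qed
    hence "(\<Sum>p\<in>B. 1 / real p) \<le> (\<Sum>p\<in>(\<Union>i. D (a i)) \<union> (\<Union>(i, j)\<in>I. D (a i * c j - a j * c i)). 1 /
        real p)"
      by (intro sum_mono2) (auto simp: finD)
    also have "\<dots> \<le> (\<Sum>p\<in>(\<Union>i. D (a i)). 1 / real p) + (\<Sum>p\<in>(\<Union>(i, j)\<in>I. D (a i * c j - a j * c i)). 1
        / real p)"
      by (subst sum.union_inter [symmetric]) (auto simp: finD intro!: sum_nonneg)
    also have "\<dots> \<le> (\<Sum>i\<in>UNIV. \<Sum>p\<in>D (a i). 1 / real p) + (\<Sum>(i, j)\<in>I. \<Sum>p\<in>D (a i * c j - a j * c i). 1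
        / real p)"
      unfolding case_prod_unfold by (intro add_mono sum_UNION_le finD) auto
    also have "\<dots> \<le> (\<Sum>i\<in>(UNIV::'k set). \<rho>) + (\<Sum>(i, j)\<in>I. \<rho>)"
    proof (intro add_mono sum_mono)
      show "(\<Sum>p\<in>D (a i). 1 / real p) \<le> \<rho>" for i
        using a[of i] aX[of i] by (intro D) auto
      show "(case ij of (i, j) \<Rightarrow> \<Sum>p\<in>D (a i * c j - a j * c i). 1 / real p)
          \<le> (case ij of (i, j) \<Rightarrow> \<rho>)"
        if "ij \<in> I" for ij
        using that ne acX by (cases ij)
            (auto simp: I_def intro!: D simp del: of_int_diff of_int_mult)
    qed
    also have "(\<Sum>(i, j)\<in>I. \<rho>) = card I * \<rho>" by (simp add: case_prod_unfold)
    also have "\<dots> \<le> (real CARD('k))\<^sup>2 * \<rho>"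
    proof -
      have "card I \<le> card (UNIV :: ('k \<times> 'k) set)" by (intro card_mono) auto
      hence "real (card I) \<le> (real CARD('k))\<^sup>2" by (simp add: power2_eq_square flip: of_nat_mult)
      thus ?thesis using \<rho> by (intro mult_right_mono)
    qed
    finally show ?thesis by (simp add: b_def \<rho>_def algebra_simps)
  qed
  have \<Lambda>: "\<bar>\<Lambda> - L\<bar> \<le> e + b" "\<Lambda> \<ge> 0" "\<Lambda> \<le> 2 * L"
  proof -
    have "(\<Sum>p\<in>B. 1 / real p) \<ge> 0" by (intro sum_nonneg) auto
    thus "\<bar>\<Lambda> - L\<bar> \<le> e + b" "\<Lambda> \<le> 2 * L" using bad prs L by (auto simp: e_def)
    show "\<Lambda> \<ge> 0" unfolding \<Lambda>_def by (intro sum_nonneg) auto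
  qed

  \<comment> \<open>The general estimate with amplitude \<open>\<Theta> / \<sigma>\<close>,
    \<open>v = Q / L\<close> and \<open>V = \<Theta>^2 / L\<close>. Since
    \<open>\<Lambda> \<le> 2 * L\<close>, the exponent in the Taylor tail stays bounded as
    \<open>L\<close> grows.\<close>
  have core: "cmod (avg S (\<lambda>s. cis (\<Sum>p\<in>P. g p s)) - complex_of_real (exp (- (Q / L * \<Lambda> / 2))))
      \<le> 2 * (2 * real K + 1) * (1 + y\<^sup>2) ^ (2 * K) / S + 4 * exp (8 * (Q + \<Theta>\<^sup>2)) / 4 ^ K
            + 2 * \<Theta> * (Q + \<Theta>\<^sup>2) / sqrt L + \<Theta>\<^sup>2 / L + (Q / L)\<^sup>2"
  proof -
    have \<tau>1: "(\<Sum>i\<in>UNIV. \<bar>\<tau> i\<bar>) = \<Theta> / \<sigma>"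
      using \<sigma> by (simp add: \<tau>_def \<Theta>_def sum_divide_distrib)
    have \<tau>2: "(\<Sum>i\<in>UNIV. (\<tau> i)\<^sup>2) = Q / L"
      using \<sigma> by (simp add: \<tau>_def Q_def sum_divide_distrib power_divide)
    have half: "\<Theta> / \<sigma> \<le> 1 / 2" using L(3) \<sigma> by (simp add: \<sigma>_def field_simps)
    have "cmod (avg S (\<lambda>s. cis (\<Sum>p\<in>P. g p s)) - complex_of_real (exp (- (Q / L * (\<Sum>p\<in>P. 1 / real
        p) / 2))))
      \<le> 2 * (2 * real K + 1) * (1 + y\<^sup>2 * (\<Theta> / \<sigma>)) ^ (2 * K) / S + 4 * exp (4 * (Q / L + \<Theta>\<^sup>2 / L)
          * (\<Sum>p\<in>P. 1 / real p)) / 4 ^ K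
         + \<Theta> / \<sigma> * (Q / L + \<Theta>\<^sup>2 / L) * (\<Sum>p\<in>P. 1 / real p) + \<Theta>\<^sup>2 / L + (Q / L)\<^sup>2"
    proof (rule short_avg_cis_sum_primes_approx)
      show "real (card P) \<le> y"
        using card_mono[of "primes_le y" P] card_primes_le[of y] y PB(1) by fastforce
      fix p assume p: "p \<in> P"
      have nd: "\<not> int p dvd a i" "i \<noteq> j \<Longrightarrow> \<not> int p dvd a i * c j - a j * c i" for i j
        using p by (auto simp: P_def)
      show "has_period p (g p)"
        using has_period_hit[of p] by (simp add: g_def has_period_def)
      show "\<bar>g p s\<bar> \<le> \<Theta> / \<sigma>" for s
      proof -
        have "\<bar>g p s\<bar> \<le> (\<Sum>i\<in>UNIV. \<bar>\<tau> i * (hit p (a i) (c i) s - 1 / p)\<bar>)" unfolding g_def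
            by (rule sum_abs)
        also have "\<dots> \<le> (\<Sum>i\<in>UNIV. \<bar>\<tau> i\<bar> * 1)"
        proof (rule sum_mono)
          fix i
          have "0 \<le> 1 / real p" "1 / real p \<le> 1" using prime_gt_0_nat[OF primeP(1)[OF p]] by auto
          hence "\<bar>hit p (a i) (c i) s - 1 / p\<bar> \<le> 1" using hit_bounds[of p "a i" "c i" s] by linarith
          thus "\<bar>\<tau> i * (hit p (a i) (c i) s - 1 / p)\<bar> \<le> \<bar>\<tau> i\<bar> * 1"
            unfolding abs_mult by (intro mult_left_mono) auto
        qed
        finally show ?thesis by (simp add: \<tau>1)
      qed
      show "avg p (g p) = 0"
        using avg_centred_hits(1)[where a = a and c = c and \<tau> = \<tau>, OF primeP(1)[OF p] nd] by
            (simp add: g_def[abs_def])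
      have "\<bar>avg p (\<lambda>s. (g p s)\<^sup>2) - Q / L / p\<bar> = (\<Sum>i\<in>UNIV. \<tau> i)\<^sup>2 / (real p)\<^sup>2"
        using avg_centred_hits(2)[where a = a and c = c and \<tau> = \<tau>, OF primeP(1)[OF p] nd] by
            (simp add: g_def \<tau>2)
      also have "\<bar>\<Sum>i\<in>UNIV. \<tau> i\<bar> \<le> \<Theta> / \<sigma>" using sum_abs[of \<tau> UNIV] by (simp add: \<tau>1)
      hence "(\<Sum>i\<in>UNIV. \<tau> i)\<^sup>2 \<le> (\<Theta> / \<sigma>)\<^sup>2"
          by (rule power2_le_iff_abs_le[THEN iffD2, rotated]) (use \<Theta> \<sigma> in auto)
      hence "(\<Sum>i\<in>UNIV. \<tau> i)\<^sup>2 / (real p)\<^sup>2 \<le> \<Theta>\<^sup>2 / L / (real p)\<^sup>2"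
        using \<sigma> by (intro divide_right_mono) (auto simp: power_divide)
      finally show "\<bar>avg p (\<lambda>s. (g p s)\<^sup>2) - Q / L / p\<bar> \<le> \<Theta>\<^sup>2 / L / (real p)\<^sup>2" .
    qed (use primeP PB S K L Q \<Theta> \<sigma> half in auto)
    also have "(\<Sum>p\<in>P. 1 / real p) = \<Lambda>" by (simp add: \<Lambda>_def)
    also have "2 * (2 * real K + 1) * (1 + y\<^sup>2 * (\<Theta> / \<sigma>)) ^ (2 * K) / S
        \<le> 2 * (2 * real K + 1) * (1 + y\<^sup>2) ^ (2 * K) / S"
    proof -
      have "\<Theta> / \<sigma> \<le> 1" using half by linarith
      hence "y\<^sup>2 * (\<Theta> / \<sigma>) \<le> y\<^sup>2 * 1" by (rule mult_left_mono) simp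
      moreover have "y\<^sup>2 * (\<Theta> / \<sigma>) \<ge> 0" using \<Theta> \<sigma> by simp
      ultimately show ?thesis by (intro divide_right_mono mult_left_mono power_mono) auto
    qed
    also have "4 * exp (4 * (Q / L + \<Theta>\<^sup>2 / L) * \<Lambda>) / 4 ^ K \<le> 4 * exp (8 * (Q + \<Theta>\<^sup>2)) / 4 ^ K"
    proof -
      have "4 * (Q / L + \<Theta>\<^sup>2 / L) * \<Lambda> \<le> 4 * (Q / L + \<Theta>\<^sup>2 / L) * (2 * L)"
        using \<Lambda> Q L by (intro mult_left_mono) auto
      also have "4 * (Q / L + \<Theta>\<^sup>2 / L) * (2 * L) = 8 * (Q + \<Theta>\<^sup>2)"
        using L(1) by (simp add: add_divide_distrib[symmetric])
      finally show ?thesis by (intro divide_right_mono mult_left_mono) auto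
    qed
    also have "\<Theta> / \<sigma> * (Q / L + \<Theta>\<^sup>2 / L) * \<Lambda> \<le> 2 * \<Theta> * (Q + \<Theta>\<^sup>2) / sqrt L"
    proof -
      have "\<Theta> / \<sigma> * (Q / L + \<Theta>\<^sup>2 / L) * \<Lambda> \<le> \<Theta> / \<sigma> * (Q / L + \<Theta>\<^sup>2 / L) * (2 * L)"
        using \<Lambda> Q L \<Theta> \<sigma> by (intro mult_left_mono) auto
      also have "\<dots> = 2 * \<Theta> * (Q + \<Theta>\<^sup>2) / sqrt L" using L(1) unfolding \<sigma>_def[symmetric] by
          (simp add: add_divide_distrib[symmetric])
      finally show ?thesis .
    qed
    finally show ?thesis by simp
  qed

  \<comment> \<open>The primes that are kept produce the variance \<open>Q / L * \<Lambda>\<close>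
    in place of \<open>Q\<close>.\<close>
  have gauss: "cmod (complex_of_real (exp (- (Q / L * \<Lambda> / 2))) - complex_of_real (exp (- (Q /
      2)))) \<le> Q * (b + e) / L"
  proof -
    have "\<bar>exp (- (Q / L * \<Lambda> / 2)) - exp (- (Q / 2))\<bar> \<le> \<bar>Q / L * \<Lambda> / 2 - Q / 2\<bar>"
      using Q L \<Lambda> by (intro abs_exp_minus_diff_le) auto
    also have "Q / L * \<Lambda> / 2 - Q / 2 = Q * (\<Lambda> - L) / L / 2" using L by (simp add: field_simps)
    also have "\<bar>\<dots>\<bar> = Q * \<bar>\<Lambda> - L\<bar> / L / 2" using Q L by (simp add: abs_mult)
    also have "\<dots> \<le> Q * \<bar>\<Lambda> - L\<bar> / L"
    proof -
      have "0 \<le> Q * \<bar>\<Lambda> - L\<bar> / L" using Q L(1) by simp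
      thus ?thesis by (simp only: pos_divide_le_eq zero_less_numeral mult_2_right
          le_add_same_cancel1)
    qed
    also have "\<dots> \<le> Q * (b + e) / L" using Q L \<Lambda> by (intro divide_right_mono mult_left_mono) auto
    finally show ?thesis by (simp only: of_real_diff [symmetric] norm_of_real)
  qed

  define bad_hits where "bad_hits i s = (\<Sum>p\<in>B. hit p (a i) (c i) s)" for i s
  \<comment> \<open>Three deviations in each coordinate: hits at discarded primes, prime factors
    above \<open>y\<close>, and the centring by \<open>L\<close> in place of
    \<open>\<Lambda>\<close>.\<close>
  have WY: "\<bar>W s - (\<Sum>p\<in>P. g p s)\<bar> \<le> (\<Sum>i\<in>UNIV. \<bar>\<tau> i\<bar> * (bad_hits i s + (ln X / ln y + (e + b))))"
    if s: "s < S" for s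
  proof -
    have "(\<Sum>p\<in>P. g p s) = (\<Sum>i\<in>UNIV. \<tau> i * ((\<Sum>p\<in>P. hit p (a i) (c i) s) - \<Lambda>))"
      unfolding g_def by (subst sum.swap)
          (simp only: sum_distrib_left[symmetric] sum_subtractf \<Lambda>_def)
    hence "W s - (\<Sum>p\<in>P. g p s)
        = (\<Sum>i\<in>UNIV. \<tau> i * (real (omega (a i * int s + c i)) - (\<Sum>p\<in>P. hit p (a i) (c i) s) + (\<Lambda> -
            L)))"
      unfolding W_def \<sigma>_def[symmetric] \<tau>_def sum_subtractf [symmetric] using \<sigma>(1)
      by (simp only: sum_subtractf [symmetric]) (intro sum.cong refl, simp add: field_simps)
    also have "\<bar>\<dots>\<bar> \<le> (\<Sum>i\<in>UNIV. \<bar>\<tau> i * (real (omega (a i * int s + c i)) - (\<Sum>p\<in>P. hit p (a i) (c i)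
        s) + (\<Lambda> - L))\<bar>)"
      by (rule sum_abs)
    also have "\<dots> \<le> (\<Sum>i\<in>UNIV. \<bar>\<tau> i\<bar> * (bad_hits i s + (ln X / ln y + (e + b))))"
    proof (rule sum_mono)
      fix i
      define m where "m = a i * int s + c i"
      define l where "l = real (card {p::nat. prime p \<and> int p dvd m \<and> real p > y})"
      have m: "m > 0" "real_of_int m \<le> X" using range[OF s, of i] by (auto simp: m_def)
      have "(\<Sum>p\<in>primes_le y. of_bool (int p dvd m)) = (\<Sum>p\<in>P. hit p (a i) (c i) s) + bad_hits i s"
        unfolding PB(1) bad_hits_def hit_def m_def using PB by (intro sum.union_disjoint) auto
      hence om: "real (omega m) - (\<Sum>p\<in>P. hit p (a i) (c i) s) = bad_hits i s + l"
        using omega_split[OF m(1), of y] by (simp add: l_def)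
      have "l \<le> ln \<bar>real_of_int m\<bar> / ln y"
        unfolding l_def using m y by (intro card_large_prime_divisors_le) auto
      also have "\<dots> \<le> ln X / ln y" using m y by (intro divide_right_mono ln_mono) auto
      finally have l: "l \<le> ln X / ln y" "l \<ge> 0" by (auto simp: l_def)
      have "bad_hits i s \<ge> 0" unfolding bad_hits_def by (intro sum_nonneg hit_bounds)
      hence "\<bar>real (omega m) - (\<Sum>p\<in>P. hit p (a i) (c i) s) + (\<Lambda> - L)\<bar>
          \<le> bad_hits i s + (ln X / ln y + (e + b))"
        unfolding om using l \<Lambda>(1) by linarith
      thus "\<bar>\<tau> i * (real (omega (a i * int s + c i)) - (\<Sum>p\<in>P. hit p (a i) (c i) s) + (\<Lambda> - L))\<bar>
          \<le> \<bar>\<tau> i\<bar> * (bad_hits i s + (ln X / ln y + (e + b)))"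
        unfolding abs_mult m_def by (intro mult_left_mono) auto
    qed
    finally show ?thesis .
  qed
  \<comment> \<open>A discarded prime dividing \<open>a i\<close> hits the whole block if it also
    divides \<open>c i\<close>, and never otherwise; the former are counted by \<open>t i\<close>,
    which survives into the final bound. Every other discarded prime hits with frequency at most
    \<open>1 / p + 2 * y / S\<close>.\<close>
  have bad_avg: "avg S (bad_hits i) \<le> t i + (b + 2 * y\<^sup>2 / S)" for i
  proof -
    have "avg S (bad_hits i) = (\<Sum>p\<in>B. avg S (hit p (a i) (c i)))"
      unfolding bad_hits_def avg_sum ..
    also have "\<dots> \<le> (\<Sum>p\<in>B. of_bool (int p dvd a i \<and> int p dvd c i) + (1 / real p + 2 * y / S))"
    proof (rule sum_mono)
      fix p assume p: "p \<in> B"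
      show "avg S (hit p (a i) (c i)) \<le> of_bool (int p dvd a i
          \<and> int p dvd c i) + (1 / real p + 2 * y / S)"
      proof (cases "int p dvd a i")
        case True
        hence "hit p (a i) (c i) s = of_bool (int p dvd c i)" for s
          by (simp add: hit_def dvd_add_right_iff)
        hence "avg S (hit p (a i) (c i)) = of_bool (int p dvd c i)"
          using S by (simp add: avg_def)
        thus ?thesis using True y by simp
      next
        case False
        have "avg S (hit p (a i) (c i)) \<le> 1 / real p + 2 * real p / real S"
          using avg_hit_le[OF primeB(1)[OF p] False S] .
        also have "2 * real p / S \<le> 2 * y / S" using primeB(2)[OF p] by
            (intro divide_right_mono) auto
        finally show ?thesis using False by simp
      qed
    qed
    also have "\<dots> = (\<Sum>p\<in>B. of_bool (int p dvd a i
        \<and> int p dvd c i)) + ((\<Sum>p\<in>B. 1 / real p) + card B * (2 * y / S))"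
      by (simp add: sum.distrib)
    also have "\<dots> \<le> t i + (b + y * (2 * y / S))"
    proof (intro add_mono bad mult_right_mono)
      have "(\<Sum>p\<in>B. of_bool (int p dvd a i \<and> int p dvd c i) :: real) 
          \<le> (\<Sum>p\<in>primes_le y. of_bool (int p dvd a i \<and> int p dvd c i))"
        unfolding PB(1) using PB by (intro sum_mono2) auto
      also have "\<dots> = t i" by (simp add: t_def sum.If_cases of_bool_def Int_def)
      finally show "(\<Sum>p\<in>B. of_bool (int p dvd a i \<and> int p dvd c i)) \<le> t i" .
      show "real (card B) \<le> y"
        using card_mono[of "primes_le y" B] card_primes_le[of y] y PB(1) by fastforce
    qed (use y in auto)
    finally show ?thesis by (simp add: power2_eq_square mult_ac)
  qed
  have "cmod (avg S (\<lambda>s. cis (W s)) - avg S (\<lambda>s. cis (\<Sum>p\<in>P. g p s)))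
      \<le> avg S (\<lambda>s. cmod (cis (W s) - cis (\<Sum>p\<in>P. g p s)))"
    unfolding avg_diff [symmetric] by (rule norm_avg_le)
  also have "\<dots> \<le> avg S (\<lambda>s. \<Sum>i\<in>UNIV. \<bar>\<tau> i\<bar> * (bad_hits i s + (ln X / ln y + (e + b))))"
    using order_trans[OF cmod_cis_diff_le WY] by (intro avg_mono) auto
  also have "\<dots> = (\<Sum>i\<in>UNIV. \<bar>\<tau> i\<bar> * (avg S (bad_hits i) + (ln X / ln y + (e + b))))"
    using S by (simp only: avg_sum avg_cmult avg_add avg_const)
  also have "\<dots> \<le> (\<Sum>i\<in>UNIV. \<bar>\<tau> i\<bar> * (t i + (b + 2 * y\<^sup>2 / S) + (ln X / ln y + (e + b))))"
    using bad_avg by (intro sum_mono mult_left_mono add_right_mono) auto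
  also have "\<dots> = (\<Sum>i\<in>UNIV. \<bar>\<theta> i\<bar> * t i) / sqrt L + \<Theta> * (2 * b + e + 2 * y\<^sup>2 / S + ln X / ln y) /
      sqrt L"
  proof -
    define C where "C = 2 * b + e + 2 * y\<^sup>2 / S + ln X / ln y"
    have "\<bar>\<tau> i\<bar> * (t i + (b + 2 * y\<^sup>2 / S) + (ln X / ln y + (e + b)))
        = \<bar>\<theta> i\<bar> * t i / \<sigma> + \<bar>\<theta> i\<bar> * C / \<sigma>" for i
    proof -
      have "t i + (b + 2 * y\<^sup>2 / S) + (ln X / ln y + (e + b)) = t i + C" by (simp add: C_def)
      moreover have "\<bar>\<tau> i\<bar> * (t i + C) = \<bar>\<theta> i\<bar> * t i / \<sigma> + \<bar>\<theta> i\<bar> * C / \<sigma>"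
        using \<sigma>(1) by (simp add: \<tau>_def add_divide_distrib distrib_left)
      ultimately show ?thesis by (simp only:)
    qed
    thus ?thesis unfolding \<Theta>_def C_def[symmetric] \<sigma>_def[symmetric]
      by (simp only: sum.distrib sum_divide_distrib sum_distrib_right)
  qed
  finally have 1: "cmod (avg S (\<lambda>s. cis (W s)) - avg S (\<lambda>s. cis (\<Sum>p\<in>P. g p s)))
      \<le> (\<Sum>i\<in>UNIV. \<bar>\<theta> i\<bar> * t i) / sqrt L + \<Theta> * (2 * b + e + 2 * y\<^sup>2 / S + ln X / ln y) / sqrt L" .
  show ?thesis
    using norm_diff_triangle_le[OF norm_diff_triangle_le[OF 1 core] gauss]
    by (simp only: W_def t_def block_error_def add.assoc)
qed

section \<open>Beatty sequences\<close>

definition beatty :: "real \<Rightarrow> real \<Rightarrow> nat \<Rightarrow> int" where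
  "beatty \<alpha> \<beta> n = \<lfloor>\<alpha> * real n + \<beta>\<rfloor>"

lemma card_separated_le:
  fixes A :: "nat set"
  assumes "A \<subseteq> {1..N}" "h > 0" and gap: "\<And>m n. m \<in> A \<Longrightarrow> n \<in> A \<Longrightarrow> m < n \<Longrightarrow> m + h \<le> n"
  shows "real (card A) \<le> real N / h + 1"
proof -
  have inj: "inj_on (\<lambda>n. n div h) A"
  proof (rule linorder_inj_onI)
    fix m n assume "m \<in> A" "n \<in> A" "m < n"
    hence "(m + h) div h \<le> n div h" by (intro div_le_mono gap)
    thus "m div h \<noteq> n div h" using assms(2) by simp
  qed auto
  have "card A = card ((\<lambda>n. n div h) ` A)" by (rule card_image[OF inj, symmetric])
  also have "\<dots> \<le> card {..N div h}"
    using assms(1) by (intro card_mono) (auto intro!: div_le_mono)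
  finally have "real (card A) \<le> real (N div h) + 1" by simp
  also have "real (N div h) \<le> real N / h" by (rule of_nat_div_le_of_nat)
  finally show ?thesis by simp
qed

text \<open>No positive multiple of an irrational number is an integer, and finitely many positive
  distances have a positive minimum.\<close>

lemma irrational_multiples_far_from_int:
  fixes \<gamma> :: real
  assumes "\<gamma> \<notin> \<rat>"
  obtains \<eta> where "\<eta> > 0" "\<And>h z. 1 \<le> h \<Longrightarrow> h \<le> H \<Longrightarrow> \<eta> \<le> \<bar>real h * \<gamma> - of_int z\<bar>"
proof -
  \<comment> \<open>The element 1 keeps the set nonempty for \<open>H = 0\<close>.\<close>
  define D where "D = insert 1 ((\<lambda>h. \<bar>real h * \<gamma> - of_int (round (real h * \<gamma>))\<bar>) ` {1..H})"
  have D: "finite D" "D \<noteq> {}" by (auto simp: D_def)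
  have pos: "\<bar>real h * \<gamma> - of_int (round (real h * \<gamma>))\<bar> > 0" if "h \<ge> 1" for h
  proof (rule ccontr)
    assume "\<not> ?thesis"
    hence "real h * \<gamma> = of_int (round (real h * \<gamma>))" by simp
    hence "\<gamma> = of_int (round (real h * \<gamma>)) / of_int (int h)" using that by (simp add: field_simps)
    hence "\<gamma> \<in> \<rat>" by (metis Rats_divide Rats_of_int)
    thus False using assms by contradiction
  qed
  show ?thesis
  proof (rule that[of "Min D"])
    show "Min D > 0" using D pos by (subst Min_gr_iff) (auto simp: D_def)
    fix h z assume "1 \<le> h" "h \<le> H"
    hence "Min D \<le> \<bar>real h * \<gamma> - of_int (round (real h * \<gamma>))\<bar>"
      using D by (intro Min_le) (auto simp: D_def)
    also have "\<dots> \<le> \<bar>real h * \<gamma> - of_int z\<bar>"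
      using round_diff_minimal[of "real h * \<gamma>" z] by simp
    finally show "Min D \<le> \<bar>real h * \<gamma> - of_int z\<bar>" .
  qed
qed

text \<open>If two values of \<open>n\<close> both bring \<open>\<alpha> * n + \<beta>\<close> near
  an integer, their difference \<open>h\<close> brings \<open>h * \<alpha>\<close> near an integer,
  which irrationality forbids for \<open>h \<le> H\<close>. So such \<open>n\<close> are more than
  \<open>H\<close> apart.\<close>

lemma eventually_card_near_int_le:
  fixes \<alpha> \<beta> \<epsilon> :: real
  assumes "\<alpha> \<notin> \<rat>" "\<epsilon> > 0"
  obtains \<eta> where "\<eta> > 0"
    "eventually (\<lambda>N. real (card {n \<in> {1..N}. \<exists>z::int. \<bar>\<alpha> * real n + \<beta> - of_int z\<bar> < \<eta>})
        \<le> \<epsilon> * N) sequentially"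
proof -
  let ?Z = "\<lambda>N \<eta>. {n \<in> {1..N}. \<exists>z::int. \<bar>\<alpha> * real n + \<beta> - of_int z\<bar> < \<eta>}"
  \<comment> \<open>Half of \<open>\<epsilon>\<close> pays for \<open>N / H\<close>, the other half
    for the additive 1 once \<open>N \<ge> 2 / \<epsilon>\<close>.\<close>
  define H where "H = nat \<lceil>2 / \<epsilon>\<rceil>"
  have H: "real H \<ge> 2 / \<epsilon>" "H > 0" using assms(2) by (auto simp: H_def)
  obtain \<eta> where \<eta>: "\<eta> > 0" "\<And>h z. 1 \<le> h \<Longrightarrow> h \<le> H \<Longrightarrow> \<eta> \<le> \<bar>real h * \<alpha> - of_int z\<bar>"
    using irrational_multiples_far_from_int[OF assms(1), of H] by blast
  show ?thesis
  proof (rule that[of "\<eta> / 2"])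
    show "\<eta> / 2 > 0" using \<eta> by simp
    have "eventually (\<lambda>N. real N \<ge> 2 / \<epsilon>) sequentially"
      by (rule filterlim_at_top[THEN iffD1, OF filterlim_real_sequentially, rule_format])
    thus "eventually (\<lambda>N. real (card (?Z N (\<eta> / 2))) \<le> \<epsilon> * N) sequentially"
    proof eventually_elim
      case (elim N)
      have "real (card (?Z N (\<eta> / 2))) \<le> real N / H + 1"
      proof (rule card_separated_le)
        fix m n assume "m \<in> (?Z N (\<eta> / 2))"
          "n \<in> (?Z N (\<eta> / 2))" "m < n"
        then obtain z w :: int where zw: "\<bar>\<alpha> * real m + \<beta> - of_int z\<bar> < \<eta> / 2"
          "\<bar>\<alpha> * real n + \<beta> - of_int w\<bar> < \<eta> / 2" by auto
        have "real (n - m) * \<alpha> - of_int (w - z)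
            = (\<alpha> * real n + \<beta> - of_int w) - (\<alpha> * real m + \<beta> - of_int z)"
          using \<open>m < n\<close> by (simp add: of_nat_diff algebra_simps)
        hence "\<bar>real (n - m) * \<alpha> - of_int (w - z)\<bar> < \<eta>" using zw by linarith
        hence "\<not> n - m \<le> H" using \<eta>(2)[of "n - m" "w - z"] \<open>m < n\<close> by linarith
        thus "m + H \<le> n" by simp
      qed (use H in auto)
      also have "real N / H \<le> real N / (2 / \<epsilon>)" using H assms(2) by (intro divide_left_mono) auto
      also have "real N / (2 / \<epsilon>) + 1 \<le> \<epsilon> * N" using elim assms(2) by (simp add: field_simps)
      finally show ?case by simp
    qed
  qed
qed

lemma card_beatty_fibre_le:
  assumes "\<alpha> > 0"
  shows "finite {n. beatty \<alpha> \<beta> n = m}" "real (card {n. beatty \<alpha> \<beta> n = m}) \<le> 1 / \<alpha> + 1"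
proof -
  define F where "F = {n. beatty \<alpha> \<beta> n = m}"
  define l where "l = nat \<lfloor>1 / \<alpha>\<rfloor>"
  define n0 where "n0 = (LEAST n. n \<in> F)"
  have sub: "F \<subseteq> {n0..n0 + l}"
  proof
    fix n assume n: "n \<in> F"
    hence n0: "n0 \<in> F" "n0 \<le> n" unfolding n0_def by (auto intro: LeastI Least_le)
    have "\<alpha> * real n + \<beta> < of_int m + 1" "of_int m \<le> \<alpha> * real n0 + \<beta>"
      using n n0 by (auto simp: F_def beatty_def floor_eq_iff)
    hence "\<alpha> * (real n - real n0) < 1" by (simp add: algebra_simps)
    hence "real (n - n0) \<le> 1 / \<alpha>" using assms n0 by (simp add: field_simps of_nat_diff)
    hence "n - n0 \<le> l" unfolding l_def by (rule le_nat_floor)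
    thus "n \<in> {n0..n0 + l}" using n0 by auto
  qed
  show "finite F" using finite_subset[OF sub] by simp
  have "card F \<le> card {n0..n0 + l}" by (intro card_mono sub) simp
  hence "real (card F) \<le> real l + 1" by simp
  also have "real l \<le> 1 / \<alpha>" using assms by (simp add: l_def)
  finally show "real (card F) \<le> 1 / \<alpha> + 1" by simp
qed

text \<open>At most \<open>\<alpha> * N / d + 3\<close> multiples of \<open>d\<close> are candidate
  values, two of the 3 being lost to rounding at the lower end and one to counting both endpoints;
  each value is taken at most \<open>1 / \<alpha> + 1\<close> times. The bound is uniform in
  \<open>d\<close>, and the 1 beside \<open>N / d\<close> covers large \<open>d\<close>.\<close>

lemma card_beatty_multiples_le:
  assumes "\<alpha> > 0" "d > 0"
  shows "real (card {n \<in> {1..N}. int d dvd beatty \<alpha> \<beta> n})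
      \<le> (\<alpha> + 3) * (1 / \<alpha> + 1) * (real N / d + 1)"
proof -
  define A where "A = {n \<in> {1..N}. int d dvd beatty \<alpha> \<beta> n}"
  define I where "I = {\<lfloor>\<beta>\<rfloor> div int d..\<lfloor>\<alpha> * real N + \<beta>\<rfloor> div int d}"
  have "A \<subseteq> (\<Union>k\<in>I. {n. beatty \<alpha> \<beta> n = k * int d})"
  proof
    fix n assume n: "n \<in> A"
    have "\<lfloor>\<beta>\<rfloor> \<le> beatty \<alpha> \<beta> n" "beatty \<alpha> \<beta> n \<le> \<lfloor>\<alpha> * real N + \<beta>\<rfloor>"
      unfolding beatty_def using assms n by (auto intro!: floor_mono simp: A_def)
    hence "beatty \<alpha> \<beta> n div int d \<in> I" using assms by (auto simp: I_def intro!: zdiv_mono1)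
    moreover have "beatty \<alpha> \<beta> n = beatty \<alpha> \<beta> n div int d * int d" using n by (auto simp: A_def)
    ultimately show "n \<in> (\<Union>k\<in>I. {n. beatty \<alpha> \<beta> n = k * int d})" by blast
  qed
  hence "card A \<le> card (\<Union>k\<in>I. {n. beatty \<alpha> \<beta> n = k * int d})"
    using card_beatty_fibre_le(1)[OF assms(1)] by (intro card_mono) (auto simp: I_def)
  also have "\<dots> \<le> (\<Sum>k\<in>I. card {n. beatty \<alpha> \<beta> n = k * int d})"
    by (intro card_UN_le) (auto simp: I_def)
  finally have "real (card A) \<le> (\<Sum>k\<in>I. real (card {n. beatty \<alpha> \<beta> n = k * int d}))"
    by (simp flip: of_nat_sum)
  also have "\<dots> \<le> (\<Sum>k\<in>I. 1 / \<alpha> + 1)"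
    by (intro sum_mono card_beatty_fibre_le assms)
  also have "\<dots> = real (card I) * (1 / \<alpha> + 1)" by simp
  also have "real (card I) \<le> (\<alpha> + 3) * (real N / d + 1)"
  proof -
    have d: "real d \<ge> 1" using assms by simp
    have 1: "real_of_int (\<lfloor>\<alpha> * real N + \<beta>\<rfloor> div int d) \<le> (\<alpha> * real N + \<beta>) / d"
      using order_trans[OF real_of_int_div4[of "\<lfloor>\<alpha> * real N + \<beta>\<rfloor>" "int d"] divide_right_mono]
          assms by simp
    have 2: "\<beta> / d - 2 \<le> real_of_int (\<lfloor>\<beta>\<rfloor> div int d)"
    proof -
      have "(\<beta> - 1) / d \<le> real_of_int \<lfloor>\<beta>\<rfloor> / d" by (intro divide_right_mono) linarith+
      moreover have "real_of_int \<lfloor>\<beta>\<rfloor> / d - 1 \<le> real_of_int (\<lfloor>\<beta>\<rfloor> div int d)"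
        using real_of_int_div3[of "\<lfloor>\<beta>\<rfloor>" "int d"] by simp
      moreover have "(\<beta> - 1) / d \<ge> \<beta> / d - 1" using d by (simp add: diff_divide_distrib)
      ultimately show ?thesis by linarith
    qed
    have "real (card I) \<le> max 0 (real_of_int (\<lfloor>\<alpha> * real N + \<beta>\<rfloor> div int d) - real_of_int (\<lfloor>\<beta>\<rfloor> div
        int d) + 1)"
      by (simp add: I_def)
    also have "\<dots> \<le> \<alpha> * real N / d + 3"
      using 1 2 assms by (simp add: add_divide_distrib)
    also have "\<dots> \<le> (\<alpha> + 3) * (real N / d + 1)"
      using assms by (simp add: algebra_simps add_divide_distrib)
    finally show ?thesis .
  qed
  finally show ?thesis using assms by (simp add: A_def mult_ac mult_right_mono)
qed

lemma density_zeroI: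
  fixes B :: "nat \<Rightarrow> nat set"
  assumes "\<And>\<epsilon>::real. \<epsilon> > 0 \<Longrightarrow> eventually (\<lambda>N. real (card (B N)) \<le> \<epsilon> * N) sequentially"
  shows "(\<lambda>N. card (B N) / N) \<longlonglongrightarrow> 0"
proof (rule tendstoI)
  fix \<epsilon> :: real assume "\<epsilon> > 0"
  hence "eventually (\<lambda>N. real (card (B N)) \<le> \<epsilon> / 2 * N) sequentially" using assms[of "\<epsilon> / 2"]
      by simp
  thus "eventually (\<lambda>N. dist (card (B N) / N) 0 < \<epsilon>) sequentially"
    using eventually_gt_at_top[of 0]
  proof eventually_elim
    case (elim N)
    have "card (B N) / N \<le> \<epsilon> / 2" using elim by (simp add: field_simps)
    also have "\<dots> < \<epsilon>" using \<open>\<epsilon> > 0\<close> by simp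
    finally show ?case by simp
  qed
qed

text \<open>Along a block the distance from the affine pattern is at most
  \<open>S * \<bar>q * \<alpha> - a\<bar>\<close>, which tends to 0, so the floor can break the
  pattern only if \<open>\<alpha> * n + \<beta>\<close> starts very near an integer. For irrational
  \<open>\<alpha>\<close> this is rare. For rational \<open>\<alpha>\<close> with denominator
  \<open>b\<close>, the error \<open>q * \<alpha> - a\<close> is a multiple of \<open>1 / b\<close>,
  hence eventually 0, and there are no exceptions at all.\<close>

lemma beatty_not_affine_density_zero:
  fixes \<alpha> \<beta> :: real and q S :: "nat \<Rightarrow> nat" and a :: "nat \<Rightarrow> int"
  assumes d: "(\<lambda>N. real (q N) * \<alpha> - of_int (a N)) \<longlonglongrightarrow> 0"
    and Sd: "(\<lambda>N. real (S N) * (real (q N) * \<alpha> - of_int (a N))) \<longlonglongrightarrow> 0"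
  shows "(\<lambda>N. card {n \<in> {1..N}. \<exists>s<S N. beatty \<alpha> \<beta> (n + q N * s) \<noteq> beatty \<alpha> \<beta> n + a N * int s} /
      N) \<longlonglongrightarrow> 0"
    (is "(\<lambda>N. card (?E N) / N) \<longlonglongrightarrow> 0")
proof (cases "\<alpha> \<in> \<rat>")
  case True
  then obtain u b :: int where ub: "b > 0" "\<alpha> = of_int u / of_int b"
    by (elim Rats_cases') auto
  have "eventually (\<lambda>N. \<bar>real (q N) * \<alpha> - of_int (a N)\<bar> < 1 / of_int b) sequentially"
    using order_tendstoD(2)[OF tendsto_rabs_zero[OF d], of "1 / of_int b"] ub by simp
  hence "eventually (\<lambda>N. card (?E N) / N = 0) sequentially"
  proof eventually_elim
    case (elim N)
    have eq: "real (q N) * \<alpha> - of_int (a N) = of_int (int (q N) * u - a N * b) / of_int b"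
      using ub by (simp add: field_simps)
    have "\<bar>real_of_int (int (q N) * u - a N * b)\<bar> < 1"
      using elim ub unfolding eq by (simp add: divide_less_cancel del: of_int_diff of_int_mult)
    hence "\<bar>int (q N) * u - a N * b\<bar> < 1" by linarith
    hence qa: "real (q N) * \<alpha> = of_int (a N)" using eq by simp
    have "beatty \<alpha> \<beta> (n + q N * s) = beatty \<alpha> \<beta> n + a N * int s" for n s
    proof -
      have "\<alpha> * real (n + q N * s) + \<beta> = \<alpha> * real n + \<beta> + of_int (a N * int s)"
        using qa by (simp add: algebra_simps)
      thus ?thesis unfolding beatty_def by (metis floor_add_int)
    qed
    thus ?case by simp
  qed
  thus ?thesis by (rule tendsto_eventually)
next
  case False
  show ?thesis
  proof (rule density_zeroI)
    fix \<epsilon> :: real assume "\<epsilon> > 0"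
    then obtain \<eta> where \<eta>: "\<eta> > 0"
      "eventually (\<lambda>N. real (card {n \<in> {1..N}. \<exists>z::int. \<bar>\<alpha> * real n + \<beta> - of_int z\<bar> < \<eta>})
          \<le> \<epsilon> * N) sequentially"
      using eventually_card_near_int_le[OF False] by blast
    have "eventually (\<lambda>N. \<bar>real (S N) * (real (q N) * \<alpha> - of_int (a N))\<bar> < \<eta>) sequentially"
      using order_tendstoD(2)[OF tendsto_rabs_zero[OF Sd]] \<eta>(1) by simp
    with \<eta>(2) show "eventually (\<lambda>N. real (card (?E N)) \<le> \<epsilon> * N) sequentially"
    proof eventually_elim
      case (elim N)
      have "?E N \<subseteq> {n \<in> {1..N}. \<exists>z::int. \<bar>\<alpha> * real n + \<beta> - of_int z\<bar> < \<eta>}"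
      proof safe
        fix n s assume s: "s < S N" "beatty \<alpha> \<beta> (n + q N * s) \<noteq> beatty \<alpha> \<beta> n + a N * int s"
        define x where "x = \<alpha> * real n + \<beta>"
        define \<delta> where "\<delta> = s * (real (q N) * \<alpha> - of_int (a N))"
        have "\<bar>\<delta>\<bar> \<le> \<bar>real (S N) * (real (q N) * \<alpha> - of_int (a N))\<bar>"
          unfolding \<delta>_def abs_mult using s by (intro mult_mono) auto
        hence \<delta>: "\<bar>\<delta>\<bar> < \<eta>" using elim by simp
        have "\<alpha> * real (n + q N * s) + \<beta> = x + \<delta> + of_int (a N * int s)"
          by (simp add: x_def \<delta>_def algebra_simps)
        hence "beatty \<alpha> \<beta> (n + q N * s) = \<lfloor>x + \<delta>\<rfloor> + a N * int s"
          unfolding beatty_def by (metis floor_add_int)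
        hence ne: "\<lfloor>x + \<delta>\<rfloor> \<noteq> \<lfloor>x\<rfloor>" using s(2) by (simp add: beatty_def x_def)
        have "\<exists>z::int. \<bar>x - of_int z\<bar> < \<eta>"
        proof (cases "\<lfloor>x + \<delta>\<rfloor> > \<lfloor>x\<rfloor>")
          case True
          hence "of_int \<lfloor>x\<rfloor> + 1 \<le> x + \<delta>" by linarith
          hence "\<bar>x - of_int (\<lfloor>x\<rfloor> + 1)\<bar> < \<eta>" using \<delta> by (simp add: abs_less_iff)
          thus ?thesis by blast
        next
          case False
          hence "x + \<delta> < of_int \<lfloor>x\<rfloor>" using ne by linarith
          hence "\<bar>x - of_int \<lfloor>x\<rfloor>\<bar> < \<eta>" using \<delta> by linarith
          thus ?thesis by blast
        qed
        thus "\<exists>z::int. \<bar>\<alpha> * real n + \<beta> - of_int z\<bar> < \<eta>" by (simp add: x_def)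
      qed
      hence "card (?E N) \<le> card {n \<in> {1..N}. \<exists>z::int. \<bar>\<alpha> * real n + \<beta> - of_int z\<bar> < \<eta>}"
        by (intro card_mono) auto
      thus ?case using elim(1) by linarith
    qed
  qed
qed

text \<open>Write \<open>a' / a\<close> in lowest terms as \<open>b' / b\<close>. The equation
  forces \<open>b\<close> to divide \<open>beatty \<alpha> \<beta> n\<close>, which happens with
  frequency O(1 / b); and \<open>b\<close> tends to infinity because \<open>a' / a\<close> tends to
  the irrational number \<open>\<alpha>' / \<alpha>\<close>.\<close>

lemma beatty_proportional_density_zero:
  fixes \<alpha> \<beta> \<alpha>' \<beta>' :: real and q :: "nat \<Rightarrow> nat" and a a' :: "nat \<Rightarrow> int"
  assumes pos: "\<alpha> > 0" "\<alpha>' > 0" and irr: "\<alpha>' / \<alpha> \<notin> \<rat>"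
    and apos: "eventually (\<lambda>N. a N > 0 \<and> a' N > 0) sequentially"
    and d: "(\<lambda>N. real (q N) * \<alpha> - of_int (a N)) \<longlonglongrightarrow> 0" "(\<lambda>N. real (q N) * \<alpha>' - of_int (a' N)) \<longlonglongrightarrow> 0"
  shows "(\<lambda>N. card {n \<in> {1..N}. a N * beatty \<alpha>' \<beta>' n = a' N * beatty \<alpha> \<beta> n} / N) \<longlonglongrightarrow> 0"
    (is "(\<lambda>N. card (?E N) / N) \<longlonglongrightarrow> 0")
proof (rule density_zeroI)
  fix \<epsilon> :: real assume \<epsilon>: "\<epsilon> > 0"
  define C where "C = (\<alpha> + 3) * (1 / \<alpha> + 1)"
  have C: "C > 0" unfolding C_def using pos by (intro mult_pos_pos add_pos_pos) auto
  define H where "H = nat \<lceil>2 * C / \<epsilon>\<rceil>"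
  have H: "real H \<ge> 2 * C / \<epsilon>" "H > 0" using C \<epsilon> by (auto simp: H_def)
  obtain \<eta> where \<eta>: "\<eta> > 0" "\<And>h z. 1 \<le> h \<Longrightarrow> h \<le> H \<Longrightarrow> \<eta> \<le> \<bar>real h * (\<alpha>' / \<alpha>) - of_int z\<bar>"
    using irrational_multiples_far_from_int[OF irr, of H] by blast
  have "(\<lambda>N. (real (q N) * \<alpha>' - of_int (a' N)) * \<alpha> - (real (q N) * \<alpha> - of_int (a N)) * \<alpha>')
      \<longlonglongrightarrow> 0 * \<alpha> - 0 * \<alpha>'"
    by (intro tendsto_diff tendsto_mult d tendsto_const)
  hence "(\<lambda>N. of_int (a N) * \<alpha>' - of_int (a' N) * \<alpha>) \<longlonglongrightarrow> 0" by (simp add: algebra_simps)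
  hence small: "eventually (\<lambda>N. \<bar>of_int (a N) * \<alpha>' - of_int (a' N) * \<alpha>\<bar> < \<eta> * \<alpha>) sequentially"
    using order_tendstoD(2)[OF tendsto_rabs_zero, of _ _ "\<eta> * \<alpha>"] \<eta> pos by simp
  have "eventually (\<lambda>N. real N \<ge> 2 * C / \<epsilon>) sequentially"
    by (rule filterlim_at_top[THEN iffD1, OF filterlim_real_sequentially, rule_format])
  with small apos show "eventually (\<lambda>N. real (card (?E N)) \<le> \<epsilon> * N) sequentially"
  proof eventually_elim
    case (elim N)
    define g where "g = gcd (a N) (a' N)"
    have g: "g > 0" using elim by (simp add: g_def)
    obtain b b' where b: "a N = b * g" "a' N = b' * g" "coprime b b'"
      using gcd_coprime_exists[of "a N" "a' N"] less_imp_neq[OF g] unfolding g_def by metis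
    have bpos: "b > 0" using conjunct1[OF elim(2)] g unfolding b(1) by
        (simp add: zero_less_mult_iff)
    define h where "h = nat b"
    have h: "int h = b" "h \<ge> 1" using bpos by (auto simp: h_def)
    have rh: "real h = of_int b" using h(1) by (metis of_int_of_nat_eq)
    \<comment> \<open>A small denominator \<open>h\<close> would put
      \<open>h * (\<alpha>' / \<alpha>)\<close> within \<open>\<eta>\<close> of the integer
      \<open>b'\<close>; dividing by the gcd only decreases the distance.\<close>
    have "h > H"
    proof (rule ccontr)
      assume "\<not> h > H"
      hence "\<eta> \<le> \<bar>real h * (\<alpha>' / \<alpha>) - of_int b'\<bar>" using \<eta>(2)[of h b'] h by simp
      also have "real h * (\<alpha>' / \<alpha>) - of_int b'
          = (of_int (a N) * \<alpha>' - of_int (a' N) * \<alpha>) / (of_int g * \<alpha>)"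
        using g pos(1) unfolding b(1,2) rh by (simp add: field_simps)
      also have "\<bar>\<dots>\<bar> = \<bar>of_int (a N) * \<alpha>' - of_int (a' N) * \<alpha>\<bar> / (of_int g * \<alpha>)"
        using g pos by (simp add: abs_mult)
      also have "\<dots> \<le> \<bar>of_int (a N) * \<alpha>' - of_int (a' N) * \<alpha>\<bar> / \<alpha>"
        using g pos by (intro divide_left_mono) (auto simp: mult_le_cancel_right2)
      finally show False using elim(1) pos(1) by (simp add: pos_le_divide_eq)
    qed
    have "?E N \<subseteq> {n \<in> {1..N}. int h dvd beatty \<alpha> \<beta> n}"
    proof safe
      fix n assume "a N * beatty \<alpha>' \<beta>' n = a' N * beatty \<alpha> \<beta> n"
      hence "b * beatty \<alpha>' \<beta>' n = b' * beatty \<alpha> \<beta> n" using g by (simp add: b)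
      hence "b dvd b' * beatty \<alpha> \<beta> n" by (metis dvd_triv_left)
      thus "int h dvd beatty \<alpha> \<beta> n" using b(3) h by (simp add: coprime_dvd_mult_right_iff)
    qed
    hence "card (?E N) \<le> card {n \<in> {1..N}. int h dvd beatty \<alpha> \<beta> n}" by (intro card_mono) auto
    also have "real \<dots> \<le> C * (real N / h + 1)"
      unfolding C_def using pos h by (intro card_beatty_multiples_le) auto
    also have "\<dots> \<le> C * (real N / H + 1)"
      using C H \<open>h > H\<close> by (intro mult_left_mono add_right_mono divide_left_mono) auto
    also have "\<dots> \<le> C * (real N / (2 * C / \<epsilon>) + 1)"
      using C H \<epsilon> by (intro mult_left_mono add_right_mono divide_left_mono) auto
    also have "\<dots> \<le> \<epsilon> * N" using elim(3) C \<epsilon> by (simp add: field_simps)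
    finally show ?case by simp
  qed
qed

section \<open>Simultaneous approximation and the passage from blocks to the average over all
  n\<close>

lemma dirichlet_approx_vec:
  fixes \<alpha> :: "real^'k" and M :: nat
  assumes "M > 0"
  obtains q :: nat and a :: "'k \<Rightarrow> int" where "q > 0" "q \<le> M ^ CARD('k)"
    "\<And>i. \<bar>real q * \<alpha> $ i - of_int (a i)\<bar> < 1 / M"
proof -
  obtain h :: "nat \<Rightarrow> 'k" where h: "bij_betw h {0..<CARD('k)} UNIV"
    using ex_bij_betw_nat_finite[of "UNIV :: 'k set"] by auto
  obtain q p where qp: "0 < q" "q \<le> int (M ^ CARD('k))"
    "\<And>i. i < CARD('k) \<Longrightarrow> \<bar>of_int q * \<alpha> $ h i - of_int (p i)\<bar> < 1 / M"
    using Dirichlet_approx_simult[OF assms, of "CARD('k)" "\<lambda>i. \<alpha> $ h i"] by blast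
  show ?thesis
  proof (rule that[of "nat q" "\<lambda>i. p (inv_into {0..<CARD('k)} h i)"])
    show "nat q \<le> M ^ CARD('k)" using qp by (simp add: nat_le_iff)
    fix i
    have "i \<in> h ` {0..<CARD('k)}" using bij_betw_imp_surj_on[OF h] by simp
    hence "inv_into {0..<CARD('k)} h i < CARD('k)" "h (inv_into {0..<CARD('k)} h i) = i"
      using inv_into_into[of i h "{0..<CARD('k)}"] by (auto simp: f_inv_into_f)
    thus "\<bar>real (nat q) * \<alpha> $ i - of_int (p (inv_into {0..<CARD('k)} h i))\<bar> < 1 / M"
      using qp(3)[of "inv_into {0..<CARD('k)} h i"] qp(1) by simp
  qed (use qp in auto)
qed

lemma norm_sum_shift_le:
  fixes G :: "nat \<Rightarrow> complex"
  assumes "\<And>n. norm (G n) \<le> 1"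
  shows "norm ((\<Sum>n\<in>{1..N}. G n) - (\<Sum>n\<in>{1..N}. G (n + d))) \<le> 2 * real d"
proof (induction d)
  case (Suc d)
  have "(\<Sum>n\<in>{1..N}. F (Suc n)) - (\<Sum>n\<in>{1..N}. F n) = F (Suc N) - F 1" for F :: "nat \<Rightarrow> complex"
    by (induction N) (auto simp: algebra_simps)
  from this[of "\<lambda>n. G (n + d)"]
  have eq: "(\<Sum>n\<in>{1..N}. G (n + Suc d)) - (\<Sum>n\<in>{1..N}. G (n + d)) = G (Suc N + d) - G (1 + d)" by simp
  have "norm ((\<Sum>n\<in>{1..N}. G (n + d)) - (\<Sum>n\<in>{1..N}. G (n + Suc d)))
      = norm (G (Suc N + d) - G (1 + d))"
    unfolding eq[symmetric] by (rule norm_minus_commute)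
  also have "\<dots> \<le> 1 + 1" by (rule order_trans[OF norm_triangle_ineq4 add_mono[OF assms assms]])
  finally have "norm ((\<Sum>n\<in>{1..N}. G n) - (\<Sum>n\<in>{1..N}. G (n + Suc d))) \<le> 2 * real d + (1 + 1)"
    by (rule norm_diff_triangle_le[OF Suc.IH])
  thus ?case by simp
qed simp

text \<open>Shifting the summation range by 1 changes the sum by two terms of modulus at most 1, so
  the mean may be computed from block averages at a cost of order \<open>q * S / N\<close>. The
  error \<open>r n\<close> depends on \<open>n\<close> because it is small only on average; for bad
  \<open>n\<close> the trivial bound 2 is used.\<close>

lemma mean_via_blocks:
  fixes G :: "nat \<Rightarrow> complex"
  assumes G: "\<And>n. norm (G n) \<le> 1" and E: "norm E \<le> 1" and N: "N > 0" "S > 0" and bad: "finite bad"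
    and est: "\<And>n. n \<in> {1..N} \<Longrightarrow> n \<notin> bad \<Longrightarrow> norm (avg S (\<lambda>s. G (n + q * s)) - E) \<le> r n + R"
    and nonneg: "\<And>n. r n \<ge> 0" "R \<ge> 0"
  shows "norm ((\<Sum>n\<in>{1..N}. G n) / of_nat N - E)
      \<le> 2 * (real q * S / N) + 2 * (card bad / N) + (\<Sum>n\<in>{1..N}. r n) / N + R"
proof -
  let ?A = "\<lambda>n. avg S (\<lambda>s. G (n + q * s))"
  have shift: "norm ((\<Sum>n\<in>{1..N}. G n) - (\<Sum>n\<in>{1..N}. ?A n)) \<le> 2 * (real q * S)"
  proof -
    have "(\<Sum>n\<in>{1..N}. G n) - (\<Sum>n\<in>{1..N}. ?A n)
        = avg S (\<lambda>s. (\<Sum>n\<in>{1..N}. G n) - (\<Sum>n\<in>{1..N}. G (n + q * s)))"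
      using N by (simp add: avg_diff avg_const avg_sum)
    also have "norm \<dots> \<le> avg S (\<lambda>s. norm ((\<Sum>n\<in>{1..N}. G n) - (\<Sum>n\<in>{1..N}. G (n + q * s))))"
      by (rule norm_avg_le)
    also have "\<dots> \<le> avg S (\<lambda>s. 2 * (real q * S))"
    proof (rule avg_mono)
      fix s assume "s < S"
      have "norm ((\<Sum>n\<in>{1..N}. G n) - (\<Sum>n\<in>{1..N}. G (n + q * s))) \<le> 2 * real (q * s)"
        by (rule norm_sum_shift_le[OF G])
      also have "real (q * s) \<le> real q * S" using \<open>s < S\<close> by (simp add: mult_left_mono)
      finally show "norm ((\<Sum>n\<in>{1..N}. G n) - (\<Sum>n\<in>{1..N}. G (n + q * s))) \<le> 2 * (real q * S)" by simp
    qed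
    also have "\<dots> = 2 * (real q * S)" using N by (simp add: avg_const)
    finally show ?thesis .
  qed
  have pointwise: "norm (?A n - E) \<le> r n + R + 2 * of_bool (n \<in> bad)" if "n \<in> {1..N}" for n
  proof (cases "n \<in> bad")
    case True
    have "norm (?A n) \<le> 1"
      using order_trans[OF norm_avg_le avg_mono[OF G, of S]] N by (simp add: avg_const)
    hence "norm (?A n - E) \<le> 1 + 1"
      by (rule order_trans[OF norm_triangle_ineq4 add_mono[OF _ E]])
    thus ?thesis using True nonneg(1)[of n] nonneg(2) by simp
  qed (use est that in auto)
  have "norm ((\<Sum>n\<in>{1..N}. ?A n) - of_nat N * E)
      = norm (\<Sum>n\<in>{1..N}. ?A n - E)" by (simp add: sum_subtractf)
  also have "\<dots> \<le> (\<Sum>n\<in>{1..N}. r n + R + 2 * of_bool (n \<in> bad))"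
    by (rule sum_norm_le) (rule pointwise)
  also have "\<dots> = (\<Sum>n\<in>{1..N}. r n) + N * R + 2 * (\<Sum>n\<in>{1..N}. of_bool (n \<in> bad))"
    by (simp add: sum.distrib sum_distrib_left)
  also have "(\<Sum>n\<in>{1..N}. of_bool (n \<in> bad)) = real (card ({1..N} \<inter> bad))"
    by (simp add: of_bool_def sum.If_cases)
  also have "real (card ({1..N} \<inter> bad)) \<le> card bad" using bad by (intro of_nat_mono card_mono) auto
  finally have "norm ((\<Sum>n\<in>{1..N}. ?A n) - of_nat N * E)
      \<le> (\<Sum>n\<in>{1..N}. r n) + N * R + 2 * card bad" by simp
  from norm_diff_triangle_le[OF shift this]
  have total: "norm ((\<Sum>n\<in>{1..N}. G n) - of_nat N * E)
      \<le> 2 * (real q * S) + ((\<Sum>n\<in>{1..N}. r n) + N * R + 2 * card bad)" .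
  have "(\<Sum>n\<in>{1..N}. G n) / of_nat N - E = ((\<Sum>n\<in>{1..N}. G n) - of_nat N * E) / of_nat N"
    using N by (simp add: diff_divide_distrib)
  hence "norm ((\<Sum>n\<in>{1..N}. G n) / of_nat N - E) = norm ((\<Sum>n\<in>{1..N}. G n) - of_nat N * E) / N"
    by (simp only: norm_divide norm_of_nat)
  also have "\<dots> \<le> (2 * (real q * S) + ((\<Sum>n\<in>{1..N}. r n) + N * R + 2 * card bad)) / N"
    using total by (rule divide_right_mono) simp
  also have "\<dots> = 2 * (real q * S / N) + 2 * (card bad / N) + (\<Sum>n\<in>{1..N}. r n) / N + R"
    using N by (simp add: add_divide_distrib)
  finally show ?thesis .
qed

lemma card_UN_density_zero:
  fixes B :: "'i \<Rightarrow> nat \<Rightarrow> nat set"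
  assumes "finite I" "\<And>i. i \<in> I \<Longrightarrow> (\<lambda>N. card (B i N) / N) \<longlonglongrightarrow> 0"
  shows "(\<lambda>N. card (\<Union>i\<in>I. B i N) / N) \<longlonglongrightarrow> 0"
proof (rule tendsto_sandwich[OF always_eventually always_eventually tendsto_const])
  show "(\<lambda>N. \<Sum>i\<in>I. card (B i N) / N) \<longlonglongrightarrow> 0"
    using tendsto_sum[of I "\<lambda>i N. card (B i N) / N" "\<lambda>_. 0", OF assms(2)] by simp
  show "\<forall>N. card (\<Union>i\<in>I. B i N) / N \<le> (\<Sum>i\<in>I. card (B i N) / N)"
  proof
    fix N
    have "real (card (\<Union>i\<in>I. B i N)) \<le> (\<Sum>i\<in>I. real (card (B i N)))"
      using card_UN_le[OF assms(1), of "\<lambda>i. B i N"] by (simp flip: of_nat_sum)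
    thus "card (\<Union>i\<in>I. B i N) / N \<le> (\<Sum>i\<in>I. card (B i N) / N)"
      by (simp only: sum_divide_distrib [symmetric]) (rule divide_right_mono, simp_all)
  qed
qed auto

text \<open>Bounds the average number of primes dividing an entire block. Counting by primes, each
  \<open>p\<close> dividing \<open>a\<close> divides O(N / p) of the starting values, which leaves
  the reciprocal sum over prime divisors of \<open>a\<close>. Since
  \<open>p \<le> y \<le> N\<close>, the additive 1 of \<open>card_beatty_multiples_le\<close> is
  absorbed by the factor 2.\<close>

lemma sum_card_beatty_le:
  assumes "\<alpha> > 0" "a \<noteq> 0" "\<bar>real_of_int a\<bar> \<le> X" "z > 1" "y \<le> real N"
  shows "(\<Sum>n\<in>{1..N}. real (card {p \<in> primes_le y. int p dvd a \<and> int p dvd beatty \<alpha> \<beta> n}))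
      \<le> 2 * ((\<alpha> + 3) * (1 / \<alpha> + 1)) * (prime_recip_sum z + ln X / (z * ln z)) * N"
proof -
  define D where "D = {p \<in> primes_le y. int p dvd a}"
  define C where "C = (\<alpha> + 3) * (1 / \<alpha> + 1)"
  have C: "C \<ge> 0" using assms by (simp add: C_def)
  have "(\<Sum>n\<in>{1..N}. real (card {p \<in> primes_le y. int p dvd a \<and> int p dvd beatty \<alpha> \<beta> n}))
      = (\<Sum>n\<in>{1..N}. \<Sum>p\<in>D. of_bool (int p dvd beatty \<alpha> \<beta> n))"
    by (intro sum.cong refl) (simp add: D_def of_bool_def sum.If_cases Int_def)
  also have "\<dots> = (\<Sum>p\<in>D. \<Sum>n\<in>{1..N}. of_bool (int p dvd beatty \<alpha> \<beta> n))" by (rule sum.swap)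
  also have "\<dots> = (\<Sum>p\<in>D. real (card {n \<in> {1..N}. int p dvd beatty \<alpha> \<beta> n}))"
    by (intro sum.cong refl) (simp add: of_bool_def sum.If_cases Int_def)
  also have "\<dots> \<le> (\<Sum>p\<in>D. 2 * C * N * (1 / real p))"
  proof (rule sum_mono)
    fix p assume "p \<in> D"
    hence p: "p > 0" "real p \<le> N" using assms(5) prime_gt_0_nat by (auto simp: D_def primes_le_def)
    have "real (card {n \<in> {1..N}. int p dvd beatty \<alpha> \<beta> n}) \<le> C * (real N / p + 1)"
      unfolding C_def using assms(1) p(1) by (rule card_beatty_multiples_le)
    also have "1 \<le> real N / p" using p by simp
    hence "C * (real N / p + 1) \<le> C * (real N / p + real N / p)" using C by
        (intro mult_left_mono) linarith+
    finally show "real (card {n \<in> {1..N}. int p dvd beatty \<alpha> \<beta> n}) \<le> 2 * C * N * (1 / real p)" by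
        (simp add: mult_ac)
  qed
  also have "\<dots> = 2 * C * N * (\<Sum>p\<in>D. 1 / real p)" by (simp only: sum_distrib_left)
  also have "\<dots> \<le> 2 * C * N * (prime_recip_sum z + ln X / (z * ln z))"
    unfolding D_def using C assms by (intro mult_left_mono sum_inverse_prime_divisors_le) auto
  finally show ?thesis by (simp add: C_def mult_ac)
qed

lemma beatty_lt_1_density_zero:
  assumes "\<alpha> > 0"
  shows "(\<lambda>N. card {n \<in> {1..N}. beatty \<alpha> \<beta> n < 1} / N) \<longlonglongrightarrow> 0"
proof (rule tendsto_sandwich[OF always_eventually always_eventually tendsto_const])
  let ?B = "\<lambda>N. {n \<in> {1..N}. beatty \<alpha> \<beta> n < 1}"
  define m where "m = nat \<lceil>(1 - \<beta>) / \<alpha>\<rceil>"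
  show "\<forall>N. card (?B N) / real N \<le> real (m + 1) / real N"
  proof
    fix N
    have "?B N \<subseteq> {..m}"
    proof safe
      fix n assume "beatty \<alpha> \<beta> n < 1"
      hence "\<alpha> * real n + \<beta> < 1" by (simp add: beatty_def floor_less_iff)
      hence "real n < (1 - \<beta>) / \<alpha>" using assms by (simp add: field_simps)
      thus "n \<le> m" unfolding m_def by linarith
    qed
    hence "card (?B N) \<le> m + 1" using card_mono[of "{..m}"] by fastforce
    hence "real (card (?B N)) \<le> real (m + 1)" by (simp only: of_nat_le_iff)
    thus "card (?B N) / real N \<le> real (m + 1) / real N" by (rule divide_right_mono) simp
  qed
  show "(\<lambda>N. real (m + 1) / real N) \<longlonglongrightarrow> 0" by (rule lim_const_over_n)
qed auto

section \<open>Choice of the parameters\<close>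

definition loglog :: "nat \<Rightarrow> real" where "loglog N = ln (ln (real N))"

text \<open>The exponent \<open>1 / (log log N)\<^bsup>1/4\<^esup>\<close> of \<open>N\<close> in the cutoff tends to \<open>0\<close>, so fixed
  powers of the cutoff are shorter than a block, but slowly enough that numbers up to \<open>N\<^sup>5\<close> have
  only \<open>o(sqrt (log log N))\<close> prime factors above it.\<close>

definition cutoff :: "nat \<Rightarrow> real" where "cutoff N = exp (ln (real N) / loglog N powr (1 / 4))"

text \<open>With \<open>M = approx_order k N\<close>, Dirichlet's theorem yields
  \<open>q \<le> M ^ k \<le> sqrt N\<close> with error below \<open>1 / M\<close>. The block length
  \<open>S\<close> is about \<open>sqrt M\<close>, so the drift \<open>S / M\<close> along a block
  tends to 0, while the span \<open>q * S\<close> is at most \<open>N powr (3 / 4)\<close>.\<close>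

definition step_count :: "nat \<Rightarrow> nat \<Rightarrow> nat" where "step_count k N
    = nat \<lfloor>real N powr (1 / (4 * real k))\<rfloor>"

definition approx_order :: "nat \<Rightarrow> nat \<Rightarrow> nat" where "approx_order k N
    = nat \<lfloor>real N powr (1 / (2 * real k))\<rfloor>"

lemma loglog_at_top: "filterlim loglog at_top sequentially"
  unfolding loglog_def by real_asymp

lemma cutoff_bounds: "eventually (\<lambda>N. cutoff N > 1 \<and> cutoff N \<le> N \<and> ln (real N) > 1
    \<and> loglog N > 1) sequentially"
proof -
  have "filterlim (\<lambda>N. ln (real N)) at_top sequentially" by real_asymp
  hence "eventually (\<lambda>N. ln (real N) > 1) sequentially"
      by (rule filterlim_at_top_dense[THEN iffD1, rule_format])
  moreover have "eventually (\<lambda>N. loglog N > 1) sequentially"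
      by (rule filterlim_at_top_dense[THEN iffD1, OF loglog_at_top, rule_format])
  ultimately show ?thesis using eventually_gt_at_top[of 1]
  proof eventually_elim
    case (elim N)
    have "loglog N powr (1 / 4) \<ge> 1" using elim by (intro ge_one_powr_ge_zero) auto
    hence "ln (real N) / loglog N powr (1 / 4) \<le> ln (real N) / 1" using elim by
        (intro divide_left_mono) auto
    hence "cutoff N \<le> exp (ln (real N))" by (simp add: cutoff_def)
    moreover have "ln (real N) / loglog N powr (1 / 4) > 0" using elim by
        (intro divide_pos_pos) auto
    ultimately show ?case using elim by (simp add: cutoff_def)
  qed
qed

text \<open>\<open>ln (ln (cutoff N))\<close> equals \<open>loglog N - ln (loglog N) / 4\<close>,
  and the errors of both prime sum bounds are of the order of \<open>ln (loglog N)\<close> as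
  well.\<close>

lemma prime_recip_sum_cutoff:
  "(\<lambda>N. \<bar>prime_recip_sum (cutoff N) - loglog N\<bar> / sqrt (loglog N)) \<longlonglongrightarrow> 0"
proof -
  define lo where "lo N = (ln (ln (real N) / loglog N powr (1 / 4)) - 2 - loglog N) / sqrt (loglog
      N)" for N
  define up where "up N = ((ln (1 + loglog N * (ln (real N) / loglog N powr (1 / 4))) + 1) / (1 -
      1 / loglog N) - loglog N) / sqrt (loglog N)" for N
  have lim: "lo \<longlonglongrightarrow> 0" "up \<longlonglongrightarrow> 0" unfolding lo_def up_def loglog_def by real_asymp+
  have bounds: "eventually (\<lambda>N. lo N \<le> (prime_recip_sum (cutoff N) - loglog N) / sqrt (loglog N) \<and>
      (prime_recip_sum (cutoff N) - loglog N) / sqrt (loglog N) \<le> up N) sequentially"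
    using cutoff_bounds
  proof eventually_elim
    case (elim N)
    have lN: "ln (real N) > 0" using elim by linarith
    have cut: "cutoff N > 1" "ln (cutoff N) = ln (real N) / loglog N powr (1 / 4)"
      using elim lN by (auto simp: cutoff_def)
    \<comment> \<open>With \<open>K = loglog N\<close> the relative loss \<open>1 / K\<close>
      amounts to a bounded error, at the price of an additive \<open>ln K\<close>.\<close>
    have "(1 - 1 / loglog N) * prime_recip_sum (cutoff N) \<le> ln (1 + loglog N * ln (cutoff N)) + 1"
      using cut elim by (intro prime_recip_sum_le) auto
    hence "prime_recip_sum (cutoff N)
        \<le> (ln (1 + loglog N * ln (cutoff N)) + 1) / (1 - 1 / loglog N)"
      using elim by (simp add: pos_le_divide_eq mult.commute)
    moreover have "prime_recip_sum (cutoff N) \<ge> ln (ln (cutoff N)) - 2"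
      using cut by (intro prime_recip_sum_ge)
    ultimately show ?case unfolding lo_def up_def cut(2)
      using elim by (intro conjI divide_right_mono) auto
  qed
  have "(\<lambda>N. (prime_recip_sum (cutoff N) - loglog N) / sqrt (loglog N)) \<longlonglongrightarrow> 0"
    by (rule tendsto_sandwich[OF _ _ lim]) (use bounds in \<open>auto elim: eventually_mono\<close>)
  hence "(\<lambda>N. \<bar>(prime_recip_sum (cutoff N) - loglog N) / sqrt (loglog N)\<bar>) \<longlonglongrightarrow> 0"
      by (rule tendsto_rabs_zero)
  moreover have "eventually (\<lambda>N. \<bar>(prime_recip_sum (cutoff N) - loglog N) / sqrt (loglog N)\<bar>
      = \<bar>prime_recip_sum (cutoff N) - loglog N\<bar> / sqrt (loglog N)) sequentially"
    using cutoff_bounds by eventually_elim simp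
  ultimately show ?thesis by (rule Lim_transform_eventually)
qed

text \<open>The bound of \<open>sum_inverse_prime_divisors_le\<close> for \<open>X = N^5\<close> and
  \<open>z = ln N\<close>.\<close>

definition divisor_bound :: "nat \<Rightarrow> real" where
  "divisor_bound N = prime_recip_sum (ln (real N)) + ln (real N ^ 5) / (ln (real N) * ln (ln (real
      N)))"

lemma divisor_bound_negligible: "(\<lambda>N. divisor_bound N / sqrt (loglog N)) \<longlonglongrightarrow> 0"
proof -
  define up where "up N = (2 * (ln (1 + 2 * loglog N) + 1) + 5 / loglog N) / sqrt (loglog N)" for N
  have bounds: "eventually (\<lambda>N. 0 \<le> divisor_bound N / sqrt (loglog N)
      \<and> divisor_bound N / sqrt (loglog N) \<le> up N) sequentially"
    using cutoff_bounds
  proof eventually_elim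
    case (elim N)
    \<comment> \<open>Only the order of magnitude matters here, so \<open>K = 2\<close> will
      do.\<close>
    have "(1 - 1 / 2) * prime_recip_sum (ln (real N)) \<le> ln (1 + 2 * loglog N) + 1"
      unfolding loglog_def using elim by (intro prime_recip_sum_le) auto
    moreover have "ln (real N ^ 5) / (ln (real N) * ln (ln (real N))) = 5 / loglog N"
      using elim by (simp add: ln_realpow loglog_def)
    moreover have "prime_recip_sum (ln (real N)) \<ge> 0"
      unfolding prime_recip_sum_def by (intro sum_nonneg) auto
    ultimately show ?case using elim unfolding up_def divisor_bound_def
      by (intro conjI divide_right_mono divide_nonneg_nonneg) auto
  qed
  have lim: "up \<longlonglongrightarrow> 0" unfolding up_def loglog_def by real_asymp
  show ?thesis
    by (rule tendsto_sandwich[OF _ _ tendsto_const lim]; rule eventually_mono[OF bounds]; blast)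
qed

lemma nat_floor_powr_bounds:
  assumes "u > 0"
  shows "eventually (\<lambda>N. real N powr u / 2 \<le> real (nat \<lfloor>real N powr u\<rfloor>)
      \<and> real (nat \<lfloor>real N powr u\<rfloor>) \<le> real N powr u
          \<and> nat \<lfloor>real N powr u\<rfloor> > 0) sequentially"
proof -
  have "filterlim (\<lambda>N. real N powr u) at_top sequentially" using assms by real_asymp
  hence "eventually (\<lambda>N. real N powr u \<ge> 2) sequentially"
      by (rule filterlim_at_top[THEN iffD1, rule_format])
  thus ?thesis
  proof eventually_elim
    case (elim N)
    have "real N powr u \<le> real (nat \<lfloor>real N powr u\<rfloor>) + 1" using elim by linarith
    thus ?case using elim by linarith
  qed
qed

lemma cutoff_power_negligible:
  assumes "k > 0"
  shows "(\<lambda>N. (1 + (cutoff N)\<^sup>2) ^ K / step_count k N) \<longlonglongrightarrow> 0"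
proof -
  define u where "u = 1 / (4 * real k)"
  have u: "u > 0" using assms by (simp add: u_def)
  \<comment> \<open>Chosen so that \<open>K * (2 * \<delta>) \<le> u / 2\<close>: once the cutoff is
    at most \<open>N powr \<delta>\<close>, its powers use up only half of the exponent of the block
    length.\<close>
  define \<delta> where "\<delta> = u / (4 * (real K + 1))"
  have \<delta>: "\<delta> > 0" using u by (simp add: \<delta>_def)
  have "(\<lambda>N. 1 / loglog N powr (1 / 4)) \<longlonglongrightarrow> 0" unfolding loglog_def by real_asymp
  hence ev: "eventually (\<lambda>N. 1 / loglog N powr (1 / 4) < \<delta>) sequentially" using \<delta>
      by (rule order_tendstoD)
  have "eventually (\<lambda>N. 0 \<le> (1 + (cutoff N)\<^sup>2) ^ K / step_count k N \<and>
      (1 + (cutoff N)\<^sup>2) ^ K / step_count k N \<le> 2 * 2 ^ K * real N powr (- u / 2)) sequentially"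
    using ev nat_floor_powr_bounds[OF u] eventually_gt_at_top[of 1]
  proof eventually_elim
    case (elim N)
    have N: "real N > 1" "ln (real N) > 0" using elim by auto
    have S: "real (step_count k N) \<ge> real N powr u / 2" using elim by
        (simp add: step_count_def u_def)
    have "ln (real N) / loglog N powr (1 / 4) \<le> \<delta> * ln (real N)"
      using mult_right_mono[OF less_imp_le[OF elim(1)], of "ln (real N)"] N by simp
    hence cut: "cutoff N \<le> real N powr \<delta>" "cutoff N > 0" using N by (auto simp: cutoff_def powr_def)
    have "1 + (cutoff N)\<^sup>2 \<le> 1 + (real N powr \<delta>)\<^sup>2" using cut by
        (intro add_left_mono power_mono) auto
    also have "\<dots> \<le> 2 * (real N powr \<delta>)\<^sup>2"
      using N \<delta> by (simp add: one_le_power ge_one_powr_ge_zero)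
    also have "(real N powr \<delta>)\<^sup>2 = real N powr (2 * \<delta>)" using N by (simp add: powr_power)
    finally have "(1 + (cutoff N)\<^sup>2) ^ K \<le> (2 * real N powr (2 * \<delta>)) ^ K" by (intro power_mono) auto
    also have "\<dots> = 2 ^ K * real N powr (K * (2 * \<delta>))" using N by
        (simp add: power_mult_distrib powr_power)
    also have "\<dots> \<le> 2 ^ K * real N powr (u / 2)"
    proof (intro mult_left_mono powr_mono)
      have "K * (2 * \<delta>) \<le> (real K + 1) * (2 * \<delta>)" using \<delta> by (intro mult_right_mono) auto
      also have "\<dots> = u / 2" unfolding \<delta>_def using of_nat_0_le_iff[of K, where 'a = real]
        by (simp add: divide_simps del: of_nat_0_le_iff)
      finally show "K * (2 * \<delta>) \<le> u / 2" .
    qed (use N in auto)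
    finally have "(1 + (cutoff N)\<^sup>2) ^ K / step_count k N
        \<le> 2 ^ K * real N powr (u / 2) / (real N powr u / 2)"
      using S N by (intro frac_le) auto
    also have "\<dots> = 2 * 2 ^ K * (real N powr (u / 2) / real N powr u)" by simp
    also have "real N powr (u / 2) / real N powr u = real N powr (u / 2 - u)"
        by (rule powr_diff [symmetric])
    also have "u / 2 - u = - u / 2" by simp
    finally show ?case by simp
  qed
  note bounds = this
  have lim: "(\<lambda>N. 2 * 2 ^ K * real N powr (- u / 2)) \<longlonglongrightarrow> 0" using u by real_asymp
  show ?thesis
    by (rule tendsto_sandwich[OF _ _ tendsto_const lim]; rule eventually_mono[OF bounds]; blast)
qed

lemma log_ratio_negligible: "(\<lambda>N. ln (real N ^ 5) / ln (cutoff N) / sqrt (loglog N)) \<longlonglongrightarrow> 0"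
proof -
  have "(\<lambda>N. 5 * loglog N powr (1 / 4) / sqrt (loglog N)) \<longlonglongrightarrow> 0" unfolding loglog_def by real_asymp
  moreover have "eventually (\<lambda>N. 5 * loglog N powr (1 / 4) / sqrt (loglog N)
      = ln (real N ^ 5) / ln (cutoff N) / sqrt (loglog N)) sequentially"
    using eventually_gt_at_top[of 1] 
  proof eventually_elim
    case (elim N)
    hence "ln (real N) > 0" by simp
    thus ?case using elim by (simp add: cutoff_def ln_realpow)
  qed
  ultimately show ?thesis by (rule Lim_transform_eventually)
qed

text \<open>The bound on \<open>q\<close> is assumed only for positive \<open>approx_order\<close>,
  where Dirichlet's theorem applies; that is the case for all large \<open>N\<close>.\<close>

lemma block_length_negligible:
  assumes "k > 0" "\<And>N. approx_order k N > 0 \<Longrightarrow> q N \<le> approx_order k N ^ k"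
  shows "(\<lambda>N. real (q N) * step_count k N / N) \<longlonglongrightarrow> 0" and "eventually (\<lambda>N. q N \<le> N \<and> step_count k N
      \<le> N) sequentially"
proof -
  define u where "u = 1 / (4 * real k)"
  have u: "u > 0" "1 / (2 * real k) = 2 * u" "2 * u * k = 1 / 2" "u \<le> 1 / 4" using assms(1) by
      (auto simp: u_def field_simps)
  have u2: "2 * u > 0" using u by simp
  have ev: "eventually (\<lambda>N. real (q N) \<le> real N powr (1 / 2) \<and> real (step_count k N)
      \<le> real N powr (1 / 4)) sequentially"
    using nat_floor_powr_bounds[OF u(1)] nat_floor_powr_bounds[OF u2] eventually_gt_at_top[of 0]
  proof eventually_elim
    case (elim N)
    have M: "approx_order k N > 0" "real (approx_order k N) \<le> real N powr (2 * u)"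
      using elim u by (auto simp: approx_order_def)
    have "real (q N) \<le> real (approx_order k N) ^ k" using assms(2)[OF M(1)] by
        (simp flip: of_nat_power)
    also have "\<dots> \<le> (real N powr (2 * u)) ^ k" using M by (intro power_mono) auto
    also have "\<dots> = real N powr (real k * (2 * u))" using elim by (simp add: powr_power)
    also have "real k * (2 * u) = 1 / 2" using u(3) by (simp add: mult.commute)
    finally have "real (q N) \<le> real N powr (1 / 2)" .
    moreover have "real (step_count k N) \<le> real N powr u" using elim by
        (simp add: step_count_def u_def)
    moreover have "real N powr u \<le> real N powr (1 / 4)" using elim u by (intro powr_mono) auto
    ultimately show ?case by linarith
  qed
  show "(\<lambda>N. real (q N) * step_count k N / N) \<longlonglongrightarrow> 0"
  proof (rule tendsto_sandwich[OF _ _ tendsto_const])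
    show "eventually (\<lambda>N. real (q N) * step_count k N / N
        \<le> real N powr (1 / 2) * real N powr (1 / 4) / N) sequentially"
      using ev by eventually_elim (intro divide_right_mono mult_mono, auto)
    show "(\<lambda>N. real N powr (1 / 2) * real N powr (1 / 4) / N) \<longlonglongrightarrow> 0" by real_asymp
  qed auto
  show "eventually (\<lambda>N. q N \<le> N \<and> step_count k N \<le> N) sequentially"
    using ev eventually_gt_at_top[of 0]
  proof eventually_elim
    case (elim N)
    have "real N powr (1 / 2) \<le> real N powr 1" "real N powr (1 / 4) \<le> real N powr 1"
      using elim by (intro powr_mono; simp)+
    thus ?case using elim by simp
  qed
qed

lemma step_count_div_approx_order:
  assumes "k > 0"
  shows "(\<lambda>N. step_count k N / approx_order k N) \<longlonglongrightarrow> 0" and "(\<lambda>N. 1 / real (approx_order k N)) \<longlonglongrightarrow> 0"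
    and "eventually (\<lambda>N. step_count k N > 0 \<and> approx_order k N > 0) sequentially"
proof -
  define u where "u = 1 / (4 * real k)"
  have u: "u > 0" "1 / (2 * real k) = 2 * u" using assms(1) by (auto simp: u_def)
  have u2: "2 * u > 0" using u by simp
  have ev: "eventually (\<lambda>N. real (step_count k N) \<le> real N powr u
      \<and> real (approx_order k N) \<ge> real N powr (2 * u) / 2 \<and> step_count k N > 0
      \<and> approx_order k N > 0 \<and> N > 0) sequentially"
    using nat_floor_powr_bounds[OF u(1)] nat_floor_powr_bounds[OF u2] eventually_gt_at_top[of 0]
  proof eventually_elim
    case (elim N)
    have "step_count k N = nat \<lfloor>real N powr u\<rfloor>" by (simp add: step_count_def u_def)
    moreover have "approx_order k N = nat \<lfloor>real N powr (2 * u)\<rfloor>" by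
        (simp only: approx_order_def u(2))
    ultimately show ?case using elim by simp
  qed
  thus "eventually (\<lambda>N. step_count k N > 0 \<and> approx_order k N > 0) sequentially"
      by eventually_elim auto
  show "(\<lambda>N. step_count k N / approx_order k N) \<longlonglongrightarrow> 0"
  proof (rule tendsto_sandwich[OF _ _ tendsto_const])
    show "eventually (\<lambda>N. step_count k N / approx_order k N
        \<le> real N powr u / (real N powr (2 * u) / 2)) sequentially"
      using ev by eventually_elim (intro frac_le, auto)
    show "(\<lambda>N. real N powr u / (real N powr (2 * u) / 2)) \<longlonglongrightarrow> 0" using u(1) by real_asymp
  qed auto
  show "(\<lambda>N. 1 / real (approx_order k N)) \<longlonglongrightarrow> 0"
  proof (rule tendsto_sandwich[OF _ _ tendsto_const])
    show "eventually (\<lambda>N. 1 / real (approx_order k N) \<le> 1 / (real N powr (2 * u) / 2)) sequentially"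
      using ev by eventually_elim (intro frac_le, auto)
    show "(\<lambda>N. 1 / (real N powr (2 * u) / 2)) \<longlonglongrightarrow> 0" using u(1) by real_asymp
  qed auto
qed

section \<open>Convergence of characteristic functions\<close>

text \<open>Integrals of these functions are finite linear combinations of values of the
  characteristic function, so their convergence is a matter of linearity. Closure under products
  follows from the addition law of \<open>cis\<close>.\<close>

inductive trig_poly :: "(real^'k \<Rightarrow> complex) \<Rightarrow> bool" where
  cis: "trig_poly (\<lambda>x. cis (t \<bullet> x))"
| cmult: "trig_poly f \<Longrightarrow> trig_poly (\<lambda>x. c * f x)"
| add: "trig_poly f \<Longrightarrow> trig_poly g \<Longrightarrow> trig_poly (\<lambda>x. f x + g x)"

lemma trig_poly_const: "trig_poly (\<lambda>_. c)"
  using trig_poly.cmult[OF trig_poly.cis[of 0], of c] by simp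

lemma trig_poly_sum: "finite A \<Longrightarrow> (\<And>i. i \<in> A \<Longrightarrow> trig_poly (f i)) \<Longrightarrow> trig_poly (\<lambda>x. \<Sum>i\<in>A. f i x)"
  by (induction A rule: finite_induct) (auto intro: trig_poly_const trig_poly.add)

lemma trig_poly_mult:
  assumes "trig_poly f" "trig_poly g"
  shows "trig_poly (\<lambda>x. f x * g x)"
proof -
  have "trig_poly (\<lambda>x. cis (t \<bullet> x) * g x)" for t
    using assms(2)
  proof (induction rule: trig_poly.induct)
    case (cis u)
    show ?case using trig_poly.cis[of "t + u"] by (simp add: cis_mult inner_add_left)
  next
    case (cmult g c)
    show ?case using trig_poly.cmult[OF cmult.IH, of c] by (simp add: mult_ac)
  next
    case (add g h)
    show ?case using trig_poly.add[OF add.IH] by (simp add: distrib_left)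
  qed
  with assms(1) show ?thesis
  proof (induction rule: trig_poly.induct)
    case (cmult f c)
    show ?case using trig_poly.cmult[OF cmult.IH[OF cmult.prems], of c] by (simp add: mult_ac)
  next
    case (add f h)
    show ?case using trig_poly.add[OF add.IH(1)[OF add.prems] add.IH(2)[OF add.prems]]
      by (simp add: distrib_right)
  qed
qed

lemma trig_poly_sin: "trig_poly (\<lambda>x. complex_of_real (sin (t \<bullet> x)))"
proof -
  have eq: "complex_of_real (sin y) = - \<i> / 2 * cis y + \<i> / 2 * cis (- y)" for y
    by (simp add: complex_eq_iff)
  have "trig_poly (\<lambda>x. - \<i> / 2 * cis (t \<bullet> x) + \<i> / 2 * cis ((- t) \<bullet> x))"
    by (intro trig_poly.intros)
  thus ?thesis by (simp only: eq inner_minus_left)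
qed

text \<open>The substituted coordinates are trigonometric polynomials, and sums and products
  preserve these. The base case of polynomial functions is an arbitrary linear functional, hence the
  expansion in the standard basis.\<close>

lemma trig_poly_real_polynomial:
  fixes p :: "real^'k \<Rightarrow> real"
  assumes "real_polynomial_function p"
  shows "trig_poly (\<lambda>x::real^'k. complex_of_real (p (\<chi> i. sin (c * x $ i) / c)))"
  using assms
proof (induction rule: real_polynomial_function.induct)
  case (linear f)
  interpret bounded_linear f by fact
  have eq: "complex_of_real (f (\<chi> i. sin (c * x $ i) / c))
      = (\<Sum>i\<in>UNIV. complex_of_real (f (axis i 1) / c) * complex_of_real (sin ((c *\<^sub>R axis i 1) \<bullet>
          x)))" for x
  proof -
    have "(\<chi> i. sin (c * x $ i) / c) = (\<Sum>i\<in>UNIV. (sin (c * x $ i) / c) *\<^sub>R axis i 1)"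
      by (subst basis_expansion[symmetric]) (simp add: scalar_mult_eq_scaleR)
    hence "f (\<chi> i. sin (c * x $ i) / c) = (\<Sum>i\<in>UNIV. (sin (c * x $ i) / c) * f (axis i 1))"
      by (simp add: sum scaleR)
    thus ?thesis by (simp add: inner_axis' mult_ac)
  qed
  show ?case unfolding eq by (intro trig_poly_sum trig_poly.cmult trig_poly_sin) simp
qed (auto intro: trig_poly_const trig_poly.add trig_poly_mult)

section \<open>Levy's continuity theorem in several dimensions\<close>

lemma integrable_bounded_continuous:
  fixes M :: "(real^'k) measure" and f :: "real^'k \<Rightarrow> 'b::{banach, second_countable_topology}"
  assumes "prob_space M" "sets M = sets borel" "continuous_on UNIV f" "bounded (range f)"
  shows "integrable M f"
proof -
  interpret prob_space M by fact
  obtain B where "\<And>x. norm (f x) \<le> B" using assms(4) by (auto simp: bounded_iff)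
  moreover have "f \<in> borel_measurable M"
    using borel_measurable_continuous_onI[OF assms(3)]
    by (simp add: measurable_cong_sets[OF assms(2) refl])
  ultimately show ?thesis by (intro integrable_const_bound[where B = B]) auto
qed

text \<open>The limit measure is given in advance; tightness is not assumed but derived from the
  one-dimensional marginals.\<close>

locale char_convergence =
  fixes \<mu> :: "nat \<Rightarrow> (real^'k) measure" and \<nu> :: "(real^'k) measure"
  assumes prob: "\<And>N. prob_space (\<mu> N)" "prob_space \<nu>"
    and sets: "\<And>N. sets (\<mu> N) = sets borel" "sets \<nu> = sets borel"
    and char: "\<And>t. (\<lambda>N. \<integral>x. cis (t \<bullet> x) \<partial>\<mu> N) \<longlonglongrightarrow> (\<integral>x. cis (t \<bullet> x) \<partial>\<nu>)"

lemma (in char_convergence) trig_poly_integral_tendsto: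
  assumes "trig_poly f"
  shows "continuous_on UNIV f \<and> bounded (range f) \<and>
           (\<lambda>N. \<integral>x. f x \<partial>\<mu> N) \<longlonglongrightarrow> (\<integral>x. f x \<partial>\<nu>)"
proof -
  note int = integrable_bounded_continuous
  show ?thesis using assms
  proof (induction rule: trig_poly.induct)
    case (cis t)
    have "bounded (range (\<lambda>x. cis (t \<bullet> x)))" by (rule boundedI[where B = 1]) auto
    moreover have "continuous_on UNIV (\<lambda>x. cis (t \<bullet> x))"
      unfolding cis_conv_exp by (intro continuous_intros)
    ultimately show ?case using char by auto
  next
    case (cmult f c)
    obtain b where "\<And>x. norm (f x) \<le> b" using cmult.IH by (auto simp: bounded_iff)
    hence "bounded (range (\<lambda>x. c * f x))"
      by (intro boundedI[where B = "norm c * b"]) (auto simp: norm_mult intro!: mult_left_mono)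
    thus ?case using cmult.IH by (auto intro!: continuous_intros tendsto_intros)
  next
    case (add f g)
    have "bounded (range (\<lambda>x. f x + g x))"
      using add.IH bounded_plus_comp[of f UNIV g] by simp
    moreover have "(\<lambda>N. \<integral>x. f x + g x \<partial>\<mu> N) \<longlonglongrightarrow> (\<integral>x. f x + g x \<partial>\<nu>)"
      using add.IH prob sets
      by (subst (1 2) Bochner_Integration.integral_add) (auto intro!: int tendsto_add)
    ultimately show ?case using add.IH by (auto intro!: continuous_intros)
  qed
qed

lemma abs_sin_minus_le: "\<bar>sin u - u\<bar> \<le> u\<^sup>2 / 2" for u :: real
proof -
  have "\<bar>sin u - u\<bar> = \<bar>Im (cis u - (1 + \<i> * u))\<bar>" by simp
  also have "\<dots> \<le> cmod (cis u - (1 + \<i> * u))" by (rule abs_Im_le_cmod)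
  also have "\<dots> \<le> u\<^sup>2 / 2"
    using iexp_approx1[of u 1] by (simp add: cis_conv_exp mult.commute power2_eq_square)
  finally show ?thesis .
qed

text \<open>A continuous substitute for the indicator of the complement of a box: it vanishes on the
  cube of half-side \<open>A\<close> and is at least 1 outside the cube of half-side
  \<open>A + 1\<close>.\<close>

definition excess :: "real \<Rightarrow> real^'k \<Rightarrow> real" where
  "excess A x = (\<Sum>i\<in>UNIV. min 1 (max 0 (\<bar>x $ i\<bar> - A)))"

lemma excess_nonneg: "excess A x \<ge> 0"
  by (auto simp: excess_def intro!: sum_nonneg)

lemma excess_ge_1: "\<bar>x $ i\<bar> > A + 1 \<Longrightarrow> excess A x \<ge> 1"
  unfolding excess_def by (rule order_trans[OF _ member_le_sum[of i]]) auto

text \<open>This supplies tightness. Each summand depends on one coordinate, whose characteristic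
  function is the joint one along \<open>axis i 1\<close>, so the one-dimensional continuity theorem
  applies to it.\<close>

lemma (in char_convergence) excess_integral_tendsto:
  shows "(\<lambda>N. \<integral>x. excess A x \<partial>\<mu> N) \<longlonglongrightarrow> (\<integral>x. excess A x \<partial>\<nu>)"
proof -
  define h where "h u = min 1 (max 0 (\<bar>u\<bar> - A))" for u :: real
  have h: "isCont h u" "\<bar>h u\<bar> \<le> 1" for u unfolding h_def by (auto intro!: continuous_intros)
  have hm: "h \<in> borel_measurable borel"
    using h(1) by (intro borel_measurable_continuous_onI)
        (auto simp: continuous_at_imp_continuous_on)
  have cm: "(\<lambda>x. x $ i) \<in> borel_measurable M" if "sets M = sets borel"
      for i and M :: "(real^'k) measure"
    unfolding measurable_cong_sets[OF that refl] by
        (intro borel_measurable_continuous_onI continuous_intros)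
  have int: "integrable M (\<lambda>x. h (x $ i))" if "prob_space M" "sets M = sets borel"
    for M :: "(real^'k) measure" and i
  proof -
    interpret prob_space M by fact
    show ?thesis
      by (rule integrable_const_bound[where B = 1])
        (use h(2) measurable_compose[OF cm[OF that(2)] hm] in auto)
  qed
  have conv: "(\<lambda>N. \<integral>x. h (x $ i) \<partial>\<mu> N) \<longlonglongrightarrow> (\<integral>x. h (x $ i) \<partial>\<nu>)" for i
  proof -
    define m where "m M = distr M borel (\<lambda>x::real^'k. x $ i)" for M
    have rd: "real_distribution (m M)" if "prob_space M" "sets M = sets borel" for M
      using prob_space.real_distribution_distr[OF that(1) cm[OF that(2)]] by (simp add: m_def)
    have ch: "Characteristic_Functions.char (m M) t = (\<integral>x. cis ((t *\<^sub>R axis i 1) \<bullet> x) \<partial>M)" 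
      if "sets M = sets borel" for M t
      unfolding char_def m_def
      by (subst integral_distr[OF cm[OF that]])
        (auto simp: cis_conv_exp inner_axis' intro!: borel_measurable_continuous_onI
            continuous_intros)
    have wc: "weak_conv_m (\<lambda>N. m (\<mu> N)) (m \<nu>)"
      by (rule levy_continuity) (auto intro!: rd prob sets simp: ch sets char simp del:
          inner_scaleR_left)
    have "(\<lambda>N. \<integral>u. h u \<partial>m (\<mu> N)) \<longlonglongrightarrow> (\<integral>u. h u \<partial>m \<nu>)"
      by (rule weak_conv_imp_integral_bdd_continuous_conv[OF _ _ wc, of h 1])
        (auto intro!: rd prob sets h simp: h(2))
    thus ?thesis by (simp add: m_def integral_distr cm sets hm)
  qed
  show ?thesis unfolding excess_def h_def[symmetric]
    by (subst (1 2) Bochner_Integration.integral_sum) (auto intro!: tendsto_sum conv int prob sets)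
qed

lemma excess_integral_small:
  fixes \<nu> :: "(real^'k) measure"
  assumes "prob_space \<nu>" "sets \<nu> = sets borel" "\<epsilon> > 0"
  obtains A where "A > 0" "(\<integral>x. excess A x \<partial>\<nu>) < \<epsilon>"
proof -
  interpret prob_space \<nu> by fact
  have "(\<lambda>n. \<integral>x. excess (real n) x \<partial>\<nu>) \<longlonglongrightarrow> (\<integral>x. 0 \<partial>\<nu>)"
  proof (rule integral_dominated_convergence[where w = "\<lambda>_. real CARD('k)"])
    have "continuous_on UNIV (excess (real n) :: real^'k \<Rightarrow> real)" for n
      unfolding excess_def by (intro continuous_intros)
    thus "excess (real n) \<in> borel_measurable \<nu>" for n
      unfolding measurable_cong_sets[OF assms(2) refl] by (rule borel_measurable_continuous_onI)
    show "AE x in \<nu>. (\<lambda>n. excess (real n) x) \<longlonglongrightarrow> 0"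
    proof (rule AE_I2)
      fix x :: "real^'k"
      have "eventually (\<lambda>n. excess (real n) x = 0) sequentially"
        using eventually_ge_at_top[of "nat \<lceil>norm x\<rceil>"]
      proof eventually_elim
        case (elim n)
        have "\<bar>x $ i\<bar> \<le> real n" for i
          using component_le_norm_cart[of x i] elim by linarith
        thus ?case by (simp add: excess_def)
      qed
      thus "(\<lambda>n. excess (real n) x) \<longlonglongrightarrow> 0" by (rule tendsto_eventually)
    qed
    have "excess (real n) x \<le> real CARD('k)" for n and x :: "real^'k"
      unfolding excess_def by (rule order_trans[OF sum_bounded_above[where K = 1]]) auto
    thus "AE x in \<nu>. norm (excess (real n) x) \<le> real CARD('k)" for n
      by (simp add: excess_nonneg)
  qed auto
  hence "eventually (\<lambda>n. (\<integral>x. excess (real n) x \<partial>\<nu>) < \<epsilon>) sequentially"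
    using assms(3) by (intro order_tendstoD(2)) auto
  hence "eventually (\<lambda>n. n > 0 \<and> (\<integral>x. excess (real n) x \<partial>\<nu>) < \<epsilon>) sequentially"
    using eventually_gt_at_top[of 0] by eventually_elim auto
  then obtain n where "n > 0" "(\<integral>x. excess (real n) x \<partial>\<nu>) < \<epsilon>"
    by (auto simp: eventually_sequentially)
  thus ?thesis using that[of "real n"] by simp
qed

text \<open>A bounded continuous \<open>f\<close> is compared with \<open>x \<mapsto> f (sin (c x) / c)\<close>, which
  is close to \<open>f\<close> on a large box and, by the Stone-Weierstrass theorem on the cube of side \<open>2 / c\<close>,
  uniformly close to a trigonometric polynomial on the whole space.\<close>

lemma trig_poly_approx:
  fixes f :: "real^'k \<Rightarrow> real"
  assumes cont: "continuous_on UNIV f" and B: "\<And>x. \<bar>f x\<bar> \<le> B" and "\<epsilon> > 0" "A > 0"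
  obtains q where "trig_poly (\<lambda>x. complex_of_real (q x))"
    "\<And>x. \<bar>f x - q x\<bar> \<le> 2 * \<epsilon> + 2 * B * excess A x"
proof -
  define b :: "real^'k" where "b = (\<chi> i. A + 1)"
  have "uniformly_continuous_on (cbox (- b) b) f"
    by (intro compact_uniformly_continuous continuous_on_subset[OF cont]) auto
  then obtain d where d: "d > 0"
    "\<And>x y. x \<in> cbox (- b) b \<Longrightarrow> y \<in> cbox (- b) b \<Longrightarrow> dist y x < d \<Longrightarrow> dist (f y) (f x) < \<epsilon>"
    unfolding uniformly_continuous_on_def using \<open>\<epsilon> > 0\<close> by metis
  \<comment> \<open>By the quadratic error of \<open>sin\<close>, each coordinate of
    \<open>S x - x\<close> is at most \<open>c * (A + 1)^2 / 2\<close> on the box of half-side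
    \<open>A + 1\<close>; with this \<open>c\<close> the coordinates add up to at most
    \<open>d / 2\<close>.\<close>
  define c where "c = d / (CARD('k) * (A + 1)\<^sup>2)"
  have c: "c > 0" using d \<open>A > 0\<close> by (simp add: c_def)
  define S :: "real^'k \<Rightarrow> real^'k" where "S x = (\<chi> i. sin (c * x $ i) / c)" for x
  have near: "\<bar>f x - f (S x)\<bar> \<le> \<epsilon>" if x: "\<And>i. \<bar>x $ i\<bar> \<le> A + 1" for x
  proof -
    have sb: "\<bar>sin (c * x $ i) / c\<bar> \<le> \<bar>x $ i\<bar>" for i
      using abs_sin_x_le_abs_x[of "c * x $ i"] c by (simp add: abs_mult field_simps)
    have box: "z \<in> cbox (- b) b" if "\<And>i. \<bar>z $ i\<bar> \<le> A + 1" for z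
    proof -
      have "- (A + 1) \<le> z $ i \<and> z $ i \<le> A + 1" for i using that[of i] by linarith
      thus ?thesis by (simp add: mem_box_cart b_def)
    qed
    have "x \<in> cbox (- b) b" using x by (rule box)
    moreover have "S x \<in> cbox (- b) b"
      using order_trans[OF sb x] by (intro box) (simp add: S_def)
    moreover have "dist (S x) x < d"
    proof -
      have "dist (S x) x \<le> (\<Sum>i\<in>UNIV. \<bar>(S x - x) $ i\<bar>)"
        unfolding dist_norm by (rule norm_le_l1_cart)
      also have "\<dots> \<le> (\<Sum>i\<in>(UNIV::'k set). c * (A + 1)\<^sup>2 / 2)"
      proof (rule sum_mono)
        fix i
        have "\<bar>(S x - x) $ i\<bar> = \<bar>sin (c * x $ i) - c * x $ i\<bar> / c"
        proof -
          have "(S x - x) $ i = (sin (c * x $ i) - c * x $ i) / c"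
            using c by (simp add: S_def diff_divide_distrib)
          thus ?thesis using c by (simp only: abs_divide abs_of_pos)
        qed
        also have "\<dots> \<le> (c * x $ i)\<^sup>2 / 2 / c"
          using c by (intro divide_right_mono abs_sin_minus_le) auto
        also have "\<dots> = c * \<bar>x $ i\<bar>\<^sup>2 / 2" using c by (simp add: power2_eq_square)
        also have "\<dots> \<le> c * (A + 1)\<^sup>2 / 2"
          using c x by (intro divide_right_mono mult_left_mono power_mono) auto
        finally show "\<bar>(S x - x) $ i\<bar> \<le> c * (A + 1)\<^sup>2 / 2" .
      qed
      also have "\<dots> = d / 2" using \<open>A > 0\<close> by (simp add: c_def)
      also have "\<dots> < d" using d by simp
      finally show ?thesis .
    qed
    ultimately show ?thesis using d(2)[of x "S x"] by (auto simp: dist_real_def abs_minus_commute)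
  qed
  define a :: "real^'k" where "a = (\<chi> i. 1 / c)"
  obtain p where p: "real_polynomial_function p" "\<And>y. y \<in> cbox (- a) a \<Longrightarrow> \<bar>f y - p y\<bar> < \<epsilon>"
    using Stone_Weierstrass_real_polynomial_function[OF compact_cbox continuous_on_subset[OF cont]
        \<open>\<epsilon> > 0\<close>]
    by (metis subset_UNIV)
  show ?thesis
  proof
    show "trig_poly (\<lambda>x. complex_of_real (p (S x)))"
      unfolding S_def by (rule trig_poly_real_polynomial[OF p(1)])
    fix x
    have "S x \<in> cbox (- a) a"
      using c by (auto simp: mem_box_cart S_def a_def divide_right_mono
          intro: order_trans[OF _ divide_right_mono[OF sin_ge_minus_one]])
    hence 1: "\<bar>f (S x) - p (S x)\<bar> < \<epsilon>" by (rule p(2))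
    have "B \<ge> 0" using B[of 0] by linarith
    show "\<bar>f x - p (S x)\<bar> \<le> 2 * \<epsilon> + 2 * B * excess A x"
    proof (cases "\<forall>i. \<bar>x $ i\<bar> \<le> A + 1")
      case True
      moreover have "2 * B * excess A x \<ge> 0" using \<open>B \<ge> 0\<close> excess_nonneg[of A x] by simp
      ultimately show ?thesis using near[of x] 1 by auto
    next
      case False
      then obtain i where "\<bar>x $ i\<bar> > A + 1" by (auto simp: not_le)
      \<comment> \<open>Outside the box the trivial bound \<open>2 * B\<close> for a difference of
        values of \<open>f\<close> is paid for by the excess.\<close>
      hence "2 * B * 1 \<le> 2 * B * excess A x"
        using \<open>B \<ge> 0\<close> by (intro mult_left_mono excess_ge_1) auto
      thus ?thesis using B[of x] B[of "S x"] 1 \<open>\<epsilon> > 0\<close> by (auto simp: abs_le_iff)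
    qed
  qed
qed

lemma (in char_convergence) converges_in_distribution:
  shows "converges_in_distribution \<mu> \<nu>"
  unfolding converges_in_distribution_def
proof safe
  fix f :: "real^'k \<Rightarrow> real"
  assume cont: "continuous_on UNIV f" and bdd: "bounded (range f)"
  obtain B where B: "B > 0" "\<And>x. \<bar>f x\<bar> \<le> B" using bdd by (auto simp: bounded_pos)
  note int = integrable_bounded_continuous
  have excess_reg: "continuous_on UNIV (excess A :: real^'k \<Rightarrow> real)" "bounded (range (excess A ::
      real^'k \<Rightarrow> real))" for A
  proof -
    show "continuous_on UNIV (excess A :: real^'k \<Rightarrow> real)" unfolding excess_def by
        (intro continuous_intros)
    have "\<bar>excess A x\<bar> \<le> real CARD('k)" for x :: "real^'k"
      using excess_nonneg[of A x] unfolding excess_def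
      by (simp only: abs_of_nonneg) (rule order_trans[OF sum_bounded_above[where K = 1]], auto)
    thus "bounded (range (excess A :: real^'k \<Rightarrow> real))" by (auto simp: bounded_iff)
  qed
  show "(\<lambda>N. integral\<^sup>L (\<mu> N) f) \<longlonglongrightarrow> integral\<^sup>L \<nu> f"
  proof (rule LIMSEQ_I)
    fix r :: real assume "r > 0"
    \<comment> \<open>One \<open>\<epsilon>\<close> is spent on the convergence of the integrals of
      \<open>q\<close>, and \<open>2 * \<epsilon> + 2 * B * \<epsilon>\<close> on each of the two
      replacements of \<open>f\<close> by \<open>q\<close>.\<close>
    define \<epsilon> where "\<epsilon> = r / (5 + 4 * B)"
    have \<epsilon>: "\<epsilon> > 0" using \<open>r > 0\<close> B by (simp add: \<epsilon>_def)
    obtain A where A: "A > 0" "(\<integral>x. excess A x \<partial>\<nu>) < \<epsilon>"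
      by (rule excess_integral_small[OF prob(2) sets(2) \<epsilon>])
    obtain q where q: "trig_poly (\<lambda>x. complex_of_real (q x))"
      "\<And>x. \<bar>f x - q x\<bar> \<le> 2 * \<epsilon> + 2 * B * excess A x"
      using trig_poly_approx[OF cont B(2) \<epsilon> A(1)] by blast
    note qq = trig_poly_integral_tendsto[OF q(1)]
    have qreg: "continuous_on UNIV q" "bounded (range q)"
      using qq continuous_on_Re[of UNIV "\<lambda>x. complex_of_real (q x)"] by (auto simp: bounded_iff)
    have qlim: "(\<lambda>N. integral\<^sup>L (\<mu> N) q) \<longlonglongrightarrow> integral\<^sup>L \<nu> q"
      using qq by (auto simp: tendsto_of_real_iff)
    have diff: "\<bar>integral\<^sup>L M f - integral\<^sup>L M q\<bar> \<le> 2 * \<epsilon> + 2 * B * \<epsilon>"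
      if M: "prob_space M" "sets M = sets borel" "(\<integral>x. excess A x \<partial>M) < \<epsilon>" for M
    proof -
      interpret prob_space M by fact
      have i: "integrable M f" "integrable M q" "integrable M (excess A)"
        using int[OF M(1,2)] cont bdd qreg excess_reg by auto
      have "\<bar>integral\<^sup>L M f - integral\<^sup>L M q\<bar> = \<bar>\<integral>x. f x - q x \<partial>M\<bar>" using i by simp
      also have "\<dots> \<le> (\<integral>x. \<bar>f x - q x\<bar> \<partial>M)" by (rule integral_abs_bound)
      also have "\<dots> \<le> (\<integral>x. 2 * \<epsilon> + 2 * B * excess A x \<partial>M)"
        using i q(2) by (intro integral_mono) auto
      also have "\<dots> = 2 * \<epsilon> + 2 * B * (\<integral>x. excess A x \<partial>M)" using i by (simp add: prob_space)
      also have "\<dots> \<le> 2 * \<epsilon> + 2 * B * \<epsilon>" using M(3) B by (intro add_left_mono mult_left_mono) auto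
      finally show ?thesis .
    qed
    have "eventually (\<lambda>N. (\<integral>x. excess A x \<partial>\<mu> N) < \<epsilon>) sequentially"
      by (rule order_tendstoD(2)[OF excess_integral_tendsto A(2)])
    moreover have "eventually (\<lambda>N. dist (integral\<^sup>L (\<mu> N) q) (integral\<^sup>L \<nu> q) < \<epsilon>) sequentially"
      using qlim \<epsilon> by (rule tendstoD)
    ultimately have "eventually (\<lambda>N. norm (integral\<^sup>L (\<mu> N) f - integral\<^sup>L \<nu> f) < r) sequentially"
    proof eventually_elim
      case (elim N)
      have "\<bar>integral\<^sup>L (\<mu> N) f - integral\<^sup>L \<nu> f\<bar> < \<epsilon> + (2 * \<epsilon> + 2 * B * \<epsilon>) + (2 * \<epsilon> + 2 * B * \<epsilon>)"
        using diff[OF prob(1) sets(1) elim(1)] diff[OF prob(2) sets(2) A(2)] elim(2)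
        unfolding dist_real_def by linarith
      also have "\<dots> = (5 + 4 * B) * \<epsilon>" by (simp add: algebra_simps)
      also have "\<dots> = r" using B by (simp add: \<epsilon>_def)
      finally show ?case by simp
    qed
    thus "\<exists>no. \<forall>N\<ge>no. norm (integral\<^sup>L (\<mu> N) f - integral\<^sup>L \<nu> f) < r"
      by (simp add: eventually_sequentially)
  qed
qed

section \<open>The standard Gaussian and its characteristic function\<close>

lemma matrix_inv_mat_1: "matrix_inv (mat 1 :: real^'k^'k) = mat 1"
  using someI[of "\<lambda>A. mat 1 ** A = mat 1 \<and> A ** mat 1 = (mat 1 :: real^'k^'k)" "mat 1"]
  by (simp add: matrix_inv_def)

lemma gaussian_std:
  "gaussian 0 (mat 1 :: real^'k^'k)
     = density lborel (\<lambda>x. ennreal (\<Prod>b\<in>Basis. std_normal_density (x \<bullet> b)))"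
proof -
  have "exp (- ((x - 0) \<bullet> (matrix_inv (mat 1 :: real^'k^'k) *v (x - 0))) / 2)
          / sqrt ((2 * pi) ^ CARD('k) * det (mat 1 :: real^'k^'k))
        = (\<Prod>b\<in>Basis. std_normal_density (x \<bullet> b))" for x :: "real^'k"
  proof -
    have "(\<Prod>b\<in>Basis. std_normal_density (x \<bullet> b))
        = (\<Prod>b\<in>(Basis :: (real^'k) set). 1 / sqrt (2 * pi)) * exp (\<Sum>b\<in>Basis. - (x \<bullet> b)\<^sup>2 / 2)"
      by (simp only: std_normal_density_def prod.distrib exp_sum[OF finite_Basis])
    also have "(\<Prod>b\<in>(Basis :: (real^'k) set). 1 / sqrt (2 * pi)) = 1 / sqrt ((2 * pi) ^ CARD('k))"
      by (simp only: prod_constant real_sqrt_power power_one_over) simp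
    also have "(\<Sum>b\<in>Basis. - (x \<bullet> b)\<^sup>2 / 2) = - (x \<bullet> x) / 2"
      by (subst (2) euclidean_inner) (simp add: sum_negf sum_divide_distrib power2_eq_square)
    finally show ?thesis by (simp add: matrix_inv_mat_1)
  qed
  thus ?thesis by (simp only: gaussian_def)
qed

lemma integral_lborel_prod_Basis:
  fixes f :: "'a::euclidean_space \<Rightarrow> real \<Rightarrow> complex"
  assumes "\<And>b. b \<in> Basis \<Longrightarrow> integrable lborel (f b)" and [measurable]: "\<And>b. f b \<in> borel_measurable
      borel"
  shows "(\<integral>x. (\<Prod>b\<in>Basis. f b (x \<bullet> b)) \<partial>lborel) = (\<Prod>b\<in>Basis. \<integral>u. f b u \<partial>lborel)"
proof -
  interpret product_sigma_finite "\<lambda>_::'a. lborel :: real measure" ..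
  have "(\<integral>x. (\<Prod>b\<in>Basis. f b (x \<bullet> b)) \<partial>lborel)
      = (\<integral>x. (\<Prod>b\<in>Basis. f b ((\<Sum>c\<in>Basis. x c *\<^sub>R c) \<bullet> b)) \<partial>(\<Pi>\<^sub>M b\<in>(Basis::'a set). lborel))"
    by (subst lborel_eq, rule integral_distr) measurable
  also have "\<dots> = (\<integral>x. (\<Prod>b\<in>Basis. f b (x b)) \<partial>(\<Pi>\<^sub>M b\<in>(Basis::'a set). lborel))"
    by (intro Bochner_Integration.integral_cong prod.cong) simp_all
  also have "\<dots> = (\<Prod>b\<in>Basis. \<integral>u. f b u \<partial>lborel)"
    using assms(1) by (intro product_integral_prod) auto
  finally show ?thesis .
qed

lemma char_gaussian_std:
  "(\<integral>x. cis (t \<bullet> x) \<partial>gaussian 0 (mat 1 :: real^'k^'k)) = complex_of_real (exp (- (t \<bullet> t) / 2))"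
proof -
  define f where "f b u = std_normal_density u *\<^sub>R cis ((t \<bullet> b) * u)" for b :: "real^'k" and u
  have [measurable]: "(\<lambda>u. cis (s * u)) \<in> borel_measurable borel" for s
    unfolding cis_conv_exp by (intro borel_measurable_continuous_onI continuous_intros)
  have cism[measurable]: "(\<lambda>x::real^'k. cis (t \<bullet> x)) \<in> borel_measurable borel"
    unfolding cis_conv_exp by (intro borel_measurable_continuous_onI continuous_intros)
  have int: "integrable lborel (f b)" for b
    unfolding f_def
    by (rule Bochner_Integration.integrable_bound[of lborel std_normal_density]) auto
  have val: "(\<integral>u. f b u \<partial>lborel) = complex_of_real (exp (- (t \<bullet> b)\<^sup>2 / 2))" for b
  proof -
    have "(\<integral>u. f b u \<partial>lborel) = Characteristic_Functions.char std_normal_distribution (t \<bullet> b)"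
      unfolding f_def char_def by (subst integral_density) (auto simp: cis_conv_exp)
    thus ?thesis by (simp add: char_std_normal_distribution)
  qed
  have "(\<integral>x. cis (t \<bullet> x) \<partial>gaussian 0 (mat 1 :: real^'k^'k))
      = (\<integral>x. (\<Prod>b\<in>Basis. std_normal_density (x \<bullet> b)) *\<^sub>R cis (t \<bullet> x) \<partial>lborel)"
    unfolding gaussian_std by (subst integral_density) (auto intro!: prod_nonneg)
  also have "\<dots> = (\<integral>x. (\<Prod>b\<in>Basis. f b (x \<bullet> b)) \<partial>lborel)"
  proof (rule Bochner_Integration.integral_cong)
    fix x :: "real^'k"
    have "t \<bullet> x = (\<Sum>b\<in>Basis. (t \<bullet> b) * (x \<bullet> b))" by (rule euclidean_inner)
    hence "cis (t \<bullet> x) = (\<Prod>b\<in>Basis. cis ((t \<bullet> b) * (x \<bullet> b)))"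
      by (simp add: cis_conv_exp sum_distrib_left exp_sum)
    thus "(\<Prod>b\<in>Basis. std_normal_density (x \<bullet> b)) *\<^sub>R cis (t \<bullet> x) = (\<Prod>b\<in>Basis. f b (x \<bullet> b))"
      by (simp add: f_def scaleR_conv_of_real prod.distrib)
  qed simp
  also have "\<dots> = (\<Prod>b\<in>Basis. complex_of_real (exp (- (t \<bullet> b)\<^sup>2 / 2)))"
  proof (subst integral_lborel_prod_Basis)
    show "f b \<in> borel_measurable borel" for b unfolding f_def by measurable
  qed (simp_all add: int val)
  also have "\<dots> = complex_of_real (exp (\<Sum>b\<in>Basis. - (t \<bullet> b)\<^sup>2 / 2))"
    by (simp add: exp_sum)
  also have "(\<Sum>b\<in>Basis. - (t \<bullet> b)\<^sup>2 / 2) = - (t \<bullet> t) / 2"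
    by (subst (2) euclidean_inner) (simp add: sum_negf sum_divide_distrib power2_eq_square)
  finally show ?thesis .
qed

text \<open>The total mass is the value of the characteristic function at 0.\<close>

lemma prob_space_gaussian_std: "prob_space (gaussian 0 (mat 1 :: real^'k^'k))" (is "prob_space ?\<nu>")
proof
  have "measure ?\<nu> (space ?\<nu>) = 1"
    using char_gaussian_std[of "0 :: real^'k"] by (simp add: scaleR_conv_of_real)
  thus "emeasure ?\<nu> (space ?\<nu>) = 1"
    \<comment> \<open>If the mass were infinite, \<open>measure\<close> would be 0, so the value 1
      rules this out.\<close>
    by (cases "emeasure ?\<nu> (space ?\<nu>)") (auto simp: measure_def)
qed

section \<open>The joint distribution\<close>

lemma card_Un_density_zero:
  fixes A B :: "nat \<Rightarrow> nat set"
  assumes "(\<lambda>N. card (A N) / N) \<longlonglongrightarrow> 0" "(\<lambda>N. card (B N) / N) \<longlonglongrightarrow> 0"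
  shows "(\<lambda>N. card (A N \<union> B N) / N) \<longlonglongrightarrow> 0"
proof -
  have "(\<lambda>N. card (\<Union>b\<in>UNIV. if b then A N else B N) / N) \<longlonglongrightarrow> 0"
  proof (rule card_UN_density_zero)
    show "(\<lambda>N. card (if b then A N else B N) / N) \<longlonglongrightarrow> 0" for b
      using assms by (cases b) simp_all
  qed simp
  thus ?thesis by (simp only: Un_eq_UN)
qed

text \<open>For fixed \<open>K\<close> everything vanishes except the Taylor tail, which does not
  depend on \<open>N\<close>. In the proof, \<open>?f\<close> regroups the error so that every
  factor has a known limit.\<close>

lemma block_error_tendsto:
  fixes \<Theta> Q c :: real and k K :: nat
  assumes "k > 0"
  defines "\<rho> \<equiv> divisor_bound" and "e \<equiv> (\<lambda>N. \<bar>prime_recip_sum (cutoff N) - loglog N\<bar>)"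
  shows "(\<lambda>N. block_error \<Theta> Q K (step_count k N) (loglog N) (c * \<rho> N) (e N) (cutoff N)
            (ln (real N ^ 5) / ln (cutoff N))) \<longlonglongrightarrow> 4 * exp (8 * (Q + \<Theta>\<^sup>2)) / 4 ^ K"
proof -
  have \<rho>: "(\<lambda>N. \<rho> N / sqrt (loglog N)) \<longlonglongrightarrow> 0"
    unfolding \<rho>_def by (rule divisor_bound_negligible)
  have e: "(\<lambda>N. e N / sqrt (loglog N)) \<longlonglongrightarrow> 0" unfolding e_def by (rule prime_recip_sum_cutoff)
  have l: "(\<lambda>N. ln (real N ^ 5) / ln (cutoff N) / sqrt (loglog N)) \<longlonglongrightarrow> 0"
      by (rule log_ratio_negligible)
  have L: "(\<lambda>N. 1 / sqrt (loglog N)) \<longlonglongrightarrow> 0" unfolding loglog_def by real_asymp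
  have y2: "(\<lambda>N. (cutoff N)\<^sup>2 / step_count k N) \<longlonglongrightarrow> 0"
  proof (rule tendsto_sandwich[OF always_eventually always_eventually tendsto_const
      cutoff_power_negligible[OF assms(1), of 1]])
    show "\<forall>N. (cutoff N)\<^sup>2 / step_count k N \<le> (1 + (cutoff N)\<^sup>2) ^ 1 / step_count k N"
      by (intro allI divide_right_mono) auto
  qed auto
  let ?f = "\<lambda>N. \<Theta> * (2 * c * (\<rho> N / sqrt (loglog N)) + e N / sqrt (loglog N)
        + 2 * ((cutoff N)\<^sup>2 / step_count k N) * (1 / sqrt (loglog N)) + ln (real N ^ 5) / ln
            (cutoff N) / sqrt (loglog N))
      + (2 * (2 * real K + 1) * ((1 + (cutoff N)\<^sup>2) ^ (2 * K) / step_count k N) + 4 * exp (8 * (Q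
          + \<Theta>\<^sup>2)) / 4 ^ K
        + 2 * \<Theta> * (Q + \<Theta>\<^sup>2) * (1 / sqrt (loglog N)) + \<Theta>\<^sup>2 * (1 / sqrt (loglog N))\<^sup>2 + (Q * (1 /
            sqrt (loglog N))\<^sup>2)\<^sup>2)
      + Q * (c * (\<rho> N / sqrt (loglog N)) + e N / sqrt (loglog N)) * (1 / sqrt (loglog N))"
  have lim: "?f
    \<longlonglongrightarrow> \<Theta> * (2 * c * 0 + 0 + 2 * 0 * 0 + 0) + (2 * (2 * real K + 1) * 0 + 4 * exp (8 * (Q + \<Theta>\<^sup>2)) /
        4 ^ K
        + 2 * \<Theta> * (Q + \<Theta>\<^sup>2) * 0 + \<Theta>\<^sup>2 * 0\<^sup>2 + (Q * 0\<^sup>2)\<^sup>2) + Q * (c * 0 + 0) * 0"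
    by (intro tendsto_add tendsto_mult tendsto_power tendsto_const \<rho> e l L y2
        cutoff_power_negligible[OF assms(1)])
  have "eventually (\<lambda>N. loglog N > 1) sequentially" using cutoff_bounds by eventually_elim simp
  hence "eventually (\<lambda>N. ?f N
    = block_error \<Theta> Q K (step_count k N) (loglog N) (c * \<rho> N) (e N) (cutoff N)
        (ln (real N ^ 5) / ln (cutoff N))) sequentially"
  proof eventually_elim
    case (elim N)
    have sq: "(1 / sqrt (loglog N))\<^sup>2 = 1 / loglog N" using elim by (simp add: power_divide)
    have 1: "\<Theta> * (2 * c * (\<rho> N / sqrt (loglog N)) + e N / sqrt (loglog N)
        + 2 * ((cutoff N)\<^sup>2 / step_count k N) * (1 / sqrt (loglog N)) + ln (real N ^ 5) / ln
            (cutoff N) / sqrt (loglog N))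
      = \<Theta> * (2 * (c * \<rho> N) + e N + 2 * (cutoff N)\<^sup>2 / step_count k N + ln (real N ^ 5) / ln
          (cutoff N)) / sqrt (loglog N)"
      by (simp add: add_divide_distrib mult.assoc distrib_left)
    have 2: "Q * (c * (\<rho> N / sqrt (loglog N)) + e N / sqrt (loglog N)) * (1 / sqrt (loglog N))
        = Q * (c * \<rho> N + e N) / loglog N"
    proof -
      have "Q * (c * (\<rho> N / sqrt (loglog N)) + e N / sqrt (loglog N)) * (1 / sqrt (loglog N))
          = Q * (c * \<rho> N + e N) * (1 / sqrt (loglog N))\<^sup>2"
        by (simp add: power2_eq_square add_divide_distrib algebra_simps)
      thus ?thesis unfolding sq by simp
    qed
    show ?case unfolding block_error_def 1 2 sq by simp
  qed
  with lim show ?thesis by (simp add: Lim_transform_eventually)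
qed

lemma normalized_omega_char_tendsto:
  fixes \<alpha> \<beta> \<theta> :: "real^'k"
  assumes pos: "\<And>i. \<alpha> $ i > 0" and irr: "\<And>i j. i \<noteq> j \<Longrightarrow> \<alpha> $ i / \<alpha> $ j \<notin> \<rat>"
  shows "(\<lambda>N. (\<Sum>n\<in>{1..N}. cis (\<theta> \<bullet> normalized_omega \<alpha> \<beta> N n)) / of_nat N)
           \<longlonglongrightarrow> complex_of_real (exp (- (\<theta> \<bullet> \<theta>) / 2))"
proof -
  define k where "k = CARD('k)"
  have k: "k > 0" by (simp add: k_def)
  define M where "M = approx_order k"
  define S where "S = step_count k"
  \<comment> \<open>For small \<open>N\<close> the order \<open>M N\<close> may be 0, and then
    Dirichlet's theorem gives nothing; hence the guard.\<close>
  have "\<forall>N. \<exists>(q::nat) (a::'k \<Rightarrow> int). M N > 0 \<longrightarrow> q > 0 \<and> q \<le> M N ^ k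
      \<and> (\<forall>i. \<bar>real q * \<alpha> $ i - of_int (a i)\<bar> < 1 / M N)"
    using dirichlet_approx_vec[of _ \<alpha>] unfolding k_def by metis
  then obtain q a where qa: "\<And>N. M N > 0 \<Longrightarrow> q N > 0" "\<And>N. M N > 0 \<Longrightarrow> q N \<le> M N ^ k"
    "\<And>N i. M N > 0 \<Longrightarrow> \<bar>real (q N) * \<alpha> $ i - of_int (a N i)\<bar> < 1 / M N"
    by metis
  define b where "b i = beatty (\<alpha> $ i) (\<beta> $ i)" for i
  define I where "I = {ij :: 'k \<times> 'k. fst ij \<noteq> snd ij}"
  \<comment> \<open>Three kinds of exceptional starting points: a nonpositive value, a block on
    which some floor is not affine, and a block with two proportional forms.\<close>
  define B1 where "B1 i N = {n \<in> {1..N}. b i n < 1}" for i and N :: nat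
  define B2 where "B2 i N = {n \<in> {1..N}. \<exists>s<S N. b i (n + q N * s) \<noteq> b i n + a N i * int s}" for i N
  define B3 where "B3 ij N = {n \<in> {1..N}. a N (fst ij) * b (snd ij) n
      = a N (snd ij) * b (fst ij) n}" for ij N
  define bad where "bad N = ((\<Union>i\<in>UNIV. B1 i N) \<union> (\<Union>i\<in>UNIV. B2 i N)) \<union> (\<Union>ij\<in>I. B3 ij N)" for N

  have SM: "eventually (\<lambda>N. S N > 0 \<and> M N > 0) sequentially"
    unfolding S_def M_def by (rule step_count_div_approx_order(3)[OF k])
  have d: "(\<lambda>N. real (q N) * \<alpha> $ i - of_int (a N i)) \<longlonglongrightarrow> 0"
    and Sd: "(\<lambda>N. real (S N) * (real (q N) * \<alpha> $ i - of_int (a N i))) \<longlonglongrightarrow> 0" for i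
  proof -
    have "eventually (\<lambda>N. norm (real (q N) * \<alpha> $ i - of_int (a N i)) \<le> 1 / M N) sequentially"
      using SM by eventually_elim (simp add: qa(3) less_imp_le)
    thus "(\<lambda>N. real (q N) * \<alpha> $ i - of_int (a N i)) \<longlonglongrightarrow> 0"
      using step_count_div_approx_order(2)[OF k] unfolding M_def by (rule Lim_null_comparison)
    have "eventually (\<lambda>N. norm (real (S N) * (real (q N) * \<alpha> $ i - of_int (a N i)))
        \<le> S N / M N) sequentially"
      using SM
    proof eventually_elim
      case (elim N)
      have "S N * \<bar>real (q N) * \<alpha> $ i - of_int (a N i)\<bar> \<le> S N * (1 / M N)"
        using elim by (intro mult_left_mono less_imp_le qa(3)) auto
      thus ?case by (simp add: abs_mult)
    qed
    thus "(\<lambda>N. real (S N) * (real (q N) * \<alpha> $ i - of_int (a N i))) \<longlonglongrightarrow> 0"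
      using step_count_div_approx_order(1)[OF k] unfolding M_def S_def by (rule Lim_null_comparison)
  qed
  have close: "eventually (\<lambda>N. \<bar>real (q N) * \<alpha> $ i - of_int (a N i)\<bar> < \<eta>) sequentially" if "\<eta> > 0"
      for \<eta> i
    by (rule order_tendstoD(2)[OF tendsto_rabs_zero[OF d] that])
  \<comment> \<open>For \<open>q \<ge> 1\<close>, an error below \<open>\<alpha> $ i\<close> cannot
    carry \<open>q * \<alpha> $ i\<close> down to 0.\<close>
  have apos: "eventually (\<lambda>N. a N i > 0) sequentially" for i
    using close[OF pos[of i], of i] SM
  proof eventually_elim
    case (elim N)
    have "q N \<ge> 1" using qa(1)[of N] elim by simp
    hence "1 * \<alpha> $ i \<le> real (q N) * \<alpha> $ i" using pos[of i] by (intro mult_right_mono) auto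
    hence "real_of_int (a N i) > 0" using elim(1) by linarith
    thus ?case by simp
  qed

  have bad0: "(\<lambda>N. card (bad N) / N) \<longlonglongrightarrow> 0"
    unfolding bad_def
  proof (intro card_Un_density_zero card_UN_density_zero)
    show "(\<lambda>N. card (B1 i N) / N) \<longlonglongrightarrow> 0" for i
      unfolding B1_def b_def by (rule beatty_lt_1_density_zero[OF pos])
    show "(\<lambda>N. card (B2 i N) / N) \<longlonglongrightarrow> 0" for i
      unfolding B2_def b_def by (rule beatty_not_affine_density_zero[OF d Sd])
    show "(\<lambda>N. card (B3 ij N) / N) \<longlonglongrightarrow> 0" if "ij \<in> I" for ij
      unfolding B3_def b_def
      by (rule beatty_proportional_density_zero[OF pos pos irr _ d d])
        (use that apos in \<open>auto simp: I_def intro: eventually_conj\<close>)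
  qed (auto simp: I_def)

  define \<Theta> where "\<Theta> = (\<Sum>i\<in>UNIV. \<bar>\<theta> $ i\<bar>)"
  define Q where "Q = (\<Sum>i\<in>UNIV. (\<theta> $ i)\<^sup>2)"
  define E where "E = complex_of_real (exp (- (Q / 2)))"
  define c where "c = real k + (real k)\<^sup>2"
  define \<rho> where "\<rho> = divisor_bound"
  define R where "R K N = block_error \<Theta> Q K (S N) (loglog N) (c * \<rho> N)
      \<bar>prime_recip_sum (cutoff N) - loglog N\<bar> (cutoff N) (ln (real N ^ 5) / ln (cutoff N))" for K N
  define r where "r N n = (\<Sum>i\<in>UNIV. \<bar>\<theta> $ i\<bar> * real (card {p \<in> primes_le (cutoff N). int p dvd a N
      i \<and> int p dvd b i n})) / sqrt (loglog N)" for N n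
  define C where "C = (\<Sum>i\<in>UNIV. \<bar>\<theta> $ i\<bar> * (2 * ((\<alpha> $ i + 3) * (1 / \<alpha> $ i + 1))))"
  define G where "G N n = cis (\<theta> \<bullet> normalized_omega \<alpha> \<beta> N n)" for N n
  \<comment> \<open>Makes \<open>a N i\<close> and \<open>b i n\<close> at most
    \<open>N * A\<close>, hence at most \<open>N^2\<close> once \<open>N \<ge> A\<close>; the
    summand 2 absorbs the approximation error and also ensures \<open>N \<ge> 2\<close>.\<close>
  define A where "A = (\<Sum>i\<in>UNIV. \<alpha> $ i + \<bar>\<beta> $ i\<bar>) + 2"
  have \<Theta>: "\<Theta> \<ge> 0" unfolding \<Theta>_def by (intro sum_nonneg) auto
  have A: "\<alpha> $ i + \<bar>\<beta> $ i\<bar> + 2 \<le> A" for i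
  proof -
    have "\<alpha> $ i + \<bar>\<beta> $ i\<bar> \<le> (\<Sum>i\<in>UNIV. \<alpha> $ i + \<bar>\<beta> $ i\<bar>)"
      using less_imp_le[OF pos] by (intro member_le_sum) auto
    thus ?thesis by (simp add: A_def)
  qed
  have main: "eventually (\<lambda>N. norm ((\<Sum>n\<in>{1..N}. G N n) / of_nat N - E)
      \<le> 2 * (real (q N) * S N / N) + 2 * (card (bad N) / N) + C * (\<rho> N / sqrt (loglog N)) + R K N)
          sequentially"
    if K: "K > 0" for K
  proof -
    have ev1: "eventually (\<lambda>N. q N \<le> N \<and> S N \<le> N) sequentially"
      unfolding S_def using qa(2) unfolding M_def by (rule block_length_negligible(2)[OF k])
    have ev2: "eventually (\<lambda>N. \<bar>prime_recip_sum (cutoff N) - loglog N\<bar> / sqrt (loglog N) < 1)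
        sequentially"
      by (rule order_tendstoD(2)[OF prime_recip_sum_cutoff]) simp
    have ev3: "eventually (\<lambda>N. loglog N \<ge> (2 * \<Theta>)\<^sup>2) sequentially"
      by (rule filterlim_at_top[THEN iffD1, OF loglog_at_top, rule_format])
    have ev4: "eventually (\<lambda>N. real N \<ge> A) sequentially"
      by (rule filterlim_at_top[THEN iffD1, OF filterlim_real_sequentially, rule_format])
    have apos': "eventually (\<lambda>N. \<forall>i. a N i > 0) sequentially"
      by (intro eventually_all_finite apos)
    have close': "eventually (\<lambda>N. \<forall>i. \<bar>real (q N) * \<alpha> $ i - of_int (a N i)\<bar> < 1) sequentially"
      by (intro eventually_all_finite close) simp
    from cutoff_bounds SM apos' ev1 ev2 ev3 ev4 close' show ?thesis
    proof eventually_elim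
      case (elim N)
      have L: "loglog N > 1" "sqrt (loglog N) > 0" using elim by auto
      have N2: "real N \<ge> 2" "real N > 0" using elim(7) A[of undefined] pos[of undefined]
          by linarith+
      have NA: "real N * A \<le> (real N)\<^sup>2" using elim(7) N2 by (simp add: power2_eq_square)
      have a_le: "real_of_int (a N i) \<le> (real N)\<^sup>2" for i
      proof -
        have "\<bar>real (q N) * \<alpha> $ i - of_int (a N i)\<bar> < 1" using elim by blast
        hence "real_of_int (a N i) \<le> real (q N) * \<alpha> $ i + 1" by linarith
        also have "\<dots> \<le> real N * \<alpha> $ i + real N * 2"
          using elim(4) pos[of i] N2 by (intro add_mono mult_right_mono) auto
        also have "\<dots> \<le> real N * A" using A[of i] N2 by (simp flip: distrib_left)
        finally show ?thesis using NA by linarith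
      qed
      have b_le: "real_of_int (b i n) \<le> (real N)\<^sup>2" if "n \<in> {1..N}" for i n
      proof -
        have "real_of_int (b i n) \<le> \<alpha> $ i * real n + \<beta> $ i" by (simp add: b_def beatty_def)
        also have "\<dots> \<le> \<alpha> $ i * real N + \<bar>\<beta> $ i\<bar> * real N"
          using that pos[of i] N2 mult_left_mono[of 1 "real N" "\<bar>\<beta> $ i\<bar>"]
          by (intro add_mono mult_left_mono) auto
        also have "\<dots> = real N * (\<alpha> $ i + \<bar>\<beta> $ i\<bar>)" by (simp add: algebra_simps)
        also have "\<dots> \<le> real N * A" using A[of i] by (intro mult_left_mono) auto
        finally show ?thesis using NA by linarith
      qed
      \<comment> \<open>The exponent 5 is a common bound: block values are at most
        \<open>N^3 + N^2\<close>, and the determinants, as differences of nonnegative products, at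
        most \<open>N^4\<close> in modulus.\<close>
      have N5: "(real N)\<^sup>2 \<le> real N ^ 5" "(real N)\<^sup>2 * (real N)\<^sup>2 \<le> real N ^ 5"
        "(real N)\<^sup>2 * real N + (real N)\<^sup>2 \<le> real N ^ 5"
      proof -
        show "(real N)\<^sup>2 \<le> real N ^ 5" "(real N)\<^sup>2 * (real N)\<^sup>2 \<le> real N ^ 5"
          using N2 by (auto simp flip: power_add intro!: power_increasing)
        have "(real N)\<^sup>2 * real N + (real N)\<^sup>2 \<le> (real N)\<^sup>2 * real N + (real N)\<^sup>2 * real N"
          using N2 by (intro add_left_mono) simp
        also have "\<dots> = real N ^ 3 * 2" by (simp add: power2_eq_square power3_eq_cube)
        also have "\<dots> \<le> real N ^ 3 * (real N)\<^sup>2" using N2 by (intro mult_left_mono)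
            (auto simp: power2_eq_square intro: order_trans[OF _ mult_mono[of 2 "real N" 1 "real
            N"]])
        also have "\<dots> = real N ^ 5" by (simp flip: power_add)
        finally show "(real N)\<^sup>2 * real N + (real N)\<^sup>2 \<le> real N ^ 5" .
      qed
      have est: "norm (avg (S N) (\<lambda>s. G N (n + q N * s)) - E) \<le> r N n + R K N"
        if n: "n \<in> {1..N}" "n \<notin> bad N" for n
      proof -
        have b1: "b i n \<ge> 1" for i using n by (auto simp: bad_def B1_def not_less)
        have b2: "b i (n + q N * s) = a N i * int s + b i n" if "s < S N" for i s
          using n that by (auto simp: bad_def B2_def)
        have b3: "a N i * b j n \<noteq> a N j * b i n" if "i \<noteq> j" for i j
          using n that by (auto simp: bad_def B3_def I_def)
        have ai: "a N i > 0" for i using elim by blast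
        have Geq: "G N (n + q N * s) = cis (\<Sum>i\<in>UNIV. \<theta> $ i * ((real (omega (a N i * int s + b i
            n)) - loglog N) / sqrt (loglog N)))"
          if "s < S N" for s
          using b2[OF that] by (simp add: G_def normalized_omega_def inner_vec_def b_def
              beatty_def loglog_def)
        have "avg (S N) (\<lambda>s. G N (n + q N * s))
            = avg (S N) (\<lambda>s. cis (\<Sum>i\<in>UNIV. \<theta> $ i * ((real (omega (a N i * int s + b i n)) - loglog
                N) / sqrt (loglog N))))"
          unfolding avg_def by (intro arg_cong2[of _ _ _ _ "(/)"] sum.cong refl Geq) auto
        moreover have "norm (\<dots> - E) \<le> r N n + R K N"
          unfolding r_def R_def E_def c_def k_def \<rho>_def divisor_bound_def \<Theta>_def Q_def
        proof (rule block_estimate)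
          show "a N i * int s + b i n > 0" for i s
            using ai[of i] b1[of i] by (intro add_nonneg_pos) auto
          show "real_of_int (a N i * int s + b i n) \<le> real N ^ 5" if "s < S N" for i s
          proof -
            have "real s \<le> N" using that elim(4) by simp
            hence "real_of_int (a N i) * real s \<le> (real N)\<^sup>2 * real N"
              using a_le[of i] ai[of i] by (intro mult_mono) auto
            thus ?thesis using b_le[OF n(1), of i] N5(3) by simp
          qed
          show "real_of_int (a N i) \<le> real N ^ 5" for i using a_le[of i] N5(1) by linarith
          show "\<bar>real_of_int (a N i * b j n - a N j * b i n)\<bar> \<le> real N ^ 5" for i j
          proof -
            have p: "0 \<le> real_of_int (a N i) * real_of_int (b j n)"
              "real_of_int (a N i) * real_of_int (b j n) \<le> (real N)\<^sup>2 * (real N)\<^sup>2" for i j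
            proof -
              have "0 \<le> real_of_int (a N i)" "0 \<le> real_of_int (b j n)" using ai[of i] b1[of j]
                  by auto
              thus "0 \<le> real_of_int (a N i) * real_of_int (b j n)" by (rule mult_nonneg_nonneg)
              show "real_of_int (a N i) * real_of_int (b j n) \<le> (real N)\<^sup>2 * (real N)\<^sup>2"
                using a_le[of i] b_le[OF n(1), of j] \<open>0 \<le> real_of_int (b j n)\<close>
                by (intro mult_mono zero_le_power2)
            qed
            show ?thesis using p[of i j] p[of j i] N5(2) by (simp add: abs_le_iff)
          qed
          show "prime_recip_sum (cutoff N) \<le> 2 * loglog N"
          proof -
            have "\<bar>prime_recip_sum (cutoff N) - loglog N\<bar> < sqrt (loglog N)" using elim(5) L by
                (simp add: divide_less_eq)
            moreover have "sqrt (loglog N) \<le> loglog N" using L by (intro real_le_lsqrt)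
                (auto simp: power2_eq_square)
            ultimately show ?thesis by linarith
          qed
          show "2 * (\<Sum>i\<in>UNIV. \<bar>\<theta> $ i\<bar>) \<le> sqrt (loglog N)"
            using elim(6) by (intro real_le_rsqrt) (simp add: \<Theta>_def)
        qed (use elim L K ai b3 in auto)
        ultimately show ?thesis by simp
      qed
      have RN: "R K N \<ge> 0"
      proof -
        have "prime_recip_sum (ln (real N)) \<ge> 0" unfolding prime_recip_sum_def by
            (intro sum_nonneg) auto
        moreover have "ln (real N ^ 5) \<ge> 0" using N2 by (intro ln_ge_zero)
            (auto intro: one_le_power)
        moreover have "ln (ln (real N)) \<ge> 0" "ln (cutoff N) \<ge> 0" using elim by auto
        moreover have "Q \<ge> 0" "c \<ge> 0" by (auto simp: Q_def c_def intro: sum_nonneg)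
        ultimately show ?thesis unfolding R_def block_error_def \<rho>_def divisor_bound_def
            using \<Theta> L elim(1)
          by (intro add_nonneg_nonneg mult_nonneg_nonneg divide_nonneg_nonneg) simp_all
      qed
      have "norm ((\<Sum>n\<in>{1..N}. G N n) / of_nat N - E)
          \<le> 2 * (real (q N) * S N / N) + 2 * (card (bad N) / N) + (\<Sum>n\<in>{1..N}. r N n) / N + R K N"
      proof (rule mean_via_blocks[OF _ _ _ _ _ est _ RN])
        show "norm E \<le> 1" by (simp add: E_def Q_def sum_nonneg)
        show "finite (bad N)" by (auto simp: bad_def B1_def B2_def B3_def I_def)
        show "r N n \<ge> 0" for n unfolding r_def using L by
            (intro divide_nonneg_nonneg sum_nonneg) auto
      qed (use elim N2 in \<open>auto simp: G_def\<close>)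
      \<comment> \<open>Here the primes dividing a whole block are averaged over
        \<open>n\<close>.\<close>
      also have "(\<Sum>n\<in>{1..N}. r N n) / N \<le> C * (\<rho> N / sqrt (loglog N))"
      proof -
        have "(\<Sum>n\<in>{1..N}. r N n) = (\<Sum>i\<in>UNIV. \<bar>\<theta> $ i\<bar> * (\<Sum>n\<in>{1..N}. real (card {p \<in> primes_le
            (cutoff N). int p dvd a N i \<and> int p dvd b i n}))) / sqrt (loglog N)"
          unfolding r_def sum_divide_distrib [symmetric] sum_distrib_left by (subst sum.swap) simp
        also have "\<dots> \<le> (\<Sum>i\<in>UNIV. \<bar>\<theta> $ i\<bar> * (2 * ((\<alpha> $ i + 3) * (1 / \<alpha> $ i + 1)) * \<rho> N * N)) / sqrt
            (loglog N)"
        proof (intro divide_right_mono sum_mono mult_left_mono)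
          fix i
          have ai: "a N i > 0" using elim by blast
          show "(\<Sum>n\<in>{1..N}. real (card {p \<in> primes_le (cutoff N). int p dvd a N i
              \<and> int p dvd b i n}))
              \<le> 2 * ((\<alpha> $ i + 3) * (1 / \<alpha> $ i + 1)) * \<rho> N * N"
            unfolding b_def \<rho>_def divisor_bound_def
          proof (rule sum_card_beatty_le[OF pos])
            show "\<bar>real_of_int (a N i)\<bar> \<le> real N ^ 5" using a_le[of i] N5(1) ai by simp
            show "a N i \<noteq> 0" using ai by simp
          qed (use elim in auto)
        qed (use L in auto)
        also have "\<dots> = N * (C * (\<rho> N / sqrt (loglog N)))"
          by (simp add: C_def sum_distrib_left sum_distrib_right sum_divide_distrib mult_ac)
        finally show ?thesis using N2 by (simp add: pos_divide_le_eq mult.commute)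
      qed
      finally show ?case by simp
    qed
  qed

  have lim: "(\<lambda>N. (\<Sum>n\<in>{1..N}. G N n) / of_nat N) \<longlonglongrightarrow> E"
  proof (rule tendstoI)
    fix \<epsilon> :: real assume \<epsilon>: "\<epsilon> > 0"
    \<comment> \<open>\<open>K\<close> is chosen before \<open>N\<close>: the Taylor tail
      \<open>D / 4 ^ K\<close> is first made smaller than \<open>\<epsilon>\<close>, and the
      remaining errors vanish as \<open>N\<close> grows.\<close>
    define D where "D = 4 * exp (8 * (Q + \<Theta>\<^sup>2))"
    have "(\<lambda>K. D / 4 ^ K) \<longlonglongrightarrow> 0" by real_asymp
    hence "eventually (\<lambda>K. D / 4 ^ K < \<epsilon>) sequentially" using \<epsilon> by (rule order_tendstoD(2))
    hence "eventually (\<lambda>K. D / 4 ^ K < \<epsilon> \<and> K > 0) sequentially"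
      using eventually_gt_at_top[of 0] by eventually_elim simp
    then obtain K where K: "D / 4 ^ K < \<epsilon>" "K > 0" by (auto simp: eventually_sequentially)
    have lims: "(\<lambda>N. 2 * (real (q N) * S N / N) + 2 * (card (bad N) / N) + C * (\<rho> N / sqrt (loglog
        N)) + R K N)
        \<longlonglongrightarrow> 2 * 0 + 2 * 0 + C * 0 + D / 4 ^ K"
    proof (intro tendsto_add tendsto_mult tendsto_const bad0)
      show "(\<lambda>N. real (q N) * S N / N) \<longlonglongrightarrow> 0"
        unfolding S_def using qa(2) unfolding M_def by (rule block_length_negligible(1)[OF k])
      show "(\<lambda>N. \<rho> N / sqrt (loglog N)) \<longlonglongrightarrow> 0"
        unfolding \<rho>_def by (rule divisor_bound_negligible)
      show "R K \<longlonglongrightarrow> D / 4 ^ K"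
        unfolding R_def[abs_def] \<rho>_def D_def S_def by (rule block_error_tendsto[OF k])
    qed
    have "eventually (\<lambda>N. 2 * (real (q N) * S N / N) + 2 * (card (bad N) / N) + C * (\<rho> N / sqrt
        (loglog N)) + R K N < \<epsilon>) sequentially"
      by (rule order_tendstoD(2)[OF lims]) (use K in simp)
    thus "eventually (\<lambda>N. dist ((\<Sum>n\<in>{1..N}. G N n) / of_nat N) E < \<epsilon>) sequentially"
      using main[OF K(2)] by eventually_elim (simp add: dist_norm)
  qed
  have "Q = \<theta> \<bullet> \<theta>" by (simp add: Q_def inner_vec_def power2_eq_square)
  thus ?thesis using lim by (simp add: G_def E_def)
qed

theorem theorem1p5:
  fixes \<alpha> \<beta> :: "real^'k"
  assumes "\<And>i. \<alpha> $ i > 0"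
    and "\<And>i j. i \<noteq> j \<Longrightarrow> \<alpha> $ i / \<alpha> $ j \<notin> \<rat>"
  shows "converges_in_distribution
           (\<lambda>N. distr (measure_pmf (pmf_of_set {1..N})) borel (normalized_omega \<alpha> \<beta> N))
           (gaussian 0 (mat 1))"
proof (rule char_convergence.converges_in_distribution[OF char_convergence.intro])
  let ?\<mu> = "\<lambda>N. distr (measure_pmf (pmf_of_set {1..N})) borel (normalized_omega \<alpha> \<beta> N)"
  show "prob_space (?\<mu> N)" for N
    by (intro measure_pmf.prob_space_distr) simp
  show "sets (gaussian 0 (mat 1 :: real^'k^'k)) = sets borel" by (simp add: gaussian_def)
  fix t :: "real^'k"
  have cism: "(\<lambda>x::real^'k. cis (t \<bullet> x)) \<in> borel_measurable borel"
    unfolding cis_conv_exp by (intro borel_measurable_continuous_onI continuous_intros)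
  \<comment> \<open>For \<open>N = 0\<close> the uniform distribution is taken on the empty set and
    is unspecified, so the identity is claimed only eventually.\<close>
  have "eventually (\<lambda>N. (\<Sum>n\<in>{1..N}. cis (t \<bullet> normalized_omega \<alpha> \<beta> N n)) / of_nat N
      = (\<integral>x. cis (t \<bullet> x) \<partial>?\<mu> N)) sequentially"
    using eventually_gt_at_top[of 0]
  proof eventually_elim
    case (elim N)
    have "(\<integral>x. cis (t \<bullet> x) \<partial>?\<mu> N)
        = (\<integral>n. cis (t \<bullet> normalized_omega \<alpha> \<beta> N n) \<partial>measure_pmf (pmf_of_set {1..N}))"
      by (rule integral_distr) (simp_all add: cism)
    also have "\<dots> = (\<Sum>n\<in>{1..N}. pmf (pmf_of_set {1..N}) n *\<^sub>R cis (t \<bullet> normalized_omega \<alpha> \<beta> N n))"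
      using elim by (intro integral_measure_pmf) auto
    also have "\<dots> = (\<Sum>n\<in>{1..N}. cis (t \<bullet> normalized_omega \<alpha> \<beta> N n) / of_nat N)"
      using elim by (intro sum.cong refl) (auto simp: scaleR_conv_of_real indicator_def)
    finally show ?case by (simp add: sum_divide_distrib)
  qed
  with normalized_omega_char_tendsto[OF assms, of t \<beta>]
  show "(\<lambda>N. \<integral>x. cis (t \<bullet> x) \<partial>?\<mu> N)
      \<longlonglongrightarrow> (\<integral>x. cis (t \<bullet> x) \<partial>gaussian 0 (mat 1))"
    unfolding char_gaussian_std by (rule Lim_transform_eventually)
qed (auto intro: prob_space_gaussian_std)

end
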